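(* Let $\mathcal{G}$ and $\mathcal{H}$ be ample Hausdorff groupoids with $\sigma$-compact unit spaces. Then the following are equivalent: (1) $\mathcal{G}$ and $\mathcal{H}$ are similar; (2) $\mathcal{G}$ and $\mathcal{H}$ are Morita equivalent; (3) there exist an ample Hausdorff groupoid $\mathcal{L}$ and a decomposition $\mathcal{L}^{(0)} = X \sqcup Y$ of $\mathcal{L}^{(0)}$ into complementary full clopen subsets such that $\mathcal{L}|_X \cong \mathcal{G}$ and $\mathcal{L}|_Y \cong \mathcal{H}$; (4) $\mathcal{G}$ and $\mathcal{H}$ are equivalent in the sense of Renault; (5) $\mathcal{G}$ and $\mathcal{H}$ admit isomorphic ampliations; (6) $\mathcal{G} \times \mathcal{R} \cong \mathcal{H} \times \mathcal{R}$, where $\mathcal{R} = \mathbb{N}\times\mathbb{N}$ is the discrete full equivalence relation on $\mathbb{N}$; (7) $\mathcal{G}$ and $\mathcal{H}$ are Kakutani equivalent; and (8) $\mathcal{G}$ and $\mathcal{H}$ are weakly Kakutani equivalent.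
   Context: Groupoids. A groupoid $\mathcal{G}$ is a small category with inverses, with unit space $\mathcal{G}^{(0)}$ and range and source maps $r,s:\mathcal{G}\to\mathcal{G}^{(0)}$; $\gamma_1\gamma_2$ is defined when $s(\gamma_1)=r(\gamma_2)$. A topological groupoid carries a locally compact topology making all operations continuous, with $\mathcal{G}^{(0)}$ Hausdorff. It is Hausdorff if the topology of $\mathcal{G}$ is Hausdorff; étale if $\mathcal{G}^{(0)}$ is open and $r,s$ are local homeomorphisms; ample if it is étale and $\mathcal{G}^{(0)}$ is zero-dimensional (has a basis of compact open sets). Isomorphisms ($\cong$) are isomorphisms of topological groupoids. The orbit of $u\in\mathcal{G}^{(0)}$ is $[u]=\{r(\gamma):s(\gamma)=u\}$; $U\subseteq\mathcal{G}^{(0)}$ is full if it meets every orbit. $\mathcal{G}|_U=\{\gamma: r(\gamma),s(\gamma)\in U\}$. Similarity. Continuous homomorphisms $\rho,\sigma:\mathcal{G}\to\mathcal{H}$ of Hausdorff étale groupoids are similar if there is a continuous map $\theta:\mathcal{G}^{(0)}\to\mathcal{H}$ with $\theta(r(g))\rho(g)=\sigma(g)\theta(s(g))$ for all $g\in\mathcal{G}$. $\mathcal{G}$ and $\mathcal{H}$ are similar if there are étale homomorphisms (groupoid homomorphisms that are local homeomorphisms) $\rho:\mathcal{G}\to\mathcal{H}$ and $\sigma:\mathcal{H}\to\mathcal{G}$ with $\sigma\circ\rho$ similar to $\mathrm{id}_{\mathcal{G}}$ and $\rho\circ\sigma$ similar to $\mathrm{id}_{\mathcal{H}}$. Morita equivalence.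 A continuous functor $\varphi:\mathcal{G}\to\mathcal{H}$ is a weak equivalence if (i) the map $\{(u,\gamma)\in\mathcal{G}^{(0)}\times\mathcal{H}:\varphi(u)=r(\gamma)\}\to\mathcal{H}^{(0)}$, $(u,\gamma)\mapsto s(\gamma)$, is an étale surjection (a surjective local homeomorphism), and (ii) $g\mapsto(r(g),\varphi(g),s(g))$ is an isomorphism of $\mathcal{G}$ onto the fibred product $\{(u,\gamma,v)\in\mathcal{G}^{(0)}\times\mathcal{H}\times\mathcal{G}^{(0)}: r(\gamma)=\varphi(u),\ s(\gamma)=\varphi(v)\}$. $\mathcal{G}$ and $\mathcal{H}$ are Morita equivalent if there are a (Hausdorff étale) groupoid $\mathcal{K}$ and weak equivalences $\mathcal{K}\to\mathcal{G}$ and $\mathcal{K}\to\mathcal{H}$. Renault equivalence. A left $\mathcal{G}$-space is a locally compact Hausdorff space $Z$ with a continuous open map $r:Z\to\mathcal{G}^{(0)}$ and a continuous pairing $(g,z)\mapsto g\cdot z$ from $\mathcal{G}*Z=\{(g,z):s(g)=r(z)\}$ to $Z$ with $r(g\cdot z)=r(g)$, $(gh)\cdot z=g\cdot(h\cdot z)$ and $r(z)\cdot z=z$. It is free and proper if $(g,z)\mapsto(g\cdot z,z)$ is a proper injection $\mathcal{G}*Z\to Z\times Z$. Right spaces are defined analogously. $\mathcal{G}$ and $\mathcal{H}$ are equivalent in the sense of Renault if there is a locally compact Hausdorff space $Z$ that is a free and proper left $\mathcal{G}$-space with fibre map $r:Z\to\mathcal{G}^{(0)}$ and a free and proper right $\mathcal{H}$-space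 with fibre map $s:Z\to\mathcal{H}^{(0)}$, such that the two actions commute, $r$ induces a homeomorphism $Z/\mathcal{H}\to\mathcal{G}^{(0)}$, and $s$ induces a homeomorphism $\mathcal{G}\backslash Z\to\mathcal{H}^{(0)}$. Ampliations. For a locally compact Hausdorff space $X$ and a local homeomorphism $\psi:X\to\mathcal{G}^{(0)}$ (understood to be surjective), the ampliation is $\mathcal{G}^\psi=\{(x,\gamma,y)\in X\times\mathcal{G}\times X:\psi(x)=r(\gamma),\psi(y)=s(\gamma)\}$ with the relative topology and operations $(x,\gamma,y)(y,\eta,z)=(x,\gamma\eta,z)$, $(x,\gamma,y)^{-1}=(y,\gamma^{-1},x)$. $\mathcal{G}$ and $\mathcal{H}$ admit isomorphic ampliations if some ampliation of $\mathcal{G}$ is isomorphic to some ampliation of $\mathcal{H}$. Kakutani equivalence. $\mathcal{G}$ and $\mathcal{H}$ are weakly Kakutani equivalent if there are full open subsets $X\subseteq\mathcal{G}^{(0)}$, $Y\subseteq\mathcal{H}^{(0)}$ with $\mathcal{G}|_X\cong\mathcal{H}|_Y$; they are Kakutani equivalent if $X,Y$ can be chosen clopen. *)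

theory Defs
  imports "HOL-Analysis.Analysis"
begin

section \<open>Local homeomorphisms and quotient spaces\<close>

definition local_homeomorphism :: "'a topology \<Rightarrow> 'b topology \<Rightarrow> ('a \<Rightarrow> 'b) \<Rightarrow> bool" where
  "local_homeomorphism X Y f \<longleftrightarrow>
     f ` topspace X \<subseteq> topspace Y \<and>
     (\<forall>x \<in> topspace X. \<exists>U. openin X U \<and> x \<in> U \<and> openin Y (f ` U) \<and>
        homeomorphic_map (subtopology X U) (subtopology Y (f ` U)) f)"

definition zero_dimensional_space :: "'a topology \<Rightarrow> bool" where
  "zero_dimensional_space X \<longleftrightarrow>
     (\<forall>U x. openin X U \<and> x \<in> U \<longrightarrow>
        (\<exists>K. openin X K \<and> compactin X K \<and> x \<in> K \<and> K \<subseteq> U))"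

definition sigma_compact_space :: "'a topology \<Rightarrow> bool" where
  "sigma_compact_space X \<longleftrightarrow>
     (\<exists>\<K>. countable \<K> \<and> (\<forall>K \<in> \<K>. compactin X K) \<and> \<Union>\<K> = topspace X)"

definition clopenin :: "'a topology \<Rightarrow> 'a set \<Rightarrow> bool" where
  "clopenin X U \<longleftrightarrow> openin X U \<and> closedin X U"

text \<open>The quotient topology on the image of \<open>q\<close>, for instance on a set of orbits.\<close>

definition quotient_topology :: "'a topology \<Rightarrow> ('a \<Rightarrow> 'b) \<Rightarrow> 'b topology" where
  "quotient_topology X q =
     topology (\<lambda>V. V \<subseteq> q ` topspace X \<and> openin X {x \<in> topspace X. q x \<in> V})"

lemma openin_quotient_topology:
  "openin (quotient_topology X q) V \<longleftrightarrow>
     V \<subseteq> q ` topspace X \<and> openin X {x \<in> topspace X. q x \<in> V}"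
proof -
  have "istopology (\<lambda>V. V \<subseteq> q ` topspace X \<and> openin X {x \<in> topspace X. q x \<in> V})"
    unfolding istopology_def
  proof (intro conjI allI impI)
    fix S T
    assume S: "S \<subseteq> q ` topspace X \<and> openin X {x \<in> topspace X. q x \<in> S}"
      and T: "T \<subseteq> q ` topspace X \<and> openin X {x \<in> topspace X. q x \<in> T}"
    show "S \<inter> T \<subseteq> q ` topspace X" using S by auto
    have "{x \<in> topspace X. q x \<in> S \<inter> T} =
        {x \<in> topspace X. q x \<in> S} \<inter> {x \<in> topspace X. q x \<in> T}" by blast
    then show "openin X {x \<in> topspace X. q x \<in> S \<inter> T}" using S T by auto
  next
    fix \<K>
    assume K: "\<forall>K\<in>\<K>. K \<subseteq> q ` topspace X \<and> openin X {x \<in> topspace X. q x \<in> K}"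
    show "\<Union>\<K> \<subseteq> q ` topspace X" using K by blast
    have "{x \<in> topspace X. q x \<in> \<Union>\<K>} = (\<Union>K\<in>\<K>. {x \<in> topspace X. q x \<in> K})" by blast
    then show "openin X {x \<in> topspace X. q x \<in> \<Union>\<K>}" using K by auto
  qed
  then show ?thesis unfolding quotient_topology_def by (simp only: topology_inverse')
qed

lemma topspace_quotient_topology [simp]: "topspace (quotient_topology X q) = q ` topspace X"
proof (rule subset_antisym)
  show "topspace (quotient_topology X q) \<subseteq> q ` topspace X"
    using openin_topspace[of "quotient_topology X q"]
    unfolding openin_quotient_topology[of X q] by (rule conjunct1)
  have "{x \<in> topspace X. q x \<in> q ` topspace X} = topspace X" by auto
  then show "q ` topspace X \<subseteq> topspace (quotient_topology X q)"
    by (intro openin_subset) (simp only: openin_quotient_topology openin_topspace order_refl)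
qed

definition induces_homeomorphism ::
    "'a topology \<Rightarrow> ('a \<Rightarrow> 'c) \<Rightarrow> 'b topology \<Rightarrow> ('a \<Rightarrow> 'b) \<Rightarrow> bool" where
  "induces_homeomorphism X q Y f \<longleftrightarrow>
     (\<exists>h. homeomorphic_map (quotient_topology X q) Y h \<and> (\<forall>x \<in> topspace X. h (q x) = f x))"


section \<open>Topological groupoids\<close>

text \<open>
  A groupoid is given by its arrows, which are the points of \<open>gtop\<close>; units are identified with
  identity arrows.  The operations are total functions whose values are only relevant on arrows,
  and for \<open>gmult g h\<close> only when \<open>gsrc g = grng h\<close>.
\<close>

record 'a grpd =
  gtop :: "'a topology"
  grng :: "'a \<Rightarrow> 'a"
  gsrc :: "'a \<Rightarrow> 'a"
  gmult :: "'a \<Rightarrow> 'a \<Rightarrow> 'a"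
  ginv :: "'a \<Rightarrow> 'a"

definition arrows :: "'a grpd \<Rightarrow> 'a set" where
  "arrows G = topspace (gtop G)"

definition units :: "'a grpd \<Rightarrow> 'a set" where
  "units G = {g \<in> arrows G. grng G g = g \<and> gsrc G g = g}"

definition unit_space :: "'a grpd \<Rightarrow> 'a topology" where
  "unit_space G = subtopology (gtop G) (units G)"

definition composable :: "'a grpd \<Rightarrow> ('a \<times> 'a) set" where
  "composable G = {(g, h). g \<in> arrows G \<and> h \<in> arrows G \<and> gsrc G g = grng G h}"

locale groupoid =
  fixes G :: "'a grpd"
  assumes rng_unit: "g \<in> arrows G \<Longrightarrow> grng G g \<in> units G"
    and src_unit: "g \<in> arrows G \<Longrightarrow> gsrc G g \<in> units G"
    and mult_closed: "(g, h) \<in> composable G \<Longrightarrow> gmult G g h \<in> arrows G"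
    and rng_mult: "(g, h) \<in> composable G \<Longrightarrow> grng G (gmult G g h) = grng G g"
    and src_mult: "(g, h) \<in> composable G \<Longrightarrow> gsrc G (gmult G g h) = gsrc G h"
    and mult_assoc: "(g, h) \<in> composable G \<Longrightarrow> (h, k) \<in> composable G \<Longrightarrow>
          gmult G (gmult G g h) k = gmult G g (gmult G h k)"
    and unit_left: "g \<in> arrows G \<Longrightarrow> gmult G (grng G g) g = g"
    and unit_right: "g \<in> arrows G \<Longrightarrow> gmult G g (gsrc G g) = g"
    and inv_closed: "g \<in> arrows G \<Longrightarrow> ginv G g \<in> arrows G"
    and rng_inv: "g \<in> arrows G \<Longrightarrow> grng G (ginv G g) = gsrc G g"
    and src_inv: "g \<in> arrows G \<Longrightarrow> gsrc G (ginv G g) = grng G g"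
    and inv_right: "g \<in> arrows G \<Longrightarrow> gmult G g (ginv G g) = grng G g"
    and inv_left: "g \<in> arrows G \<Longrightarrow> gmult G (ginv G g) g = gsrc G g"

locale topological_groupoid = groupoid G for G :: "'a grpd" +
  assumes locally_compact: "locally_compact_space (gtop G)"
    and Hausdorff_unit_space: "Hausdorff_space (unit_space G)"
    and continuous_rng: "continuous_map (gtop G) (unit_space G) (grng G)"
    and continuous_src: "continuous_map (gtop G) (unit_space G) (gsrc G)"
    and continuous_mult: "continuous_map
          (subtopology (prod_topology (gtop G) (gtop G)) (composable G)) (gtop G)
          (\<lambda>(g, h). gmult G g h)"
    and continuous_inv: "continuous_map (gtop G) (gtop G) (ginv G)"

locale Hausdorff_groupoid = topological_groupoid G for G :: "'a grpd" +
  assumes Hausdorff: "Hausdorff_space (gtop G)"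

locale etale_groupoid = topological_groupoid G for G :: "'a grpd" +
  assumes open_units: "openin (gtop G) (units G)"
    and etale_rng: "local_homeomorphism (gtop G) (unit_space G) (grng G)"
    and etale_src: "local_homeomorphism (gtop G) (unit_space G) (gsrc G)"

locale Hausdorff_etale_groupoid = Hausdorff_groupoid G + etale_groupoid G for G :: "'a grpd"

locale ample_groupoid = etale_groupoid G for G :: "'a grpd" +
  assumes zero_dimensional_unit_space: "zero_dimensional_space (unit_space G)"

locale ample_Hausdorff_groupoid = Hausdorff_groupoid G + ample_groupoid G for G :: "'a grpd"

definition orbit :: "'a grpd \<Rightarrow> 'a \<Rightarrow> 'a set" where
  "orbit G u = {grng G g | g. g \<in> arrows G \<and> gsrc G g = u}"

definition full :: "'a grpd \<Rightarrow> 'a set \<Rightarrow> bool" where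
  "full G U \<longleftrightarrow> U \<subseteq> units G \<and> (\<forall>u \<in> units G. U \<inter> orbit G u \<noteq> {})"

definition reduction :: "'a grpd \<Rightarrow> 'a set \<Rightarrow> 'a grpd" where
  "reduction G U =
     G\<lparr>gtop := subtopology (gtop G) {g \<in> arrows G. grng G g \<in> U \<and> gsrc G g \<in> U}\<rparr>"

definition groupoid_hom :: "'a grpd \<Rightarrow> 'b grpd \<Rightarrow> ('a \<Rightarrow> 'b) \<Rightarrow> bool" where
  "groupoid_hom G H \<phi> \<longleftrightarrow>
     (\<forall>g \<in> arrows G. \<phi> g \<in> arrows H \<and> \<phi> (grng G g) = grng H (\<phi> g) \<and> \<phi> (gsrc G g) = gsrc H (\<phi> g)) \<and>
     (\<forall>(g, h) \<in> composable G. \<phi> (gmult G g h) = gmult H (\<phi> g) (\<phi> h))"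

definition continuous_hom :: "'a grpd \<Rightarrow> 'b grpd \<Rightarrow> ('a \<Rightarrow> 'b) \<Rightarrow> bool" where
  "continuous_hom G H \<phi> \<longleftrightarrow> groupoid_hom G H \<phi> \<and> continuous_map (gtop G) (gtop H) \<phi>"

definition etale_hom :: "'a grpd \<Rightarrow> 'b grpd \<Rightarrow> ('a \<Rightarrow> 'b) \<Rightarrow> bool" where
  "etale_hom G H \<phi> \<longleftrightarrow> groupoid_hom G H \<phi> \<and> local_homeomorphism (gtop G) (gtop H) \<phi>"

definition groupoid_iso :: "'a grpd \<Rightarrow> 'b grpd \<Rightarrow> ('a \<Rightarrow> 'b) \<Rightarrow> bool" where
  "groupoid_iso G H \<phi> \<longleftrightarrow> groupoid_hom G H \<phi> \<and> homeomorphic_map (gtop G) (gtop H) \<phi>"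

definition isomorphic :: "'a grpd \<Rightarrow> 'b grpd \<Rightarrow> bool"  (infix \<open>\<cong>\<^sub>G\<close> 50) where
  "G \<cong>\<^sub>G H \<longleftrightarrow> (\<exists>\<phi>. groupoid_iso G H \<phi>)"

definition prod_groupoid :: "'a grpd \<Rightarrow> 'b grpd \<Rightarrow> ('a \<times> 'b) grpd"  (infixr \<open>\<times>\<^sub>G\<close> 70) where
  "G \<times>\<^sub>G H =
     \<lparr>gtop = prod_topology (gtop G) (gtop H),
      grng = map_prod (grng G) (grng H),
      gsrc = map_prod (gsrc G) (gsrc H),
      gmult = (\<lambda>(g, h) (g', h'). (gmult G g g', gmult H h h')),
      ginv = map_prod (ginv G) (ginv H)\<rparr>"

definition full_equivalence_relation :: "(nat \<times> nat) grpd"  (\<open>\<R>\<close>) where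
  "\<R> =
     \<lparr>gtop = discrete_topology UNIV,
      grng = (\<lambda>(m, n). (m, m)),
      gsrc = (\<lambda>(m, n). (n, n)),
      gmult = (\<lambda>(m, n) (n', p). (m, p)),
      ginv = (\<lambda>(m, n). (n, m))\<rparr>"

text \<open>
  The groupoid on \<open>{(x, \<gamma>, y). \<psi> x = r \<gamma> \<and> \<psi> y = s \<gamma>}\<close>, for a map \<open>\<psi>\<close> from \<open>X\<close> to the units
  of \<open>G\<close>.  It serves both as the ampliation of \<open>G\<close> along a surjective local homeomorphism \<open>\<psi>\<close>
  and as the fibred product in the definition of a weak equivalence.
\<close>

definition fibred_groupoid ::
    "'a grpd \<Rightarrow> 'x topology \<Rightarrow> ('x \<Rightarrow> 'a) \<Rightarrow> ('x \<times> 'a \<times> 'x) grpd" where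
  "fibred_groupoid G X \<psi> =
     \<lparr>gtop = subtopology (prod_topology X (prod_topology (gtop G) X))
               {(x, \<gamma>, y). \<psi> x = grng G \<gamma> \<and> \<psi> y = gsrc G \<gamma>},
      grng = (\<lambda>(x, \<gamma>, y). (x, grng G \<gamma>, x)),
      gsrc = (\<lambda>(x, \<gamma>, y). (y, gsrc G \<gamma>, y)),
      gmult = (\<lambda>(x, \<gamma>, y) (y', \<eta>, z). (x, gmult G \<gamma> \<eta>, z)),
      ginv = (\<lambda>(x, \<gamma>, y). (y, ginv G \<gamma>, x))\<rparr>"


section \<open>Notions of equivalence\<close>

text \<open>
  Several notions assert the existence of an auxiliary groupoid or space.  Such a notion takes an
  argument of type \<open>'u itself\<close>, the type in which the auxiliary object is sought.
\<close>

subsection \<open>Similarity\<close>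

text \<open>The first two equations in the body say that both products in the third are defined.\<close>

definition similar_homs ::
    "'a grpd \<Rightarrow> 'b grpd \<Rightarrow> ('a \<Rightarrow> 'b) \<Rightarrow> ('a \<Rightarrow> 'b) \<Rightarrow> bool" where
  "similar_homs G H \<rho> \<sigma> \<longleftrightarrow>
     continuous_hom G H \<rho> \<and> continuous_hom G H \<sigma> \<and>
     (\<exists>\<theta>. continuous_map (unit_space G) (gtop H) \<theta> \<and>
        (\<forall>g \<in> arrows G.
           gsrc H (\<theta> (grng G g)) = grng H (\<rho> g) \<and>
           gsrc H (\<sigma> g) = grng H (\<theta> (gsrc G g)) \<and>
           gmult H (\<theta> (grng G g)) (\<rho> g) = gmult H (\<sigma> g) (\<theta> (gsrc G g))))"

definition similar :: "'a grpd \<Rightarrow> 'b grpd \<Rightarrow> bool" where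
  "similar G H \<longleftrightarrow>
     (\<exists>\<rho> \<sigma>. etale_hom G H \<rho> \<and> etale_hom H G \<sigma> \<and>
        similar_homs G G (\<sigma> \<circ> \<rho>) id \<and> similar_homs H H (\<rho> \<circ> \<sigma>) id)"


subsection \<open>Morita equivalence\<close>

definition weak_equivalence :: "'a grpd \<Rightarrow> 'b grpd \<Rightarrow> ('a \<Rightarrow> 'b) \<Rightarrow> bool" where
  "weak_equivalence G H \<phi> \<longleftrightarrow>
     continuous_hom G H \<phi> \<and>
     (let P = subtopology (prod_topology (unit_space G) (gtop H)) {(u, \<gamma>). \<phi> u = grng H \<gamma>};
          p = (\<lambda>(u, \<gamma>). gsrc H \<gamma>)
      in local_homeomorphism P (unit_space H) p \<and> p ` topspace P = units H) \<and>
     groupoid_iso G (fibred_groupoid H (unit_space G) \<phi>) (\<lambda>g. (grng G g, \<phi> g, gsrc G g))"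

definition Morita_equivalent :: "'u itself \<Rightarrow> 'a grpd \<Rightarrow> 'b grpd \<Rightarrow> bool" where
  "Morita_equivalent T G H \<longleftrightarrow>
     (\<exists>(K :: 'u grpd) \<phi> \<psi>. Hausdorff_etale_groupoid K \<and>
        weak_equivalence K G \<phi> \<and> weak_equivalence K H \<psi>)"


subsection \<open>Linking groupoids\<close>

definition has_linking_groupoid :: "'u itself \<Rightarrow> 'a grpd \<Rightarrow> 'b grpd \<Rightarrow> bool" where
  "has_linking_groupoid T G H \<longleftrightarrow>
     (\<exists>(L :: 'u grpd) X Y. ample_Hausdorff_groupoid L \<and>
        X \<union> Y = units L \<and> X \<inter> Y = {} \<and>
        clopenin (unit_space L) X \<and> clopenin (unit_space L) Y \<and> full L X \<and> full L Y \<and>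
        reduction L X \<cong>\<^sub>G G \<and> reduction L Y \<cong>\<^sub>G H)"


subsection \<open>Equivalence in the sense of Renault\<close>

definition left_fibred :: "'a grpd \<Rightarrow> 'z topology \<Rightarrow> ('z \<Rightarrow> 'a) \<Rightarrow> ('a \<times> 'z) set" where
  "left_fibred G Z r = {(g, z). g \<in> arrows G \<and> z \<in> topspace Z \<and> gsrc G g = r z}"

definition left_space ::
    "'a grpd \<Rightarrow> 'z topology \<Rightarrow> ('z \<Rightarrow> 'a) \<Rightarrow> ('a \<Rightarrow> 'z \<Rightarrow> 'z) \<Rightarrow> bool" where
  "left_space G Z r act \<longleftrightarrow>
     locally_compact_space Z \<and> Hausdorff_space Z \<and>
     continuous_map Z (unit_space G) r \<and> open_map Z (unit_space G) r \<and>
     continuous_map (subtopology (prod_topology (gtop G) Z) (left_fibred G Z r)) Z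
       (\<lambda>(g, z). act g z) \<and>
     (\<forall>(g, z) \<in> left_fibred G Z r. r (act g z) = grng G g) \<and>
     (\<forall>g h z. (g, h) \<in> composable G \<and> (h, z) \<in> left_fibred G Z r \<longrightarrow>
        act (gmult G g h) z = act g (act h z)) \<and>
     (\<forall>z \<in> topspace Z. act (r z) z = z)"

definition left_free_proper ::
    "'a grpd \<Rightarrow> 'z topology \<Rightarrow> ('z \<Rightarrow> 'a) \<Rightarrow> ('a \<Rightarrow> 'z \<Rightarrow> 'z) \<Rightarrow> bool" where
  "left_free_proper G Z r act \<longleftrightarrow>
     inj_on (\<lambda>(g, z). (act g z, z)) (left_fibred G Z r) \<and>
     proper_map (subtopology (prod_topology (gtop G) Z) (left_fibred G Z r)) (prod_topology Z Z)
       (\<lambda>(g, z). (act g z, z))"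

definition left_orbit :: "'a grpd \<Rightarrow> ('z \<Rightarrow> 'a) \<Rightarrow> ('a \<Rightarrow> 'z \<Rightarrow> 'z) \<Rightarrow> 'z \<Rightarrow> 'z set" where
  "left_orbit G r act z = {act g z | g. g \<in> arrows G \<and> gsrc G g = r z}"

definition right_fibred :: "'b grpd \<Rightarrow> 'z topology \<Rightarrow> ('z \<Rightarrow> 'b) \<Rightarrow> ('z \<times> 'b) set" where
  "right_fibred H Z s = {(z, h). z \<in> topspace Z \<and> h \<in> arrows H \<and> s z = grng H h}"

definition right_space ::
    "'b grpd \<Rightarrow> 'z topology \<Rightarrow> ('z \<Rightarrow> 'b) \<Rightarrow> ('z \<Rightarrow> 'b \<Rightarrow> 'z) \<Rightarrow> bool" where
  "right_space H Z s act \<longleftrightarrow>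
     locally_compact_space Z \<and> Hausdorff_space Z \<and>
     continuous_map Z (unit_space H) s \<and> open_map Z (unit_space H) s \<and>
     continuous_map (subtopology (prod_topology Z (gtop H)) (right_fibred H Z s)) Z
       (\<lambda>(z, h). act z h) \<and>
     (\<forall>(z, h) \<in> right_fibred H Z s. s (act z h) = gsrc H h) \<and>
     (\<forall>z h k. (z, h) \<in> right_fibred H Z s \<and> (h, k) \<in> composable H \<longrightarrow>
        act z (gmult H h k) = act (act z h) k) \<and>
     (\<forall>z \<in> topspace Z. act z (s z) = z)"

definition right_free_proper ::
    "'b grpd \<Rightarrow> 'z topology \<Rightarrow> ('z \<Rightarrow> 'b) \<Rightarrow> ('z \<Rightarrow> 'b \<Rightarrow> 'z) \<Rightarrow> bool" where
  "right_free_proper H Z s act \<longleftrightarrow>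
     inj_on (\<lambda>(z, h). (z, act z h)) (right_fibred H Z s) \<and>
     proper_map (subtopology (prod_topology Z (gtop H)) (right_fibred H Z s)) (prod_topology Z Z)
       (\<lambda>(z, h). (z, act z h))"

definition right_orbit :: "'b grpd \<Rightarrow> ('z \<Rightarrow> 'b) \<Rightarrow> ('z \<Rightarrow> 'b \<Rightarrow> 'z) \<Rightarrow> 'z \<Rightarrow> 'z set" where
  "right_orbit H s act z = {act z h | h. h \<in> arrows H \<and> s z = grng H h}"

text \<open>The first two equations in the body say that both sides of the third are defined.\<close>

definition actions_commute ::
    "'a grpd \<Rightarrow> 'b grpd \<Rightarrow> 'z topology \<Rightarrow> ('z \<Rightarrow> 'a) \<Rightarrow> ('z \<Rightarrow> 'b) \<Rightarrow>
       ('a \<Rightarrow> 'z \<Rightarrow> 'z) \<Rightarrow> ('z \<Rightarrow> 'b \<Rightarrow> 'z) \<Rightarrow> bool" where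
  "actions_commute G H Z r s lact ract \<longleftrightarrow>
     (\<forall>g z h. (g, z) \<in> left_fibred G Z r \<and> (z, h) \<in> right_fibred H Z s \<longrightarrow>
        s (lact g z) = s z \<and> r (ract z h) = r z \<and>
        ract (lact g z) h = lact g (ract z h))"

definition Renault_equivalent :: "'u itself \<Rightarrow> 'a grpd \<Rightarrow> 'b grpd \<Rightarrow> bool" where
  "Renault_equivalent T G H \<longleftrightarrow>
     (\<exists>(Z :: 'u topology) r s lact ract.
        left_space G Z r lact \<and> left_free_proper G Z r lact \<and>
        right_space H Z s ract \<and> right_free_proper H Z s ract \<and>
        actions_commute G H Z r s lact ract \<and>
        induces_homeomorphism Z (right_orbit H s ract) (unit_space G) r \<and>
        induces_homeomorphism Z (left_orbit G r lact) (unit_space H) s)"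


subsection \<open>Ampliations\<close>

definition ampliation_map :: "'a grpd \<Rightarrow> 'x topology \<Rightarrow> ('x \<Rightarrow> 'a) \<Rightarrow> bool" where
  "ampliation_map G X \<psi> \<longleftrightarrow>
     locally_compact_space X \<and> Hausdorff_space X \<and>
     local_homeomorphism X (unit_space G) \<psi> \<and> \<psi> ` topspace X = units G"

definition isomorphic_ampliations :: "'u itself \<Rightarrow> 'a grpd \<Rightarrow> 'b grpd \<Rightarrow> bool" where
  "isomorphic_ampliations T G H \<longleftrightarrow>
     (\<exists>(X :: 'u topology) \<psi> (Y :: 'u topology) \<eta>.
        ampliation_map G X \<psi> \<and> ampliation_map H Y \<eta> \<and>
        fibred_groupoid G X \<psi> \<cong>\<^sub>G fibred_groupoid H Y \<eta>)"


subsection \<open>Kakutani equivalence\<close>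

definition weakly_Kakutani_equivalent :: "'a grpd \<Rightarrow> 'b grpd \<Rightarrow> bool" where
  "weakly_Kakutani_equivalent G H \<longleftrightarrow>
     (\<exists>X Y. openin (unit_space G) X \<and> full G X \<and> openin (unit_space H) Y \<and> full H Y \<and>
        reduction G X \<cong>\<^sub>G reduction H Y)"

definition Kakutani_equivalent :: "'a grpd \<Rightarrow> 'b grpd \<Rightarrow> bool" where
  "Kakutani_equivalent G H \<longleftrightarrow>
     (\<exists>X Y. clopenin (unit_space G) X \<and> full G X \<and> clopenin (unit_space H) Y \<and> full H Y \<and>
        reduction G X \<cong>\<^sub>G reduction H Y)"


subsection \<open>A universe for auxiliary objects\<close>

text \<open>
  HOL cannot quantify over types within a formula, so auxiliary objects are sought in the following
  type.  Lists over an infinite type are closed under products up to bijection, so that groupoids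
  and spaces built from \<open>'a\<close>, \<open>'b\<close> and countable index sets can be copied into it.  The parameter
  \<open>'w\<close> is unconstrained, so a theorem about \<open>universe\<close> covers auxiliary objects in every type.
\<close>

type_synonym ('a, 'b, 'w) universe = "('a + 'b + nat + 'w) list"

end

theory Submission
  imports Defs
begin

text \<open>
  Everything is compared with one device: a \<^emph>\<open>bridge\<close>, that is a space \<open>X\<close> with local
  homeomorphisms to both unit spaces, meeting all orbits, such that the two pullback groupoids over
  \<open>X\<close> are isomorphic over \<open>X\<close>.  Each of the eight relations leads to bridges, and both maps of a bridge
  can be made surjective.  Compact open sets on which both maps are injective then act as bisections
  between \<open>G\<close> and \<open>H\<close>, and by \<open>\<sigma>\<close>-compactness countably many of them cover both unit spaces.

  Discarding from the \<open>n\<close>-th of these sets every point whose image already lies in the image of an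
  earlier one (kept or not) leaves a locally finite disjoint family, whence full clopen sets with
  isomorphic reductions.  After multiplication with \<open>\<R>\<close>, a back-and-forth argument that always moves
  to a fresh index of \<open>\<nat>\<close> exhausts both unit spaces, whence \<open>G \<times> \<R> \<cong> H \<times> \<R>\<close>.  The corners
  of such an isomorphism are similar homomorphisms, and a similarity \<open>\<rho>\<close> from \<open>G\<close> to \<open>H\<close> is a bridge
  over the unit space of \<open>G\<close> which makes \<open>{(u, h). \<rho> u = r h}\<close> an equivalence in the sense of Renault.
  A linking groupoid is a reduction of \<open>G \<times> \<R> \<times> \<R>\<close>.
\<close>

section \<open>Local homeomorphisms\<close>

text \<open>The groupoids and spaces hidden in the definitions carry no countability assumption, so
  a bridge may live over an arbitrarily large \<open>X\<close>. Only countably many compact open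
  pieces of \<open>X\<close> are ever used, and \<sigma>-compactness of the two unit spaces alone
  selects them. Two greedy selections occur because their goals conflict. A clopen image needs local
  finiteness, so a piece avoids everything that earlier pieces touched; points may then stay
  uncovered, and only their orbits are met. An isomorphism of the stabilised groupoids needs every
  unit covered exactly once, so a piece avoids only what was kept; but a point is then rejected as
  soon as one of its images is taken, while the other may still be free. A fresh index in \<R>
  removes this clash. Auxiliary objects have to live in a prescribed type. Implications that consume
  one therefore hold for an arbitrary type, while those that produce one build it in its natural
  type and copy it along an injection. Stable isomorphism mentions no such type and so serves as the
  hub between the two kinds.\<close>

lemma continuous_map_o:
  "continuous_map X Y f \<Longrightarrow> continuous_map Y Z g \<Longrightarrow> continuous_map X Z (\<lambda>x. g (f x))"
  using continuous_map_compose[of X Y f Z g] by (simp add: o_def)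

text \<open>An injective continuous open map is an embedding, so a neighbourhood on which the map is
  injective already yields the local homeomorphism. The right-hand side separates continuity and
  openness, which are global, from local injectivity, and most closure properties below are checked
  on these three parts.\<close>

lemma local_homeomorphism_iff:
  "local_homeomorphism X Y f \<longleftrightarrow> continuous_map X Y f \<and> open_map X Y f \<and>
     (\<forall>x \<in> topspace X. \<exists>U. openin X U \<and> x \<in> U \<and> inj_on f U)" (is "?l \<longleftrightarrow> ?r")
proof
  assume l: ?l
  then have fX: "f ` topspace X \<subseteq> topspace Y" unfolding local_homeomorphism_def by blast
  define \<U> where "\<U> = {U. openin X U \<and> openin Y (f ` U) \<and>
     homeomorphic_map (subtopology X U) (subtopology Y (f ` U)) f}"
  have cov: "\<exists>U \<in> \<U>. x \<in> U" if "x \<in> topspace X" for x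
    using l that unfolding local_homeomorphism_def \<U>_def by blast
  have inj: "inj_on f U" if "U \<in> \<U>" for U
    using that unfolding \<U>_def homeomorphic_map_def by (auto dest: openin_subset simp: Int_absorb1)
  have cont: "continuous_map X Y f"
    unfolding continuous_map_def
  proof (intro conjI allI impI)
    show "f \<in> topspace X \<rightarrow> topspace Y" using fX by auto
    fix V assume V: "openin Y V"
    show "openin X {x \<in> topspace X. f x \<in> V}"
    proof (subst openin_subopen, safe)
      fix x assume x: "x \<in> topspace X" "f x \<in> V"
      then obtain U where U: "U \<in> \<U>" "x \<in> U" using cov by blast
      have "continuous_map (subtopology X U) Y f"
        using U unfolding \<U>_def by (auto dest!: homeomorphic_imp_continuous_map simp:
          continuous_map_in_subtopology)
      then have "openin (subtopology X U) {x \<in> topspace (subtopology X U). f x \<in> V}"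
        using V unfolding continuous_map_def by blast
      then have "openin X {x \<in> topspace (subtopology X U). f x \<in> V}"
        using U unfolding \<U>_def by (auto intro: openin_trans_full)
      then show "\<exists>T. openin X T \<and> x \<in> T \<and> T \<subseteq> {x \<in> topspace X. f x \<in> V}"
        using x U by (intro exI[of _ "{x \<in> topspace (subtopology X U). f x \<in> V}"]) auto
    qed
  qed
  have "open_map X Y f"
    unfolding open_map_def
  proof (intro allI impI)
    fix V assume V: "openin X V"
    show "openin Y (f ` V)"
    proof (subst openin_subopen, safe)
      fix x assume x: "x \<in> V"
      then obtain U where U: "U \<in> \<U>" "x \<in> U" using cov V openin_subset by blast
      have "open_map (subtopology X U) (subtopology Y (f ` U)) f"
        using U unfolding \<U>_def by (auto dest!: homeomorphic_imp_open_map)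
      then have "openin (subtopology Y (f ` U)) (f ` (U \<inter> V))"
        using V unfolding open_map_def by (auto simp: openin_subtopology_Int2)
      then have "openin Y (f ` (U \<inter> V))"
        using U unfolding \<U>_def by (auto intro: openin_trans_full)
      then show "\<exists>T. openin Y T \<and> f x \<in> T \<and> T \<subseteq> f ` V"
        using x U by (intro exI[of _ "f ` (U \<inter> V)"]) auto
    qed
  qed
  then show ?r using cont inj cov unfolding \<U>_def by blast
next
  assume r: ?r
  show ?l unfolding local_homeomorphism_def
  proof (intro conjI ballI)
    show "f ` topspace X \<subseteq> topspace Y" using r by (auto dest: continuous_map_funspace)
    fix x assume "x \<in> topspace X"
    then obtain U where U: "openin X U" "x \<in> U" "inj_on f U" using r by blast
    have "homeomorphic_map (subtopology X U) (subtopology Y (f ` U)) f"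
    proof -
      have "embedding_map (subtopology X U) Y f"
        using r U
        by (intro injective_open_imp_embedding_map continuous_map_from_subtopology
            open_map_from_subtopology) (auto simp: inj_on_def)
      moreover have "topspace (subtopology X U) = U" using U openin_subset by auto
      ultimately show ?thesis unfolding embedding_map_def by simp
    qed
    moreover have "openin Y (f ` U)" using r U unfolding open_map_def by blast
    ultimately show "\<exists>U. openin X U \<and> x \<in> U \<and> openin Y (f ` U) \<and>
        homeomorphic_map (subtopology X U) (subtopology Y (f ` U)) f" using U by blast
  qed
qed

lemma local_homeomorphismD:
  assumes "local_homeomorphism X Y f"
  shows "continuous_map X Y f" "open_map X Y f"
    "x \<in> topspace X \<Longrightarrow> \<exists>U. openin X U \<and> x \<in> U \<and> inj_on f U"
  using assms unfolding local_homeomorphism_iff by auto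

lemma local_homeomorphism_funcset:
  "local_homeomorphism X Y f \<Longrightarrow> x \<in> topspace X \<Longrightarrow> f x \<in> topspace Y"
  unfolding local_homeomorphism_def by blast

lemma local_homeomorphism_eq:
  assumes "local_homeomorphism X Y f" "\<And>x. x \<in> topspace X \<Longrightarrow> f x = g x"
  shows "local_homeomorphism X Y g"
proof -
  have "inj_on g U \<longleftrightarrow> inj_on f U" if "openin X U" for U
    using that assms(2) by (metis (no_types, lifting) inj_on_cong openin_subset subset_eq)
  then show ?thesis using assms unfolding local_homeomorphism_iff
    by (metis continuous_map_eq open_map_eq)
qed

lemma local_homeomorphism_compose:
  assumes f: "local_homeomorphism X Y f" and g: "local_homeomorphism Y Z g"
  shows "local_homeomorphism X Z (\<lambda>x. g (f x))"
  unfolding local_homeomorphism_iff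
proof (intro conjI ballI)
  show "continuous_map X Z (\<lambda>x. g (f x))"
    using f g by (blast intro: continuous_map_o dest: local_homeomorphismD)
  show "open_map X Z (\<lambda>x. g (f x))"
    using open_map_compose[of X Y f Z g] f g by (simp add: local_homeomorphism_iff o_def)
  fix x assume x: "x \<in> topspace X"
  obtain U where U: "openin X U" "x \<in> U" "inj_on f U" using local_homeomorphismD(3)[OF f x] by blast
  obtain V where V: "openin Y V" "f x \<in> V" "inj_on g V"
    using local_homeomorphismD(3)[OF g] local_homeomorphism_funcset[OF f x] by blast
  show "\<exists>U. openin X U \<and> x \<in> U \<and> inj_on (\<lambda>x. g (f x)) U"
    using U V x openin_continuous_map_preimage[OF local_homeomorphismD(1)[OF f] V(1)]
    by (intro exI[of _ "U \<inter> {x \<in> topspace X. f x \<in> V}"]) (auto simp: inj_on_def)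
qed

lemma homeomorphic_imp_local_homeomorphism:
  "homeomorphic_map X Y f \<Longrightarrow> local_homeomorphism X Y f"
  unfolding local_homeomorphism_iff
  by (auto simp: homeomorphic_imp_continuous_map homeomorphic_imp_open_map
      intro!: exI[of _ "topspace X"] dest: homeomorphic_imp_injective_map)

lemma local_homeomorphism_open_subtopology:
  assumes f: "local_homeomorphism X Y f" and U: "openin X U" and V: "f ` U \<subseteq> V"
  shows "local_homeomorphism (subtopology X U) (subtopology Y V) f"
  unfolding local_homeomorphism_iff
proof (intro conjI ballI)
  have UX: "topspace X \<inter> U = U" using U openin_subset by blast
  show "continuous_map (subtopology X U) (subtopology Y V) f"
    using f V by (auto simp: UX continuous_map_in_subtopology local_homeomorphism_iff
        intro: continuous_map_from_subtopology)
  show "open_map (subtopology X U) (subtopology Y V) f"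
    using f V U
    by (intro open_map_into_subtopology)
       (auto simp: UX local_homeomorphism_iff intro: open_map_from_subtopology)
  fix x assume x: "x \<in> topspace (subtopology X U)"
  then obtain W where "openin X W" "x \<in> W" "inj_on f W"
    using local_homeomorphismD(3)[OF f, of x] by auto
  then show "\<exists>W. openin (subtopology X U) W \<and> x \<in> W \<and> inj_on f W"
    using x by (intro exI[of _ "U \<inter> W"]) (auto simp: openin_subtopology_Int2 inj_on_def)
qed

lemma local_homeomorphism_open_inclusion:
  assumes "openin Y U"
  shows "local_homeomorphism (subtopology Y U) Y (\<lambda>x. x)"
proof -
  have "local_homeomorphism Y Y id" by (rule homeomorphic_imp_local_homeomorphism) simp
  from local_homeomorphism_open_subtopology[OF this assms, of UNIV] show ?thesis
    by (simp add: id_def)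
qed

lemma local_homeomorphism_discrete:
  "f ` A \<subseteq> B \<Longrightarrow> local_homeomorphism (discrete_topology A) (discrete_topology B) f"
  unfolding local_homeomorphism_iff
  by (auto simp: open_map_def intro!: exI[of _ "{_}"])

text \<open>Images commute with unions, so boxes suffice. The set \<open>S\<close> cuts out a fibre
  product, or is \<open>UNIV\<close>.\<close>

lemma open_map_prod_basis:
  assumes "\<And>U V x. openin X U \<Longrightarrow> openin Y V \<Longrightarrow> openin W (f ` ((U \<times> V) \<inter> S))"
  shows "open_map (subtopology (prod_topology X Y) S) W f"
  unfolding open_map_def
proof (intro allI impI)
  fix T assume "openin (subtopology (prod_topology X Y) S) T"
  then obtain T' where T': "openin (prod_topology X Y) T'" "T = T' \<inter> S"
    by (auto simp: openin_subtopology)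
  show "openin W (f ` T)"
  proof (subst openin_subopen, safe)
    fix t assume t: "t \<in> T"
    then obtain U V where UV: "openin X U" "openin Y V" "t \<in> U \<times> V" "U \<times> V \<subseteq> T'"
      using T' by (metis openin_prod_topology_alt IntE mem_Times_iff prod.collapse)
    then show "\<exists>R. openin W R \<and> f t \<in> R \<and> R \<subseteq> f ` T"
      using t T' assms[OF UV(1,2)] by (intro exI[of _ "f ` ((U \<times> V) \<inter> S)"]) auto
  qed
qed

lemma local_homeomorphism_map_prod:
  assumes f: "local_homeomorphism X X' f" and g: "local_homeomorphism Y Y' g"
  shows "local_homeomorphism (prod_topology X Y) (prod_topology X' Y') (map_prod f g)"
  unfolding local_homeomorphism_iff
proof (intro conjI ballI)
  show "continuous_map (prod_topology X Y) (prod_topology X' Y') (map_prod f g)"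
    using continuous_map_prod_top[of X Y X' Y' f g] f g
    by (simp add: local_homeomorphism_iff map_prod_def)
  have "map_prod f g ` (U \<times> V) = f ` U \<times> g ` V" for U V by auto
  then show "open_map (prod_topology X Y) (prod_topology X' Y') (map_prod f g)"
    using open_map_prod_basis[of X Y "prod_topology X' Y'" "map_prod f g" UNIV] f g
    by (simp add: local_homeomorphism_iff open_map_def openin_prod_Times_iff)
  fix t assume "t \<in> topspace (prod_topology X Y)"
  then obtain U V where "openin X U" "fst t \<in> U" "inj_on f U" "openin Y V" "snd t \<in> V" "inj_on g V"
    using local_homeomorphismD(3)[OF f] local_homeomorphismD(3)[OF g]
    by (metis mem_Times_iff topspace_prod_topology)
  then show "\<exists>U. openin (prod_topology X Y) U \<and> t \<in> U \<and> inj_on (map_prod f g) U"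
    by (intro exI[of _ "U \<times> V"]) (auto simp: openin_prod_Times_iff inj_on_def mem_Times_iff)
qed

text \<open>Base change. A box over \<open>U\<close> and \<open>V\<close> projects onto the part of
  \<open>U\<close> that \<open>f\<close> sends into the image of \<open>V\<close>, which is open
  because \<open>g\<close> is open; where \<open>g\<close> is injective on \<open>V\<close>, the
  first coordinate determines the second.\<close>

lemma local_homeomorphism_pullback_fst:
  assumes f: "continuous_map X B f" and g: "local_homeomorphism Y B g"
  shows "local_homeomorphism (subtopology (prod_topology X Y) {(x, y). f x = g y}) X fst"
  unfolding local_homeomorphism_iff
proof (intro conjI ballI)
  show "continuous_map (subtopology (prod_topology X Y) {(x, y). f x = g y}) X fst"
    by (rule continuous_map_subtopology_fst)
  show "open_map (subtopology (prod_topology X Y) {(x, y). f x = g y}) X fst"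
  proof (rule open_map_prod_basis)
    fix U V assume U: "openin X U" and V: "openin Y V"
    have "fst ` (U \<times> V \<inter> {(x, y). f x = g y}) = U \<inter> {x \<in> topspace X. f x \<in> g ` V}"
      using openin_subset[OF U] by force
    moreover have "openin X {x \<in> topspace X. f x \<in> g ` V}"
      using openin_continuous_map_preimage[OF f] local_homeomorphismD(2)[OF g] V
      unfolding open_map_def by blast
    ultimately show "openin X (fst ` (U \<times> V \<inter> {(x, y). f x = g y}))" using U by auto
  qed
  fix t assume t: "t \<in> topspace (subtopology (prod_topology X Y) {(x, y). f x = g y})"
  then obtain V where "openin Y V" "snd t \<in> V" "inj_on g V"
    using local_homeomorphismD(3)[OF g, of "snd t"] by (auto simp: mem_Times_iff)
  then show "\<exists>U. openin (subtopology (prod_topology X Y) {(x, y). f x = g y}) U \<and> t \<in> U \<and> inj_on fst U"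
    using t by (intro exI[of _ "{(x, y). f x = g y} \<inter> topspace X \<times> V"])
      (auto simp: openin_subtopology_Int2 openin_prod_Times_iff inj_on_def)
qed

lemma local_homeomorphism_pullback_snd:
  assumes f: "local_homeomorphism X B f" and g: "continuous_map Y B g"
  shows "local_homeomorphism (subtopology (prod_topology X Y) {(x, y). f x = g y}) Y snd"
proof -
  have "homeomorphic_map (subtopology (prod_topology X Y) {(x, y). f x = g y})
      (subtopology (prod_topology Y X) {(y, x). g y = f x}) (\<lambda>(x, y). (y, x))"
    by (rule homeomorphic_map_subtopologies_alt[OF homeomorphic_map_swap]) auto
  from local_homeomorphism_compose[OF homeomorphic_imp_local_homeomorphism[OF this]
      local_homeomorphism_pullback_fst[OF g f]]
  show ?thesis by (rule local_homeomorphism_eq) auto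
qed

text \<open>Inside the open image of a neighbourhood on which \<open>f\<close> is a homeomorphism, a
  compact open set is chosen and pulled back by the local inverse. Thus zero-dimensionality of the
  unit space reaches every space over it, and this supplies the small pieces of a bridge.\<close>

lemma compact_open_section:
  assumes f: "local_homeomorphism X Y f" and Y: "zero_dimensional_space Y"
    and U: "openin X U" "x \<in> U"
  obtains B where "openin X B" "compactin X B" "x \<in> B" "B \<subseteq> U"
proof -
  have xX: "x \<in> topspace X" using U openin_subset by blast
  obtain V where V: "openin X V" "x \<in> V" "openin Y (f ` V)"
    "homeomorphic_map (subtopology X V) (subtopology Y (f ` V)) f"
    using f xX unfolding local_homeomorphism_def by blast
  then obtain g where g: "homeomorphic_maps (subtopology X V) (subtopology Y (f ` V)) f g"
    using homeomorphic_map_maps by blast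
  have VX: "V \<subseteq> topspace X" "f ` V \<subseteq> topspace Y" using V openin_subset by auto
  have gf: "g (f v) = v" if "v \<in> V" for v
    using g that VX unfolding homeomorphic_maps_def by auto
  have "openin Y (f ` (U \<inter> V))"
    using local_homeomorphismD(2)[OF f] U V unfolding open_map_def by blast
  then obtain K where K: "openin Y K" "compactin Y K" "f x \<in> K" "K \<subseteq> f ` (U \<inter> V)"
    using Y U V unfolding zero_dimensional_space_def by blast
  \<comment> \<open>As a preimage cut with \<open>V\<close> the lifted set is open; as the image of
    \<open>K\<close> under \<open>g\<close> it is compact.\<close>
  have "g ` K = {v \<in> topspace X. f v \<in> K} \<inter> V"
  proof (intro set_eqI iffI)
    fix v assume "v \<in> g ` K"
    then obtain u where "u \<in> U \<inter> V" "f u \<in> K" "v = g (f u)" using K by auto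
    then show "v \<in> {v \<in> topspace X. f v \<in> K} \<inter> V" using gf VX by auto
  next
    fix v assume "v \<in> {v \<in> topspace X. f v \<in> K} \<inter> V"
    then show "v \<in> g ` K" using gf by (metis (no_types, lifting) IntE image_eqI mem_Collect_eq)
  qed
  moreover have "openin X {v \<in> topspace X. f v \<in> K}"
    using openin_continuous_map_preimage[OF local_homeomorphismD(1)[OF f] K(1)] .
  ultimately have "openin X (g ` K)" using V by auto
  moreover have "compactin X (g ` K)"
  proof (rule image_compactin)
    show "compactin (subtopology Y (f ` V)) K" using K by (auto simp: compactin_subtopology)
    show "continuous_map (subtopology Y (f ` V)) X g"
      using g unfolding homeomorphic_maps_def by (simp add: continuous_map_in_subtopology)
  qed
  moreover have "x \<in> g ` K" "g ` K \<subseteq> U" using K gf V by force+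
  ultimately show ?thesis using that by blast
qed

lemma zero_dimensional_space_local_homeomorphism:
  assumes "local_homeomorphism X Y f" "zero_dimensional_space Y"
  shows "zero_dimensional_space X"
  unfolding zero_dimensional_space_def using compact_open_section[OF assms] by metis

lemma zero_dimensional_imp_locally_compact:
  "zero_dimensional_space X \<Longrightarrow> locally_compact_space X"
  unfolding zero_dimensional_space_def locally_compact_space_def
  by (metis openin_topspace order_refl)

text \<open>Every point of \<open>X\<close> is the image of a point of \<open>Z\<close> that has a
  compact open neighbourhood on which \<open>p\<close> and \<open>q\<close> are both injective. As
  \<open>p\<close> is open, the images of finitely many of these neighbourhoods cover each of the
  countably many compact sets that exhaust \<open>X\<close>, whatever the size of
  \<open>Z\<close>.\<close>

lemma countable_compact_open_cover:
  fixes Z :: "'z topology"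
  assumes p: "local_homeomorphism Z X p" "p ` topspace Z = topspace X"
    and q: "local_homeomorphism Z Y q"
    and X: "zero_dimensional_space X" "sigma_compact_space X"
  shows "\<exists>B :: nat \<Rightarrow> 'z set. (\<forall>n. openin Z (B n) \<and> compactin Z (B n) \<and> inj_on p (B n) \<and> inj_on q
    (B n)) \<and>
    (\<Union>n. p ` B n) = topspace X"
proof -
  define \<B> where "\<B> = {B. openin Z B \<and> compactin Z B \<and> inj_on p B \<and> inj_on q B}"
  have 1: "\<exists>B\<in>\<B>. x \<in> p ` B" if x: "x \<in> topspace X" for x
  proof -
    obtain z where z: "z \<in> topspace Z" "p z = x" using p(2) x by (metis imageE)
    obtain U where U: "openin Z U" "z \<in> U" "inj_on p U"
      using local_homeomorphismD(3)[OF p(1) z(1)] by blast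
    obtain V where V: "openin Z V" "z \<in> V" "inj_on q V" using local_homeomorphismD(3)[OF q z(1)]
      by blast
    have UV: "openin Z (U \<inter> V)" "z \<in> U \<inter> V" using U V by auto
    obtain B where B: "openin Z B" "compactin Z B" "z \<in> B" "B \<subseteq> U \<inter> V"
      by (rule compact_open_section[OF p(1) X(1) UV])
    have "inj_on p B" "inj_on q B" using U(3) V(3) B(4) by (meson inj_on_subset le_inf_iff)+
    then have "B \<in> \<B>" using B unfolding \<B>_def by blast
    then show ?thesis using B z by blast
  qed
  obtain \<K> where \<K>: "countable \<K>" "\<And>K. K \<in> \<K> \<Longrightarrow> compactin X K" "\<Union>\<K> = topspace X"
    using X(2) unfolding sigma_compact_space_def by metis
  have "\<exists>\<F>. finite \<F> \<and> \<F> \<subseteq> \<B> \<and> K \<subseteq> \<Union>((`) p ` \<F>)" if K: "K \<in> \<K>" for K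
  proof -
    have "\<forall>T\<in>(`) p ` \<B>. openin X T"
      using local_homeomorphismD(2)[OF p(1)] unfolding \<B>_def open_map_def by blast
    moreover have "K \<subseteq> \<Union>((`) p ` \<B>)"
    proof
      fix x assume "x \<in> K"
      then have "x \<in> topspace X" using \<K>(3) K by auto
      then obtain B where "B \<in> \<B>" "x \<in> p ` B" by (metis 1)
      then show "x \<in> \<Union>((`) p ` \<B>)" by auto
    qed
    ultimately obtain \<F> where "finite \<F>" "\<F> \<subseteq> (`) p ` \<B>" "K \<subseteq> \<Union>\<F>"
      using \<K>(2)[OF K] unfolding compactin_def by meson
    then show ?thesis by (metis finite_subset_image)
  qed
  then obtain F where F: "\<And>K. K \<in> \<K> \<Longrightarrow> finite (F K) \<and> F K \<subseteq> \<B> \<and> K \<subseteq> \<Union>((`) p ` F K)"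
    by metis
  \<comment> \<open>The empty set is harmless and keeps the family nonempty, so that
    \<open>from_nat_into\<close> enumerates it.\<close>
  define \<C> where "\<C> = insert {} (\<Union>K\<in>\<K>. F K)"
  have "countable (F K)" if "K \<in> \<K>" for K
    using F[OF that] by (simp add: countable_finite)
  then have "countable \<C>" using \<K>(1) unfolding \<C>_def by simp
  then have rng: "range (from_nat_into \<C>) = \<C>" unfolding \<C>_def by (intro range_from_nat_into) auto
  have sub: "\<C> \<subseteq> \<B>" using F unfolding \<C>_def \<B>_def by auto
  have n: "from_nat_into \<C> n \<in> \<B>" for n using rng sub by blast
  have "(\<Union>n. p ` from_nat_into \<C> n) = \<Union>((`) p ` \<C>)" using rng by (metis image_image)
  also have "\<dots> = topspace X"
  proof
    show "\<Union>((`) p ` \<C>) \<subseteq> topspace X"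
    proof
      fix x assume "x \<in> \<Union>((`) p ` \<C>)"
      then obtain B z where "B \<in> \<C>" "z \<in> B" "x = p z" by auto
      moreover have "B \<subseteq> topspace Z" using \<open>B \<in> \<C>\<close> sub openin_subset unfolding \<B>_def by auto
      ultimately show "x \<in> topspace X" using p(2) by auto
    qed
    show "topspace X \<subseteq> \<Union>((`) p ` \<C>)"
    proof
      fix x assume "x \<in> topspace X"
      then obtain K where K: "K \<in> \<K>" "x \<in> K" using \<K>(3) by auto
      then have "x \<in> \<Union>((`) p ` F K)" using F[OF K(1)] K(2) by (metis subsetD)
      then show "x \<in> \<Union>((`) p ` \<C>)" using K unfolding \<C>_def by auto
    qed
  qed
  finally have "(\<Union>n. p ` from_nat_into \<C> n) = topspace X" .
  moreover have "openin Z (from_nat_into \<C> n)" "compactin Z (from_nat_into \<C> n)"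
    "inj_on p (from_nat_into \<C> n)" "inj_on q (from_nat_into \<C> n)" for n
    using n[of n] unfolding \<B>_def by auto
  ultimately show ?thesis by (intro exI[of _ "from_nat_into \<C>"]) simp
qed

section \<open>Groupoids and bridges\<close>

lemma topspace_unit_space [simp]: "topspace (unit_space G) = units G"
  unfolding unit_space_def units_def arrows_def by auto

lemma units_subset_arrows: "units G \<subseteq> arrows G"
  unfolding units_def by auto

lemma continuous_map_into_unit_space:
  "continuous_map T (unit_space G) a \<longleftrightarrow> continuous_map T (gtop G) a \<and> (\<forall>t \<in> topspace T. a t \<in> units G)"
  unfolding unit_space_def by (auto simp: continuous_map_in_subtopology)

lemma topspace_gtop [simp]: "topspace (gtop G) = arrows G"
  unfolding arrows_def ..

lemma continuous_map_arrow:
  "continuous_map T (gtop G) a \<Longrightarrow> t \<in> topspace T \<Longrightarrow> a t \<in> arrows G"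
  using continuous_map_funspace[of T "gtop G" a] by auto

section \<open>Algebra of arrows\<close>

context groupoid
begin

lemma unit_simps [simp]:
  assumes "u \<in> units G"
  shows "u \<in> arrows G" "grng G u = u" "gsrc G u = u"
  using assms unfolding units_def by auto

lemma arrow_simps [simp]:
  assumes "g \<in> arrows G"
  shows "grng G g \<in> units G" "gsrc G g \<in> units G"
    "ginv G g \<in> arrows G" "grng G (ginv G g) = gsrc G g" "gsrc G (ginv G g) = grng G g"
    "gmult G g (ginv G g) = grng G g" "gmult G (ginv G g) g = gsrc G g"
    "gmult G (grng G g) g = g" "gmult G g (gsrc G g) = g"
  using assms by (auto intro: rng_unit src_unit inv_closed rng_inv src_inv inv_right inv_left
    unit_left unit_right)

lemma mult_simps [simp]:
  assumes "g \<in> arrows G" "h \<in> arrows G" "gsrc G g = grng G h"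
  shows "gmult G g h \<in> arrows G" "grng G (gmult G g h) = grng G g" "gsrc G (gmult G g h) = gsrc G h"
  using assms by (auto simp: composable_def intro: mult_closed rng_mult src_mult)

lemma assoc:
  assumes "g \<in> arrows G" "h \<in> arrows G" "k \<in> arrows G" "gsrc G g = grng G h" "gsrc G h = grng G k"
  shows "gmult G (gmult G g h) k = gmult G g (gmult G h k)"
  using assms by (auto simp: composable_def intro: mult_assoc)

lemma unit_mult:
  assumes "g \<in> arrows G"
  shows "u = grng G g \<Longrightarrow> gmult G u g = g" "u = gsrc G g \<Longrightarrow> gmult G g u = g"
  using assms by auto

lemma inv_mult_cancel [simp]:
  assumes "g \<in> arrows G" "h \<in> arrows G"
  shows "gsrc G g = grng G h \<Longrightarrow> gmult G (ginv G g) (gmult G g h) = h"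
    "grng G g = grng G h \<Longrightarrow> gmult G g (gmult G (ginv G g) h) = h"
    "gsrc G h = grng G g \<Longrightarrow> gmult G (gmult G h g) (ginv G g) = h"
    "gsrc G h = gsrc G g \<Longrightarrow> gmult G (gmult G h (ginv G g)) g = h"
  subgoal by (subst assoc[symmetric]) (use assms in \<open>auto simp: unit_mult\<close>)
  subgoal by (subst assoc[symmetric]) (use assms in \<open>auto simp: unit_mult\<close>)
  subgoal by (subst assoc) (use assms in \<open>auto simp: unit_mult\<close>)
  subgoal by (subst assoc) (use assms in \<open>auto simp: unit_mult\<close>)
  done

lemma left_cancel:
  assumes "g \<in> arrows G" "h \<in> arrows G" "k \<in> arrows G" "gsrc G g = grng G h" "gsrc G g = grng G k"
    "gmult G g h = gmult G g k"
  shows "h = k"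
  using assms by (metis inv_mult_cancel(1))

lemma right_cancel:
  assumes "g \<in> arrows G" "h \<in> arrows G" "k \<in> arrows G" "gsrc G h = grng G g" "gsrc G k = grng G g"
    "gmult G h g = gmult G k g"
  shows "h = k"
  using assms by (metis inv_mult_cancel(3))

lemma inv_unique:
  assumes "g \<in> arrows G" "h \<in> arrows G" "gsrc G g = grng G h" "gmult G g h = grng G g"
  shows "h = ginv G g"
  using assms left_cancel[of g h "ginv G g"] by (metis arrow_simps(3,4,6))

lemma inv_inv [simp]: "g \<in> arrows G \<Longrightarrow> ginv G (ginv G g) = g"
  by (metis arrow_simps(3,5,7) arrow_simps(4) inv_unique)

lemma idempotent_unit:
  assumes "e \<in> arrows G" "grng G e = gsrc G e" "gmult G e e = e"
  shows "e = grng G e"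
  using assms by (metis arrow_simps(2,9) left_cancel unit_simps(1,2))

end

context topological_groupoid
begin

lemma continuous_rng_comp:
  assumes "continuous_map T (gtop G) a"
  shows "continuous_map T (unit_space G) (\<lambda>t. grng G (a t))" "continuous_map T (gtop G)
    (\<lambda>t. grng G (a t))"
  using continuous_map_o[OF assms continuous_rng] by (auto simp: continuous_map_into_unit_space)

lemma continuous_src_comp:
  assumes "continuous_map T (gtop G) a"
  shows "continuous_map T (unit_space G) (\<lambda>t. gsrc G (a t))" "continuous_map T (gtop G)
    (\<lambda>t. gsrc G (a t))"
  using continuous_map_o[OF assms continuous_src] by (auto simp: continuous_map_into_unit_space)

lemma continuous_inv_comp:
  "continuous_map T (gtop G) a \<Longrightarrow> continuous_map T (gtop G) (\<lambda>t. ginv G (a t))"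
  using continuous_map_o continuous_inv by blast

text \<open>Continuity of the product in a form that works as an introduction rule: long words in
  arrows are taken apart factor by factor, leaving composability at each point as the side
  condition.\<close>

lemma continuous_mult_comp:
  assumes "continuous_map T (gtop G) a" "continuous_map T (gtop G) b"
    and "\<And>t. t \<in> topspace T \<Longrightarrow> gsrc G (a t) = grng G (b t)"
  shows "continuous_map T (gtop G) (\<lambda>t. gmult G (a t) (b t))"
proof -
  have "a t \<in> arrows G" "b t \<in> arrows G" if "t \<in> topspace T" for t
    using assms(1,2) that by (auto intro: continuous_map_arrow)
  then have "continuous_map T (subtopology (prod_topology (gtop G) (gtop G)) (composable G)) (\<lambda>t.
    (a t, b t))"
    using assms by (auto simp: continuous_map_in_subtopology composable_def intro:
      continuous_map_pairedI)
  from continuous_map_o[OF this continuous_mult] show ?thesis by simp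
qed

end

section \<open>Fibred groupoids and isomorphisms of pullbacks over a common space\<close>

lemma fibred_simps [simp]:
  "grng (fibred_groupoid G X p) = (\<lambda>(x, \<gamma>, y). (x, grng G \<gamma>, x))"
  "gsrc (fibred_groupoid G X p) = (\<lambda>(x, \<gamma>, y). (y, gsrc G \<gamma>, y))"
  "gmult (fibred_groupoid G X p) = (\<lambda>(x, \<gamma>, y) (y', \<eta>, z). (x, gmult G \<gamma> \<eta>, z))"
  "ginv (fibred_groupoid G X p) = (\<lambda>(x, \<gamma>, y). (y, ginv G \<gamma>, x))"
  unfolding fibred_groupoid_def by auto

lemma arrows_fibred:
  "arrows (fibred_groupoid G X p) =
     {(x, g, y). x \<in> topspace X \<and> g \<in> arrows G \<and> y \<in> topspace X \<and> p x = grng G g \<and> p y = gsrc G g}"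
  unfolding fibred_groupoid_def arrows_def by auto

lemma continuous_map_into_fibred:
  "continuous_map T (gtop (fibred_groupoid G X p)) k \<longleftrightarrow>
     continuous_map T X (\<lambda>t. fst (k t)) \<and> continuous_map T (gtop G) (\<lambda>t. fst (snd (k t))) \<and>
     continuous_map T X (\<lambda>t. snd (snd (k t))) \<and>
     (\<forall>t \<in> topspace T. p (fst (k t)) = grng G (fst (snd (k t))) \<and> p (snd (snd (k t))) = gsrc G
       (fst (snd (k t))))"
  unfolding fibred_groupoid_def
  by (auto simp: continuous_map_in_subtopology continuous_map_pairwise o_def split_beta Pi_iff)

lemma continuous_map_fibred_projections:
  "continuous_map (gtop (fibred_groupoid G X p)) X fst"
  "continuous_map (gtop (fibred_groupoid G X p)) (gtop G) (\<lambda>t. fst (snd t))"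
  "continuous_map (gtop (fibred_groupoid G X p)) X (\<lambda>t. snd (snd t))"
  using continuous_map_into_fibred[of "gtop (fibred_groupoid G X p)" G X p "\<lambda>t. t"] by auto

text \<open>
  A bridge is an isomorphism between the pullbacks of \<open>G\<close> and \<open>H\<close> to a common space \<open>X\<close> which is the
  identity on \<open>X\<close>: on arrows it is \<open>(x, g, y) \<mapsto> (x, f x g y, y)\<close>, with inverse
  \<open>(x, h, y) \<mapsto> (x, f' x h y, y)\<close>.
\<close>

locale bridge = G: topological_groupoid G + H: topological_groupoid H
  for G :: "'a grpd" and H :: "'b grpd" and X :: "'x topology" and p q
    and f :: "'x \<Rightarrow> 'a \<Rightarrow> 'x \<Rightarrow> 'b" and f' :: "'x \<Rightarrow> 'b \<Rightarrow> 'x \<Rightarrow> 'a" +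
  assumes p_lh: "local_homeomorphism X (unit_space G) p"
    and q_lh: "local_homeomorphism X (unit_space H) q"
    and p_full: "u \<in> units G \<Longrightarrow> \<exists>g \<in> arrows G. \<exists>x \<in> topspace X. grng G g = u \<and> gsrc G g = p x"
    and q_full: "v \<in> units H \<Longrightarrow> \<exists>h \<in> arrows H. \<exists>x \<in> topspace X. grng H h = v \<and> gsrc H h = q x"
    and f_arrow: "\<lbrakk>x \<in> topspace X; y \<in> topspace X; g \<in> arrows G; grng G g = p x; gsrc G g = p y\<rbrakk> \<Longrightarrow>
      f x g y \<in> arrows H \<and> grng H (f x g y) = q x \<and> gsrc H (f x g y) = q y \<and> f' x (f x g y) y = g"
    and f'_arrow: "\<lbrakk>x \<in> topspace X; y \<in> topspace X; h \<in> arrows H; grng H h = q x; gsrc H h = q y\<rbrakk> \<Longrightarrow>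
      f' x h y \<in> arrows G \<and> grng G (f' x h y) = p x \<and> gsrc G (f' x h y) = p y \<and> f x (f' x h y) y = h"
    and f_mult: "\<lbrakk>x \<in> topspace X; y \<in> topspace X; z \<in> topspace X; g \<in> arrows G; g' \<in> arrows G;
      grng G g = p x; gsrc G g = p y; grng G g' = p y; gsrc G g' = p z\<rbrakk> \<Longrightarrow>
      f x (gmult G g g') z = gmult H (f x g y) (f y g' z)"
    and f_continuous: "continuous_map (gtop (fibred_groupoid G X p)) (gtop H) (\<lambda>t. f (fst t) (fst
      (snd t)) (snd (snd t)))"
    and f'_continuous: "continuous_map (gtop (fibred_groupoid H X q)) (gtop G) (\<lambda>t. f' (fst t)
      (fst (snd t)) (snd (snd t)))"
begin

lemma p_unit [simp]: "x \<in> topspace X \<Longrightarrow> p x \<in> units G"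
  using local_homeomorphism_funcset[OF p_lh] by simp

lemma q_unit [simp]: "x \<in> topspace X \<Longrightarrow> q x \<in> units H"
  using local_homeomorphism_funcset[OF q_lh] by simp

lemma f_simps [simp]:
  assumes "x \<in> topspace X" "y \<in> topspace X" "g \<in> arrows G" "grng G g = p x" "gsrc G g = p y"
  shows "f x g y \<in> arrows H" "grng H (f x g y) = q x" "gsrc H (f x g y) = q y" "f' x (f x g y) y = g"
  using f_arrow[OF assms] by auto

lemma f'_simps [simp]:
  assumes "x \<in> topspace X" "y \<in> topspace X" "h \<in> arrows H" "grng H h = q x" "gsrc H h = q y"
  shows "f' x h y \<in> arrows G" "grng G (f' x h y) = p x" "gsrc G (f' x h y) = p y" "f x (f' x h y) y = h"
  using f'_arrow[OF assms] by auto

text \<open>The inverse of a multiplicative bijection is multiplicative: apply \<open>f_mult\<close>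
  to the preimages. This completes the symmetry of the locale, so results proved for one side of a
  bridge hold for the other through \<open>bridge_sym\<close>.\<close>

lemma f'_mult:
  assumes "x \<in> topspace X" "y \<in> topspace X" "z \<in> topspace X" "h \<in> arrows H" "h' \<in> arrows H"
    "grng H h = q x" "gsrc H h = q y" "grng H h' = q y" "gsrc H h' = q z"
  shows "f' x (gmult H h h') z = gmult G (f' x h y) (f' y h' z)"
  using f_mult[of x y z "f' x h y" "f' y h' z"] f_arrow[of x z "gmult G (f' x h y) (f' y h' z)"] assms
  by simp

text \<open>By \<open>f_mult\<close> the arrow \<open>f x (p x) x\<close> is an idempotent loop at
  \<open>q x\<close>, and in a groupoid such a loop is a unit.\<close>

lemma f_unit:
  assumes "x \<in> topspace X"
  shows "f x (p x) x = q x"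
  using H.idempotent_unit[of "f x (p x) x"] f_mult[of x x x "p x" "p x"] G.unit_mult[of "p x"
    "p x"] assms
  by simp

lemma bridge_sym: "bridge H G X q p f' f"
  by unfold_locales
    (fact p_lh q_lh f_continuous f'_continuous p_full q_full | simp add: f'_mult)+

lemma f_continuous_comp:
  assumes "continuous_map T X a" "continuous_map T (gtop G) g" "continuous_map T X b"
    and "\<And>t. t \<in> topspace T \<Longrightarrow> grng G (g t) = p (a t) \<and> gsrc G (g t) = p (b t)"
  shows "continuous_map T (gtop H) (\<lambda>t. f (a t) (g t) (b t))"
  using continuous_map_o[OF _ f_continuous, of T "\<lambda>t. (a t, g t, b t)"] assms
  by (simp add: continuous_map_into_fibred)

text \<open>A point \<open>(\<gamma>, x)\<close> carries an arrow from \<open>p x\<close> to a new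
  unit \<open>grng G \<gamma>\<close>. By \<open>p_full\<close> these ranges exhaust the units of
  \<open>G\<close>, so the new map to \<open>G\<close> is onto, while the map to \<open>H\<close>
  still sees only \<open>x\<close>. An arrow of \<open>G\<close> is conjugated by the two carried
  arrows before \<open>f\<close> is applied.\<close>

lemma bridge_extend:
  assumes "local_homeomorphism (gtop G) (unit_space G) (grng G)"
  shows "bridge G H (subtopology (prod_topology (gtop G) X) {(\<gamma>, x). gsrc G \<gamma> = p x})
     (\<lambda>(\<gamma>, x). grng G \<gamma>) (\<lambda>(\<gamma>, x). q x)
     (\<lambda>(\<gamma>, x) g (\<gamma>', x'). f x (gmult G (gmult G (ginv G \<gamma>) g) \<gamma>') x')
     (\<lambda>(\<gamma>, x) h (\<gamma>', x'). gmult G (gmult G \<gamma> (f' x h x')) (ginv G \<gamma>'))"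
    (is "bridge G H ?Z ?P ?Q ?F ?F'")
proof
  have Z: "topspace ?Z = {(\<gamma>, x). \<gamma> \<in> arrows G \<and> x \<in> topspace X \<and> gsrc G \<gamma> = p x}"
    by auto
  have c1: "continuous_map ?Z (gtop G) fst" "continuous_map ?Z X snd"
    by (auto intro: continuous_map_subtopology_fst continuous_map_subtopology_snd)
  show "local_homeomorphism ?Z (unit_space G) ?P"
    using local_homeomorphism_compose[OF local_homeomorphism_pullback_fst[OF G.continuous_src
      p_lh] assms]
    by (simp add: case_prod_unfold)
  show "\<exists>h\<in>arrows H. \<exists>x\<in>topspace ?Z. grng H h = v \<and> gsrc H h = ?Q x" if v: "v \<in> units H" for v
  proof -
    obtain h x where "h \<in> arrows H" "x \<in> topspace X" "grng H h = v" "gsrc H h = q x"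
      using q_full[OF v] by auto
    then show ?thesis unfolding Z
      by (intro bexI[of _ h] bexI[of _ "(p x, x)"]) auto
  qed
  show "\<exists>g\<in>arrows G. \<exists>x\<in>topspace ?Z. grng G g = u \<and> gsrc G g = ?P x" if u: "u \<in> units G" for u
  proof -
    obtain h x where "h \<in> arrows G" "x \<in> topspace X" "grng G h = u" "gsrc G h = p x"
      using p_full[OF u] by auto
    then show ?thesis using u unfolding Z
      by (intro bexI[of _ "u"] bexI[of _ "(h, x)"]) auto
  qed
  show "?F z g z' \<in> arrows H \<and> grng H (?F z g z') = ?Q z \<and> gsrc H (?F z g z') = ?Q z' \<and>
      ?F' z (?F z g z') z' = g"
    if "z \<in> topspace ?Z" "z' \<in> topspace ?Z" "g \<in> arrows G" "grng G g = ?P z" "gsrc G g = ?P z'"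
      for z g z'
  proof -
    obtain \<gamma> x \<gamma>' x' where "z = (\<gamma>, x)" "z' = (\<gamma>', x')" by (metis prod.collapse)
    then show ?thesis using that unfolding Z
      by (auto simp: G.assoc G.unit_mult)
  qed
  show "?F' z h z' \<in> arrows G \<and> grng G (?F' z h z') = ?P z \<and> gsrc G (?F' z h z') = ?P z' \<and>
      ?F z (?F' z h z') z' = h"
    if "z \<in> topspace ?Z" "z' \<in> topspace ?Z" "h \<in> arrows H" "grng H h = ?Q z" "gsrc H h = ?Q z'"
      for z h z'
  proof -
    obtain \<gamma> x \<gamma>' x' where "z = (\<gamma>, x)" "z' = (\<gamma>', x')" by (metis prod.collapse)
    then show ?thesis using that unfolding Z
      by (auto simp: G.assoc G.unit_mult)
  qed
  show "?F z (gmult G g g') z'' = gmult H (?F z g z') (?F z' g' z'')"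
    if "z \<in> topspace ?Z" "z' \<in> topspace ?Z" "z'' \<in> topspace ?Z" "g \<in> arrows G" "g' \<in> arrows G"
      "grng G g = ?P z" "gsrc G g = ?P z'" "grng G g' = ?P z'" "gsrc G g' = ?P z''" for z z' z'' g g'
  proof -
    obtain \<gamma> x \<gamma>' x' \<gamma>'' x'' where "z = (\<gamma>, x)" "z' = (\<gamma>', x')" "z'' = (\<gamma>'', x'')"
      by (metis prod.collapse)
    then show ?thesis using that unfolding Z
      using f_mult[of x x' x'' "gmult G (gmult G (ginv G \<gamma>) g) \<gamma>'" "gmult G (gmult G
        (ginv G \<gamma>') g') \<gamma>''"]
      by (auto simp: G.assoc)
  qed
  let ?A = "gtop (fibred_groupoid G ?Z ?P)"
  have A: "topspace ?A = arrows (fibred_groupoid G ?Z ?P)" by simp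
  note pr = continuous_map_fibred_projections[of G ?Z ?P]
  have "continuous_map ?A (gtop H) (\<lambda>t. f (snd (fst t))
      (gmult G (gmult G (ginv G (fst (fst t))) (fst (snd t))) (fst (snd (snd t)))) (snd (snd (snd t))))"
    by (intro f_continuous_comp G.continuous_mult_comp G.continuous_inv_comp pr
        continuous_map_o[OF pr(1) c1(1)] continuous_map_o[OF pr(1) c1(2)]
        continuous_map_o[OF pr(3) c1(1)] continuous_map_o[OF pr(3) c1(2)])
      (auto simp: A arrows_fibred Z)
  then show "continuous_map ?A (gtop H) (\<lambda>t. ?F (fst t) (fst (snd t)) (snd (snd t)))"
    by (simp add: case_prod_unfold)
  let ?B = "gtop (fibred_groupoid H ?Z ?Q)"
  have B: "topspace ?B = arrows (fibred_groupoid H ?Z ?Q)" by simp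
  note pr = continuous_map_fibred_projections[of H ?Z ?Q]
  have "continuous_map ?B (gtop G) (\<lambda>t. gmult G (gmult G (fst (fst t))
      (f' (snd (fst t)) (fst (snd t)) (snd (snd (snd t))))) (ginv G (fst (snd (snd t)))))"
    by (intro bridge.f_continuous_comp[OF bridge_sym] G.continuous_mult_comp G.continuous_inv_comp pr
        continuous_map_o[OF pr(1) c1(1)] continuous_map_o[OF pr(1) c1(2)]
        continuous_map_o[OF pr(3) c1(1)] continuous_map_o[OF pr(3) c1(2)])
      (auto simp: B arrows_fibred Z)
  then show "continuous_map ?B (gtop G) (\<lambda>t. ?F' (fst t) (fst (snd t)) (snd (snd t)))"
    by (simp add: case_prod_unfold)
  show "local_homeomorphism ?Z (unit_space H) ?Q"
  proof -
    \<comment> \<open>The source map is the range map preceded by the homeomorphism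
      \<open>ginv\<close>.\<close>
    have "local_homeomorphism (gtop G) (unit_space G) (gsrc G)"
    proof -
      have "homeomorphic_map (gtop G) (gtop G) (ginv G)"
        using G.continuous_inv by (intro homeomorphic_map_involution) (auto simp: topspace_gtop)
      from local_homeomorphism_compose[OF homeomorphic_imp_local_homeomorphism[OF this] assms]
      show ?thesis by (rule local_homeomorphism_eq) (simp add: topspace_gtop)
    qed
    from local_homeomorphism_compose[OF local_homeomorphism_pullback_snd[OF this
      local_homeomorphismD(1)[OF p_lh]] q_lh]
    show ?thesis by (simp add: case_prod_unfold)
  qed
qed

end

text \<open>One extension on the side of \<open>G\<close>, then one on the side of \<open>H\<close>.
  The second keeps the first map onto, because over every old point there is the new point that
  carries the unit \<open>q x\<close>.\<close>

lemma (in bridge) bridge_surjective: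
  assumes G: "local_homeomorphism (gtop G) (unit_space G) (grng G)"
    and H: "local_homeomorphism (gtop H) (unit_space H) (grng H)"
  obtains Z :: "('b \<times> 'a \<times> 'x) topology" and P Q F F' where "bridge G H Z P Q F F'"
    "P ` topspace Z = units G" "Q ` topspace Z = units H"
proof -
  let ?Z = "subtopology (prod_topology (gtop G) X) {(\<gamma>, x). gsrc G \<gamma> = p x}"
  let ?P = "\<lambda>(\<gamma>, x). grng G \<gamma>" and ?Q = "\<lambda>(\<gamma>::'a, x). q x"
  let ?Z' = "subtopology (prod_topology (gtop H) ?Z) {(\<gamma>, x). gsrc H \<gamma> = ?Q x}"
  let ?Q' = "\<lambda>(\<eta>, x). grng H \<eta>" and ?P' = "\<lambda>(\<eta>::'b, x). ?P x"
  note b1 = bridge_extend[OF G]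
  note b2 = bridge.bridge_sym[OF bridge.bridge_extend[OF bridge.bridge_sym[OF b1] H]]
  have "?P' ` topspace ?Z' = units G"
  proof
    show "?P' ` topspace ?Z' \<subseteq> units G" by auto
    show "units G \<subseteq> ?P' ` topspace ?Z'"
    proof
      fix u assume "u \<in> units G"
      then obtain g x where "g \<in> arrows G" "x \<in> topspace X" "grng G g = u" "gsrc G g = p x"
        using p_full by blast
      then show "u \<in> ?P' ` topspace ?Z'"
        by (intro image_eqI[of _ _ "(q x, g, x)"]) auto
    qed
  qed
  moreover have "?Q' ` topspace ?Z' = units H"
  proof
    show "?Q' ` topspace ?Z' \<subseteq> units H" by auto
    show "units H \<subseteq> ?Q' ` topspace ?Z'"
    proof
      fix v assume "v \<in> units H"
      then obtain h x where "h \<in> arrows H" "x \<in> topspace X" "grng H h = v" "gsrc H h = q x"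
        using q_full by blast
      then show "v \<in> ?Q' ` topspace ?Z'"
        by (intro image_eqI[of _ _ "(h, p x, x)"]) auto
    qed
  qed
  ultimately show ?thesis using that b2 by blast
qed

section \<open>Reductions, and greedy selection of injective pieces of a bridge\<close>

lemma reduction_simps [simp]:
  "grng (reduction G U) = grng G" "gsrc (reduction G U) = gsrc G"
  "gmult (reduction G U) = gmult G" "ginv (reduction G U) = ginv G"
  "gtop (reduction G U) = subtopology (gtop G) {g \<in> arrows G. grng G g \<in> U \<and> gsrc G g \<in> U}"
  unfolding reduction_def by auto

lemma arrows_reduction: "arrows (reduction G U) = {g \<in> arrows G. grng G g \<in> U \<and> gsrc G g \<in> U}"
  unfolding arrows_def[of "reduction G U"] by auto

lemma (in groupoid) reduction_units: "reduction G (units G) = G"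
proof -
  have "subtopology (gtop G) {g \<in> arrows G. grng G g \<in> units G \<and> gsrc G g \<in> units G} = gtop G"
    by (rule subtopology_superset) auto
  then show ?thesis unfolding reduction_def by simp
qed

text \<open>On an open set where it is injective, a local homeomorphism is an open embedding. The
  resulting continuous section lets endpoints of arrows be lifted to \<open>X\<close>.\<close>

lemma continuous_inverse_of_local_homeomorphism:
  assumes p: "local_homeomorphism X Y p" and C: "openin X C" "inj_on p C"
  shows "continuous_map (subtopology Y (p ` C)) X (inv_into C p)"
proof -
  have CX: "C \<subseteq> topspace X" using C openin_subset by blast
  then have pC: "p ` C \<subseteq> topspace Y" using local_homeomorphism_funcset[OF p] by auto
  have "embedding_map (subtopology X C) Y p"
    using local_homeomorphismD[OF p] C
    by (intro injective_open_imp_embedding_map continuous_map_from_subtopology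
        open_map_from_subtopology) (auto simp: inj_on_def)
  then have "homeomorphic_map (subtopology X C) (subtopology Y (p ` C)) p"
    using CX by (simp add: embedding_map_def Int_absorb1)
  then obtain t where t: "homeomorphic_maps (subtopology X C) (subtopology Y (p ` C)) p t"
    using homeomorphic_map_maps by blast
  have "t y = inv_into C p y" if "y \<in> p ` C" for y
  proof -
    have "t y \<in> C" "p (t y) = y"
      using that t pC unfolding homeomorphic_maps_def by (auto simp: continuous_map_in_subtopology)
    then show ?thesis using C(2) by (metis inv_into_f_f)
  qed
  moreover have "continuous_map (subtopology Y (p ` C)) X t"
    using t unfolding homeomorphic_maps_def by (simp add: continuous_map_in_subtopology)
  ultimately show ?thesis by (auto intro: continuous_map_eq)
qed

lemma isomorphicI:
  assumes "homeomorphic_maps (gtop G) (gtop H) \<phi> \<psi>"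
    and "\<And>g. g \<in> arrows G \<Longrightarrow> \<phi> (grng G g) = grng H (\<phi> g) \<and> \<phi> (gsrc G g) = gsrc H (\<phi> g)"
    and "\<And>g h. g \<in> arrows G \<Longrightarrow> h \<in> arrows G \<Longrightarrow> gsrc G g = grng G h \<Longrightarrow>
      \<phi> (gmult G g h) = gmult H (\<phi> g) (\<phi> h)"
  shows "G \<cong>\<^sub>G H"
proof -
  have "homeomorphic_map (gtop G) (gtop H) \<phi>" using assms(1) homeomorphic_maps_imp_map by blast
  moreover then have "\<phi> g \<in> arrows H" if "g \<in> arrows G" for g
    using that homeomorphic_imp_surjective_map by fastforce
  ultimately have "groupoid_iso G H \<phi>" using assms(2,3)
    unfolding groupoid_iso_def groupoid_hom_def by (auto simp: composable_def)
  then show ?thesis unfolding isomorphic_def by blast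
qed

context bridge
begin

text \<open>The set \<open>C\<close> acts as a bisection from \<open>G\<close> to \<open>H\<close>:
  it matches \<open>p c\<close> with \<open>q c\<close>. An arrow of \<open>G\<close> between units
  in the image of \<open>C\<close> has unique lifted endpoints \<open>c\<close> and \<open>d\<close>
  in \<open>C\<close>, and is sent to \<open>f c g d\<close>; the inverse lifts endpoints through
  \<open>q\<close> and uses \<open>f'\<close>.\<close>

lemma bridge_reduction:
  assumes C: "openin X C" "inj_on p C" "inj_on q C"
  shows "reduction G (p ` C) \<cong>\<^sub>G reduction H (q ` C)"
proof -
  define s where "s = inv_into C p"
  define t where "t = inv_into C q"
  have CX: "c \<in> topspace X" if "c \<in> C" for c using C openin_subset that by blast
  have s: "s (p c) = c" and t: "t (q c) = c" if "c \<in> C" for c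
    using that C unfolding s_def t_def by auto
  define \<phi> where "\<phi> g = f (s (grng G g)) g (s (gsrc G g))" for g
  define \<psi> where "\<psi> h = f' (t (grng H h)) h (t (gsrc H h))" for h
  have \<phi>: "\<phi> g = f c g d" "\<phi> g \<in> arrows H" "grng H (\<phi> g) = q c" "gsrc H (\<phi> g) = q d" "\<psi> (\<phi> g) = g"
    if "g \<in> arrows G" "grng G g = p c" "gsrc G g = p d" "c \<in> C" "d \<in> C" for g c d
    using that s t CX unfolding \<phi>_def \<psi>_def by auto
  have \<psi>: "\<psi> h \<in> arrows G" "grng G (\<psi> h) = p c" "gsrc G (\<psi> h) = p d" "\<phi> (\<psi> h) = h"
    if "h \<in> arrows H" "grng H h = q c" "gsrc H h = q d" "c \<in> C" "d \<in> C" for h c d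
    using that s t CX unfolding \<phi>_def \<psi>_def by auto
  have "continuous_map (subtopology (unit_space G) (p ` C)) X s"
    unfolding s_def by (rule continuous_inverse_of_local_homeomorphism[OF p_lh C(1,2)])
  from continuous_map_o[OF _ this]
  have sc: "continuous_map T X (\<lambda>y. s (a y))"
    if "continuous_map T (unit_space G) a" "\<And>y. y \<in> topspace T \<Longrightarrow> a y \<in> p ` C"
      for a and T :: "'a topology"
    using that by (auto simp: continuous_map_in_subtopology)
  have "continuous_map (subtopology (unit_space H) (q ` C)) X t"
    unfolding t_def by (rule continuous_inverse_of_local_homeomorphism[OF q_lh C(1,3)])
  from continuous_map_o[OF _ this]
  have tc: "continuous_map T X (\<lambda>y. t (a y))"
    if "continuous_map T (unit_space H) a" "\<And>y. y \<in> topspace T \<Longrightarrow> a y \<in> q ` C"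
      for a and T :: "'b topology"
    using that by (auto simp: continuous_map_in_subtopology)
  let ?G = "reduction G (p ` C)" and ?H = "reduction H (q ` C)"
  have cG: "continuous_map (gtop ?G) (gtop G) (\<lambda>g. g)" and cH: "continuous_map (gtop ?H) (gtop H)
    (\<lambda>h. h)"
    by auto
  have "continuous_map (gtop ?G) (gtop H) \<phi>"
    unfolding \<phi>_def
    by (intro f_continuous_comp sc cG G.continuous_rng_comp G.continuous_src_comp)
      (use s in \<open>auto simp: arrows_reduction\<close>)
  moreover have "continuous_map (gtop ?H) (gtop G) \<psi>"
    unfolding \<psi>_def
    by (intro bridge.f_continuous_comp[OF bridge_sym] tc cH H.continuous_rng_comp H.continuous_src_comp)
      (use t in \<open>auto simp: arrows_reduction\<close>)
  ultimately have "homeomorphic_maps (gtop ?G) (gtop ?H) \<phi> \<psi>"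
    unfolding homeomorphic_maps_def
    using \<phi> \<psi> by (auto simp: continuous_map_in_subtopology arrows_reduction)
  then show ?thesis
  proof (rule isomorphicI)
    fix g assume g: "g \<in> arrows ?G"
    then obtain c d where cd: "g \<in> arrows G" "grng G g = p c" "gsrc G g = p d" "c \<in> C" "d \<in> C"
      by (auto simp: arrows_reduction)
    have "\<phi> (p c) = q c" "\<phi> (p d) = q d"
      using cd \<phi>(1)[of "p c" c c] \<phi>(1)[of "p d" d d] CX f_unit by auto
    then show "\<phi> (grng ?G g) = grng ?H (\<phi> g) \<and> \<phi> (gsrc ?G g) = gsrc ?H (\<phi> g)"
      using \<phi>[OF cd] cd by simp
  next
    fix g h assume "g \<in> arrows ?G" "h \<in> arrows ?G" "gsrc ?G g = grng ?G h"
    then obtain b c d where cd: "g \<in> arrows G" "grng G g = p b" "gsrc G g = p c" "b \<in> C" "c \<in> C"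
      and cd': "h \<in> arrows G" "grng G h = p c" "gsrc G h = p d" "c \<in> C" "d \<in> C"
      by (auto simp: arrows_reduction)
    have "\<phi> (gmult G g h) = f b (gmult G g h) d" using \<phi>(1)[of "gmult G g h" b d] cd cd' by simp
    then show "\<phi> (gmult ?G g h) = gmult ?H (\<phi> g) (\<phi> h)"
      using \<phi>(1)[OF cd] \<phi>(1)[OF cd'] f_mult[of b c d g h] CX cd cd' by simp
  qed
qed

end

text \<open>
  A point is discarded even if the earlier set that meets its image was itself discarded there.  Thus
  the image of \<open>B m\<close> meets only the parts with index at most \<open>m\<close>, which makes the union clopen.
\<close>

definition greedy_part :: "('x \<Rightarrow> 'a) \<Rightarrow> ('x \<Rightarrow> 'b) \<Rightarrow> (nat \<Rightarrow> 'x set) \<Rightarrow> nat \<Rightarrow> 'x set" where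
  "greedy_part p q B n = {b \<in> B n. p b \<notin> (\<Union>i<n. p ` B i) \<and> q b \<notin> (\<Union>i<n. q ` B i)}"

lemma local_homeomorphism_image_clopen:
  assumes "local_homeomorphism Z X p" "Hausdorff_space X" "openin Z B" "compactin Z B"
  shows "openin X (p ` B)" "compactin X (p ` B)" "closedin X (p ` B)"
proof -
  show "openin X (p ` B)" using local_homeomorphismD(2)[OF assms(1)] assms(3)
    unfolding open_map_def by blast
  show "compactin X (p ` B)" using image_compactin[OF assms(4) local_homeomorphismD(1)[OF assms(1)]] .
  then show "closedin X (p ` B)" using assms(2) compactin_imp_closedin by blast
qed

lemma openin_avoiding:
  assumes p: "local_homeomorphism Z X p" "Hausdorff_space X"
    and B: "openin Z B" and D: "\<And>i. i \<in> I \<Longrightarrow> openin Z (D i) \<and> compactin Z (D i)" "finite I"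
  shows "openin Z {b \<in> B. p b \<notin> (\<Union>i\<in>I. p ` D i)}"
proof -
  have "closedin X (\<Union>i\<in>I. p ` D i)"
    using D local_homeomorphism_image_clopen[OF p] by (intro closedin_Union) auto
  then have "openin X (topspace X - (\<Union>i\<in>I. p ` D i))" by blast
  from openin_continuous_map_preimage[OF local_homeomorphismD(1)[OF p(1)] this]
  have "openin Z (B \<inter> {z \<in> topspace Z. p z \<in> topspace X - (\<Union>i\<in>I. p ` D i)})" using B by blast
  moreover have "B \<inter> {z \<in> topspace Z. p z \<in> topspace X - (\<Union>i\<in>I. p ` D i)} = {b \<in> B. p b \<notin>
    (\<Union>i\<in>I. p ` D i)}"
    using openin_subset[OF B] local_homeomorphism_funcset[OF p(1)] by blast
  ultimately show ?thesis by simp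
qed

lemma greedy_part_open:
  assumes p: "local_homeomorphism Z X p" "Hausdorff_space X"
    and q: "local_homeomorphism Z Y q" "Hausdorff_space Y"
    and B: "\<And>n. openin Z (B n)" "\<And>n. compactin Z (B n)"
  shows "openin Z (greedy_part p q B n)"
proof -
  have "greedy_part p q B n = {b \<in> B n. p b \<notin> (\<Union>i\<in>{..<n}. p ` B i)} \<inter> {b \<in> B n. q b \<notin>
    (\<Union>i\<in>{..<n}. q ` B i)}"
    unfolding greedy_part_def by blast
  moreover have "openin Z {b \<in> B n. p b \<notin> (\<Union>i\<in>{..<n}. p ` B i)}"
    by (rule openin_avoiding[OF p]) (use B in auto)
  moreover have "openin Z {b \<in> B n. q b \<notin> (\<Union>i\<in>{..<n}. q ` B i)}"
    by (rule openin_avoiding[OF q]) (use B in auto)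
  ultimately show ?thesis by (simp only: openin_Int)
qed

lemma inj_on_UN_disjoint:
  assumes "\<And>n. inj_on p (C n)" "\<And>m n. m < n \<Longrightarrow> p ` C m \<inter> p ` C n = {}"
  shows "inj_on p (\<Union>n::nat. C n)"
proof (rule inj_onI)
  fix x y assume xy: "x \<in> (\<Union>n. C n)" "y \<in> (\<Union>n. C n)" "p x = p y"
  then obtain m n where mn: "x \<in> C m" "y \<in> C n" by auto
  have "m = n"
    using assms(2)[of m n] assms(2)[of n m] mn xy(3) by (metis disjoint_iff image_eqI linorder_neqE_nat)
  then show "x = y" using mn xy(3) assms(1) by (auto dest: inj_onD)
qed

lemma greedy_part_avoids:
  assumes "m < n"
  shows "p ` B m \<inter> p ` greedy_part p q B n = {}" "q ` B m \<inter> q ` greedy_part p q B n = {}"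
proof -
  have *: "p b \<notin> p ` B m" "q b \<notin> q ` B m" if "b \<in> greedy_part p q B n" for b
    using that assms unfolding greedy_part_def by auto
  show "p ` B m \<inter> p ` greedy_part p q B n = {}" "q ` B m \<inter> q ` greedy_part p q B n = {}"
    by (intro equals0I; metis * IntD1 IntD2 imageE)+
qed

lemma greedy_part_inj:
  assumes "\<And>n. inj_on p (B n)" "\<And>n. inj_on q (B n)"
  shows "inj_on p (\<Union>n. greedy_part p q B n)" "inj_on q (\<Union>n. greedy_part p q B n)"
proof -
  have sub: "greedy_part p q B n \<subseteq> B n" for n unfolding greedy_part_def by blast
  have p: "p ` greedy_part p q B m \<inter> p ` greedy_part p q B n = {}" if "m < n" for m n
  proof -
    have "p ` B m \<inter> p ` greedy_part p q B n = {}"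
      using greedy_part_avoids[OF that] by simp
    then show ?thesis using image_mono[OF sub[of m], of p] by blast
  qed
  have q: "q ` greedy_part p q B m \<inter> q ` greedy_part p q B n = {}" if "m < n" for m n
  proof -
    have "q ` B m \<inter> q ` greedy_part p q B n = {}"
      using greedy_part_avoids[OF that] by simp
    then show ?thesis using image_mono[OF sub[of m], of q] by blast
  qed
  show "inj_on p (\<Union>n. greedy_part p q B n)"
    by (rule inj_on_UN_disjoint[OF inj_on_subset[OF assms(1) sub] p])
  show "inj_on q (\<Union>n. greedy_part p q B n)"
    by (rule inj_on_UN_disjoint[OF inj_on_subset[OF assms(2) sub] q])
qed

text \<open>The complement is shown to be open near each of its points: such a point lies in the
  open image of some \<open>B m\<close>, and from this neighbourhood only the finitely many parts
  with index at most \<open>m\<close> have to be removed.\<close>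

lemma greedy_part_clopen:
  assumes p: "local_homeomorphism Z X p" "Hausdorff_space X"
    and q: "local_homeomorphism Z Y q" "Hausdorff_space Y"
    and B: "\<And>n. openin Z (B n)" "\<And>n. compactin Z (B n)" "(\<Union>n. p ` B n) = topspace X"
      "\<And>n. inj_on p (B n)"
  shows "clopenin X (p ` (\<Union>n. greedy_part p q B n))"
proof -
  define C where "C = greedy_part p q B"
  have C: "openin Z (C n)" for n unfolding C_def by (rule greedy_part_open[OF p q B(1,2)])
  have CB: "C n \<subseteq> B n" for n unfolding C_def greedy_part_def by blast
  have op: "openin X (p ` S)" if "openin Z S" for S
    using local_homeomorphismD(2)[OF p(1)] that unfolding open_map_def by blast
  have "openin X (p ` (\<Union>n. C n))" using C by (intro op) auto
  moreover have "openin X (topspace X - p ` (\<Union>n. C n))"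
  proof (subst openin_subopen, rule ballI)
    fix x assume x: "x \<in> topspace X - p ` (\<Union>n. C n)"
    then have "x \<in> (\<Union>n. p ` B n)" using B(3) by simp
    then obtain m where m: "x \<in> p ` B m" by blast
    have "closedin X (p ` C n)" for n
    proof -
      \<comment> \<open>The image of \<open>B n\<close> is compact, hence closed. The discarded
        points form an open subset of \<open>B n\<close>, and since \<open>p\<close> is injective on
        \<open>B n\<close> taking images commutes with the difference.\<close>
      have "p ` C n = p ` B n - p ` {b \<in> B n. b \<notin> C n}"
        using B(4)[of n] CB[of n] by (auto simp: inj_on_def)
      moreover have "{b \<in> B n. b \<notin> C n} = B n \<inter> {z \<in> topspace Z. p z \<in> (\<Union>i<n. p ` B i)} \<union>
          B n \<inter> {z \<in> topspace Z. q z \<in> (\<Union>i<n. q ` B i)}"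
        using openin_subset[OF B(1)[of n]] unfolding C_def greedy_part_def by blast
      moreover have "openin Z \<dots>"
        using B(1,2) local_homeomorphism_image_clopen(1)[OF p] local_homeomorphism_image_clopen(1)[OF q]
        by (intro openin_Un openin_Int openin_continuous_map_preimage[OF
          local_homeomorphismD(1)[OF p(1)]]
            openin_continuous_map_preimage[OF local_homeomorphismD(1)[OF q(1)]] openin_Union) auto
      ultimately show ?thesis
        using op local_homeomorphism_image_clopen(3)[OF p B(1,2)] by (metis closedin_diff)
    qed
    then have "closedin X (\<Union>n\<le>m. p ` C n)" by (intro closedin_Union) auto
    then have "openin X (p ` B m - (\<Union>n\<le>m. p ` C n))" using op B(1) by (intro openin_diff) auto
    moreover have "p ` B m - (\<Union>n\<le>m. p ` C n) \<subseteq> topspace X - p ` (\<Union>n. C n)"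
    proof
      fix y assume y: "y \<in> p ` B m - (\<Union>n\<le>m. p ` C n)"
      have "y \<notin> p ` C n" for n
        using y greedy_part_avoids(1)[of m n p B q] unfolding C_def by (cases "n \<le> m") auto
      moreover have "y \<in> topspace X" using y B(3) by (metis DiffD1 UNIV_I UN_I)
      ultimately show "y \<in> topspace X - p ` (\<Union>n. C n)" by auto
    qed
    ultimately show "\<exists>T. openin X T \<and> x \<in> T \<and> T \<subseteq> topspace X - p ` (\<Union>n. C n)"
      using x m by (intro exI[of _ "p ` B m - (\<Union>n\<le>m. p ` C n)"]) auto
  qed
  ultimately show ?thesis unfolding clopenin_def C_def by (simp add: closedin_def openin_subset)
qed

section \<open>From bridges to Kakutani equivalence and stable isomorphism\<close>

lemma greedy_part_commute: "greedy_part p q B = greedy_part q p B"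
  unfolding greedy_part_def by auto

text \<open>Merges a cover of the units of \<open>G\<close> with a cover of the units of
  \<open>H\<close> into one sequence, so that a single greedy selection treats both sides; in the
  stable case parity distinguishes the two kinds of stage.\<close>

definition interleave :: "(nat \<Rightarrow> 'x) \<Rightarrow> (nat \<Rightarrow> 'x) \<Rightarrow> nat \<Rightarrow> 'x" where
  "interleave A B n = (if even n then A (n div 2) else B (n div 2))"

lemma interleave_simps [simp]:
  "interleave A B (2 * n) = A n" "interleave A B (Suc (2 * n)) = B n"
  unfolding interleave_def by auto

lemma interleave_cases: "P (A (n div 2)) \<Longrightarrow> P (B (n div 2)) \<Longrightarrow> P (interleave A B n)"
  unfolding interleave_def by auto

lemma ample_unit_space:
  assumes "ample_Hausdorff_groupoid G"
  shows "zero_dimensional_space (unit_space G)" "Hausdorff_space (unit_space G)"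
    "local_homeomorphism (gtop G) (unit_space G) (grng G)"
    "local_homeomorphism (gtop G) (unit_space G) (gsrc G)"
    "openin (gtop G) (units G)" "topological_groupoid G" "groupoid G"
    "Hausdorff_space (gtop G)"
proof -
  interpret ample_Hausdorff_groupoid G by fact
  show "zero_dimensional_space (unit_space G)" "Hausdorff_space (unit_space G)"
    "local_homeomorphism (gtop G) (unit_space G) (grng G)"
    "local_homeomorphism (gtop G) (unit_space G) (gsrc G)"
    "openin (gtop G) (units G)" "topological_groupoid G" "groupoid G"
    "Hausdorff_space (gtop G)"
    by (fact zero_dimensional_unit_space Hausdorff_unit_space etale_rng etale_src open_units Hausdorff
        topological_groupoid_axioms groupoid_axioms)+
qed

context bridge
begin

text \<open>Clopenness comes from the selection; the remaining point is fullness. A discarded point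
  shares one of its two images with a point of an earlier set, so following these coincidences down
  the indices ends at a kept point, and every link of the chain stays inside one orbit.\<close>

lemma bridge_surjective_imp_Kakutani:
  assumes G: "ample_Hausdorff_groupoid G" "sigma_compact_space (unit_space G)"
    and H: "ample_Hausdorff_groupoid H" "sigma_compact_space (unit_space H)"
    and surj: "p ` topspace X = units G" "q ` topspace X = units H"
  shows "Kakutani_equivalent G H"
proof -
  note aG = ample_unit_space[OF G(1)] and aH = ample_unit_space[OF H(1)]
  have surj': "p ` topspace X = topspace (unit_space G)" "q ` topspace X = topspace (unit_space H)"
    using surj by auto
  obtain A :: "nat \<Rightarrow> 'x set" where A: "(\<forall>n. openin X (A n) \<and> compactin X (A n) \<and> inj_on p (A n)
    \<and> inj_on q (A n)) \<and>
      (\<Union>n. p ` A n) = topspace (unit_space G)"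
    using countable_compact_open_cover[OF p_lh surj'(1) q_lh aG(1) G(2)] by blast
  obtain A' :: "nat \<Rightarrow> 'x set" where A': "(\<forall>n. openin X (A' n) \<and> compactin X (A' n) \<and> inj_on q
    (A' n) \<and> inj_on p (A' n)) \<and>
      (\<Union>n. q ` A' n) = topspace (unit_space H)"
    using countable_compact_open_cover[OF q_lh surj'(2) p_lh aH(1) H(2)] by blast
  define B where "B = interleave A A'"
  have B: "openin X (B n)" "compactin X (B n)" "inj_on p (B n)" "inj_on q (B n)" for n
    using A A' unfolding B_def by (auto intro: interleave_cases)
  have BX: "B n \<subseteq> topspace X" for n using B(1) openin_subset by blast
  have pB: "(\<Union>n. p ` B n) = units G"
  proof
    show "(\<Union>n. p ` B n) \<subseteq> units G" using BX by (auto intro!: p_unit)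
    have "p ` A n \<subseteq> (\<Union>n. p ` B n)" for n unfolding B_def by (metis UNIV_I UN_upper interleave_simps(1))
    then have "(\<Union>n. p ` A n) \<subseteq> (\<Union>n. p ` B n)" by (rule UN_least)
    then show "units G \<subseteq> (\<Union>n. p ` B n)" using A by simp
  qed
  have qB: "(\<Union>n. q ` B n) = units H"
  proof
    show "(\<Union>n. q ` B n) \<subseteq> units H" using BX by (auto intro!: q_unit)
    have "q ` A' n \<subseteq> (\<Union>n. q ` B n)" for n unfolding B_def by (metis UNIV_I UN_upper interleave_simps(2))
    then have "(\<Union>n. q ` A' n) \<subseteq> (\<Union>n. q ` B n)" by (rule UN_least)
    then show "units H \<subseteq> (\<Union>n. q ` B n)" using A' by simp
  qed
  define C where "C = (\<Union>n. greedy_part p q B n)"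
  have "openin X C"
    unfolding C_def using greedy_part_open[where B = B, OF p_lh aG(2) q_lh aH(2) B(1,2)] by blast
  moreover have "inj_on p C" "inj_on q C"
    unfolding C_def using greedy_part_inj[of p B q] B by auto
  ultimately have "reduction G (p ` C) \<cong>\<^sub>G reduction H (q ` C)" by (rule bridge_reduction)
  moreover have "clopenin (unit_space G) (p ` C)"
    unfolding C_def by (rule greedy_part_clopen[where B
      = B, OF p_lh aG(2) q_lh aH(2) B(1,2) _ B(3)]) (simp add: pB)
  moreover have "clopenin (unit_space H) (q ` C)"
    unfolding C_def greedy_part_commute[of p q]
    by (rule greedy_part_clopen[where B = B, OF q_lh aH(2) p_lh aG(2) B(1,2) _ B(4)]) (simp add: qB)
  moreover
  have CX: "C \<subseteq> topspace X" using \<open>openin X C\<close> openin_subset by blast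
  have good: "\<exists>c\<in>C. \<exists>g\<in>arrows G. grng G g = p c \<and> gsrc G g = p b" if "b \<in> B n" for b n
    using that
  proof (induction n arbitrary: b rule: less_induct)
    case (less n)
    have bX: "b \<in> topspace X" using less.prems BX by blast
    consider "b \<in> greedy_part p q B n" | i a where "i < n" "a \<in> B i" "p b = p a"
      | i a where "i < n" "a \<in> B i" "q b = q a"
      using less.prems unfolding greedy_part_def by blast
    then show ?case
    proof cases
      case 1
      then have "b \<in> C" unfolding C_def by blast
      then show ?thesis using bX by (intro bexI[of _ b] bexI[of _ "p b"]) auto
    next
      case 2
      then show ?thesis using less.IH by metis
    next
      case 3
      then obtain c g where c: "c \<in> C" "g \<in> arrows G" "grng G g = p c" "gsrc G g = p a"
        using less.IH by blast
      have "a \<in> topspace X" using 3 BX by blast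
      then show ?thesis
        \<comment> \<open>The points \<open>a\<close> and \<open>b\<close> lie over the same unit of
          \<open>H\<close>; that unit, read as an arrow from \<open>b\<close> to \<open>a\<close>
          and moved to \<open>G\<close> by \<open>f'\<close>, runs from \<open>p b\<close> to
          \<open>p a\<close>.\<close>
        using c bX 3 by (intro bexI[of _ c] bexI[of _ "gmult G g (f' a (q b) b)"]) auto
    qed
  qed
  have "full G (p ` C)"
    unfolding full_def
  proof (intro conjI ballI)
    show "p ` C \<subseteq> units G" using CX by auto
    fix u assume "u \<in> units G"
    then obtain n b where b: "b \<in> B n" "u = p b" using pB by (metis (no_types, lifting) UN_E imageE)
    then show "p ` C \<inter> orbit G u \<noteq> {}"
      using good[OF b(1)] unfolding orbit_def by (auto simp: disjoint_iff) (metis imageI)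
  qed
  moreover have "full H (q ` C)"
    unfolding full_def
  proof (intro conjI ballI)
    show "q ` C \<subseteq> units H" using CX by auto
    fix v assume "v \<in> units H"
    then obtain n b where b: "b \<in> B n" "v = q b" using qB by (metis (no_types, lifting) UN_E imageE)
    then obtain c g where c: "c \<in> C" "g \<in> arrows G" "grng G g = p c" "gsrc G g = p b"
      using good[OF b(1)] by blast
    have "c \<in> topspace X" "b \<in> topspace X" using c b CX BX by blast+
    \<comment> \<open>The arrow found in \<open>G\<close> is carried to \<open>H\<close> by
      \<open>f\<close>, so one induction serves both groupoids.\<close>
    then have "f c g b \<in> arrows H" "grng H (f c g b) = q c" "gsrc H (f c g b) = v"
      using c b CX BX by auto
    then have "q c \<in> orbit H v" unfolding orbit_def by (intro CollectI exI[of _ "f c g b"]) simp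
    then have "q c \<in> q ` C \<inter> orbit H v" using c by auto
    then show "q ` C \<inter> orbit H v \<noteq> {}" by blast
  qed
  ultimately show ?thesis unfolding Kakutani_equivalent_def by blast
qed

end

section \<open>Stabilisation by the full equivalence relation and the back-and-forth
  argument\<close>

lemma prod_groupoid_simps [simp]:
  "gtop (G \<times>\<^sub>G H) = prod_topology (gtop G) (gtop H)"
  "grng (G \<times>\<^sub>G H) = map_prod (grng G) (grng H)"
  "gsrc (G \<times>\<^sub>G H) = map_prod (gsrc G) (gsrc H)"
  "gmult (G \<times>\<^sub>G H) = (\<lambda>(g, h) (g', h'). (gmult G g g', gmult H h h'))"
  "ginv (G \<times>\<^sub>G H) = map_prod (ginv G) (ginv H)"
  unfolding prod_groupoid_def by auto

lemma arrows_prod [simp]: "arrows (G \<times>\<^sub>G H) = arrows G \<times> arrows H"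
  unfolding arrows_def by simp

lemma units_prod: "units (G \<times>\<^sub>G H) = units G \<times> units H"
  unfolding units_def by auto

lemma unit_space_prod: "unit_space (G \<times>\<^sub>G H) = prod_topology (unit_space G) (unit_space H)"
  unfolding unit_space_def by (simp add: units_prod subtopology_Times)

lemma topological_groupoid_prod:
  assumes "topological_groupoid G" "topological_groupoid H"
  shows "topological_groupoid (G \<times>\<^sub>G H)"
proof -
  interpret G: topological_groupoid G by fact
  interpret H: topological_groupoid H by fact
  let ?C = "subtopology (prod_topology (gtop (G \<times>\<^sub>G H)) (gtop (G \<times>\<^sub>G H))) (composable (G \<times>\<^sub>G H))"
  have c1: "continuous_map ?C (prod_topology (gtop G) (gtop H)) fst"
    "continuous_map ?C (prod_topology (gtop G) (gtop H)) snd"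
    by (auto intro: continuous_map_subtopology_fst continuous_map_subtopology_snd)
  have m: "continuous_map ?C (prod_topology (gtop G) (gtop H))
      (\<lambda>t. (gmult G (fst (fst t)) (fst (snd t)), gmult H (snd (fst t)) (snd (snd t))))"
    by (intro continuous_map_pairedI G.continuous_mult_comp H.continuous_mult_comp
        continuous_map_o[OF c1(1) continuous_map_fst] continuous_map_o[OF c1(2) continuous_map_fst]
        continuous_map_o[OF c1(1) continuous_map_snd] continuous_map_o[OF c1(2) continuous_map_snd])
      (auto simp: composable_def)
  show ?thesis
  proof
    show "locally_compact_space (gtop (G \<times>\<^sub>G H))"
      using G.locally_compact H.locally_compact by (simp add: locally_compact_space_prod_topology)
    show "Hausdorff_space (unit_space (G \<times>\<^sub>G H))"
      using G.Hausdorff_unit_space H.Hausdorff_unit_space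
      by (simp add: unit_space_prod Hausdorff_space_prod_topology)
    show "continuous_map (gtop (G \<times>\<^sub>G H)) (unit_space (G \<times>\<^sub>G H)) (grng (G \<times>\<^sub>G H))"
      using G.continuous_rng H.continuous_rng
        by (simp add: unit_space_prod map_prod_def continuous_map_prod_top)
    show "continuous_map (gtop (G \<times>\<^sub>G H)) (unit_space (G \<times>\<^sub>G H)) (gsrc (G \<times>\<^sub>G H))"
      using G.continuous_src H.continuous_src
        by (simp add: unit_space_prod map_prod_def continuous_map_prod_top)
    show "continuous_map (gtop (G \<times>\<^sub>G H)) (gtop (G \<times>\<^sub>G H)) (ginv (G \<times>\<^sub>G H))"
      using G.continuous_inv H.continuous_inv by (simp add: map_prod_def continuous_map_prod_top)
    show "continuous_map ?C (gtop (G \<times>\<^sub>G H)) (\<lambda>(g, h). gmult (G \<times>\<^sub>G H) g h)"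
      using m by (simp add: case_prod_unfold)
  qed (auto simp: units_prod composable_def G.assoc H.assoc)
qed

lemma R_simps [simp]:
  "gtop \<R> = discrete_topology UNIV"
  "grng \<R> = (\<lambda>(m, n). (m, m))" "gsrc \<R> = (\<lambda>(m, n). (n, n))"
  "gmult \<R> = (\<lambda>(m, n) (n', p). (m, p))" "ginv \<R> = (\<lambda>(m, n). (n, m))"
  unfolding full_equivalence_relation_def by auto

lemma arrows_R [simp]: "arrows \<R> = UNIV"
  unfolding arrows_def by simp

lemma units_R: "units \<R> = range (\<lambda>m. (m, m))"
  unfolding units_def by auto

lemma unit_space_R: "unit_space \<R> = discrete_topology (units \<R>)"
  unfolding unit_space_def by simp

lemma topological_groupoid_R: "topological_groupoid \<R>"
proof
  show "locally_compact_space (gtop \<R>)" by (simp add: locally_compact_space_discrete_topology)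
  show "continuous_map (subtopology (prod_topology (gtop \<R>) (gtop \<R>)) (composable \<R>)) (gtop \<R>)
     (\<lambda>(g, h). gmult \<R> g h)"
    by (simp flip: prod_topology_discrete_topology)
qed (auto simp: units_R unit_space_R composable_def)

text \<open>In contrast to \<open>greedy_part\<close>, a new point is compared only with the points
  kept so far. It is thus rejected only when one of its images is already covered by a kept point,
  which is what an exhaustion argument can exploit.\<close>

primrec greedy_union :: "('x \<Rightarrow> 'a) \<Rightarrow> ('x \<Rightarrow> 'b) \<Rightarrow> (nat \<Rightarrow> 'x set) \<Rightarrow> nat \<Rightarrow> 'x set" where
  "greedy_union p q B 0 = {}"
| "greedy_union p q B (Suc n) = greedy_union p q B n \<union>
     {b \<in> B n. p b \<notin> p ` greedy_union p q B n \<and> q b \<notin> q ` greedy_union p q B n}"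

lemma greedy_union_subset: "greedy_union p q B n \<subseteq> (\<Union>i<n. B i)"
  by (induction n) (auto simp: lessThan_Suc)

lemma greedy_union_mono: "m \<le> n \<Longrightarrow> greedy_union p q B m \<subseteq> greedy_union p q B n"
  by (rule lift_Suc_mono_le[of "greedy_union p q B"]) auto

lemma greedy_union_inj:
  assumes "\<And>n. inj_on p (B n)" "\<And>n. inj_on q (B n)"
  shows "inj_on p (\<Union>n. greedy_union p q B n)" "inj_on q (\<Union>n. greedy_union p q B n)"
proof -
  have n: "inj_on p (greedy_union p q B n) \<and> inj_on q (greedy_union p q B n)" for n
  proof (induction n)
    case (Suc n)
    let ?S = "{b \<in> B n. p b \<notin> p ` greedy_union p q B n \<and> q b \<notin> q ` greedy_union p q B n}"
    have "inj_on p ?S" "inj_on q ?S" using assms[of n] by (auto simp: inj_on_def)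
    moreover have "p x \<noteq> p y" "q x \<noteq> q y" if "x \<in> greedy_union p q B n" "y \<in> ?S" for x y
      using that by (metis (mono_tags, lifting) image_eqI mem_Collect_eq)+
    ultimately show ?case using Suc.IH
      by (auto simp: inj_on_Un disjoint_iff)
  qed simp
  have "\<exists>n. x \<in> greedy_union p q B n \<and> y \<in> greedy_union p q B n"
    if "x \<in> (\<Union>n. greedy_union p q B n)" "y \<in> (\<Union>n. greedy_union p q B n)" for x y
  proof -
    obtain m n where "x \<in> greedy_union p q B m" "y \<in> greedy_union p q B n" using \<open>x \<in> _\<close> \<open>y \<in> _\<close>
      by blast
    then show ?thesis
      using greedy_union_mono[of m "max m n" p q B] greedy_union_mono[of n "max m n" p q B]
      by (intro exI[of _ "max m n"]) auto
  qed
  then show "inj_on p (\<Union>n. greedy_union p q B n)" "inj_on q (\<Union>n. greedy_union p q B n)"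
    using n unfolding inj_on_def by metis+
qed

text \<open>Openness and compactness have to be carried together: a compact open union has clopen
  images in the Hausdorff spaces \<open>X\<close> and \<open>Y\<close>, so avoiding these images is
  a clopen condition, and the points selected from the compact open \<open>B n\<close> again form a
  compact open set.\<close>

lemma greedy_union_open:
  assumes p: "local_homeomorphism Z X p" "Hausdorff_space X"
    and q: "local_homeomorphism Z Y q" "Hausdorff_space Y"
    and B: "\<And>n. openin Z (B n)" "\<And>n. compactin Z (B n)"
  shows "openin Z (greedy_union p q B n) \<and> compactin Z (greedy_union p q B n)"
proof (induction n)
  case (Suc n)
  let ?D = "greedy_union p q B n"
  let ?P = "{z \<in> topspace Z. p z \<in> topspace X - p ` ?D}" and ?Q = "{z \<in> topspace Z. q z
    \<in> topspace Y - q ` ?D}"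
  have D: "openin Z ?D" "compactin Z ?D" using Suc.IH by auto
  note pD = local_homeomorphism_image_clopen[OF p D] and qD = local_homeomorphism_image_clopen[OF q D]
  have eq: "{b \<in> B n. p b \<notin> p ` ?D \<and> q b \<notin> q ` ?D} = (?P \<inter> ?Q) \<inter> B n"
    using openin_subset[OF B(1)[of n]] local_homeomorphism_funcset[OF p(1)]
      local_homeomorphism_funcset[OF q(1)]
    by blast
  have "openin Z ((?P \<inter> ?Q) \<inter> B n)"
    using pD(3) qD(3) B(1)[of n]
    by (intro openin_Int openin_continuous_map_preimage[OF local_homeomorphismD(1)[OF p(1)]]
        openin_continuous_map_preimage[OF local_homeomorphismD(1)[OF q(1)]]) auto
  moreover have "closedin Z (?P \<inter> ?Q)"
    using pD(1) qD(1)
    by (intro closedin_Int closedin_continuous_map_preimage[OF local_homeomorphismD(1)[OF p(1)]]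
        closedin_continuous_map_preimage[OF local_homeomorphismD(1)[OF q(1)]]) auto
  then have "compactin Z ((?P \<inter> ?Q) \<inter> B n)"
    using closed_Int_compactin[of Z "?P \<inter> ?Q" "B n"] B(2)[of n] by blast
  ultimately show ?case using D unfolding greedy_union.simps eq
    by (simp add: openin_Un compactin_Un)
qed simp

text \<open>If the \<open>q\<close>-image of \<open>b\<close> is still free at stage
  \<open>n\<close>, only a coincidence of \<open>p\<close>-images can reject \<open>b\<close>, and
  then \<open>p b\<close> is covered already. Hence a stage with a free index on one side never
  fails to cover what it aims at on the other.\<close>

lemma greedy_union_new:
  assumes "b \<in> B n" "q b \<notin> q ` greedy_union p q B n"
  shows "p b \<in> p ` (\<Union>n. greedy_union p q B n)"
proof (cases "p b \<in> p ` greedy_union p q B n")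
  case True
  then show ?thesis by blast
next
  case False
  then have "b \<in> greedy_union p q B (Suc n)" using assms by simp
  then show ?thesis by blast
qed

lemma greedy_union_commute: "greedy_union p q B n = greedy_union q p B n"
  by (induction n) auto

context bridge
begin

text \<open>A point carries two independent indices, \<open>m\<close> on the side of
  \<open>G\<close> and \<open>n\<close> on the side of \<open>H\<close>. This freedom permits one of
  them to be fixed by the unit that has to be covered while the other is chosen fresh.\<close>

lemma bridge_times_R:
  "bridge (G \<times>\<^sub>G \<R>) (H \<times>\<^sub>G \<R>) (prod_topology X (discrete_topology UNIV))
     (\<lambda>(x, m, n). (p x, m, m)) (\<lambda>(x, m, n). (q x, n, n))
     (\<lambda>(x, m, n) (g, _) (x', m', n'). (f x g x', n, n'))
     (\<lambda>(x, m, n) (h, _) (x', m', n'). (f' x h x', m, m'))"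
    (is "bridge _ _ ?Z ?P ?Q ?F ?F'")
proof -
  interpret GR: topological_groupoid "G \<times>\<^sub>G \<R>"
    by (rule topological_groupoid_prod[OF G.topological_groupoid_axioms topological_groupoid_R])
  interpret HR: topological_groupoid "H \<times>\<^sub>G \<R>"
    by (rule topological_groupoid_prod[OF H.topological_groupoid_axioms topological_groupoid_R])
  have pq: "?P = map_prod p (\<lambda>(m, n). (m, m))" "?Q = map_prod q (\<lambda>(m, n). (n, n))"
    by (auto simp: fun_eq_iff)
  let ?D = "discrete_topology (UNIV :: (nat \<times> nat) set)"
  have disc: "continuous_map T ?D (\<lambda>t. (k (a t), k (b t)))"
    if "continuous_map T ?D a" "continuous_map T ?D b"
      for T :: "'t topology" and a b and k :: "nat \<times> nat \<Rightarrow> nat"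
  proof -
    have "continuous_map T (prod_topology (discrete_topology UNIV) (discrete_topology UNIV)) (\<lambda>t.
      (k (a t), k (b t)))"
      by (intro continuous_map_pairedI continuous_map_o[OF that(1)] continuous_map_o[OF that(2)]) auto
    then show ?thesis by (simp flip: prod_topology_discrete_topology)
  qed
  show ?thesis
  proof
    show "local_homeomorphism ?Z (unit_space (G \<times>\<^sub>G \<R>)) ?P"
      unfolding unit_space_prod unit_space_R pq
      by (intro local_homeomorphism_map_prod p_lh local_homeomorphism_discrete) (auto simp: units_R)
    show "local_homeomorphism ?Z (unit_space (H \<times>\<^sub>G \<R>)) ?Q"
      unfolding unit_space_prod unit_space_R pq
      by (intro local_homeomorphism_map_prod q_lh local_homeomorphism_discrete) (auto simp: units_R)
    show "\<exists>g\<in>arrows (G \<times>\<^sub>G \<R>). \<exists>x\<in>topspace ?Z. grng (G \<times>\<^sub>G \<R>) g = u \<and> gsrc (G \<times>\<^sub>G \<R>) g = ?P x"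
      if "u \<in> units (G \<times>\<^sub>G \<R>)" for u
    proof -
      obtain v m where u: "u = (v, m, m)" "v \<in> units G" using \<open>u \<in> _\<close> unfolding units_prod units_R
        by auto
      then obtain g x where "g \<in> arrows G" "x \<in> topspace X" "grng G g = v" "gsrc G g = p x"
        using p_full by blast
      then show ?thesis using u by (intro bexI[of _ "(g, m, m)"] bexI[of _ "(x, m, m)"]) auto
    qed
    show "\<exists>g\<in>arrows (H \<times>\<^sub>G \<R>). \<exists>x\<in>topspace ?Z. grng (H \<times>\<^sub>G \<R>) g = u \<and> gsrc (H \<times>\<^sub>G \<R>) g = ?Q x"
      if "u \<in> units (H \<times>\<^sub>G \<R>)" for u
    proof -
      obtain v m where u: "u = (v, m, m)" "v \<in> units H" using \<open>u \<in> _\<close> unfolding units_prod units_R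
        by auto
      then obtain g x where "g \<in> arrows H" "x \<in> topspace X" "grng H g = v" "gsrc H g = q x"
        using q_full by blast
      then show ?thesis using u by (intro bexI[of _ "(g, m, m)"] bexI[of _ "(x, m, m)"]) auto
    qed
    let ?A = "gtop (fibred_groupoid (G \<times>\<^sub>G \<R>) ?Z ?P)" and ?B = "gtop (fibred_groupoid (H \<times>\<^sub>G \<R>) ?Z ?Q)"
    have pA: "continuous_map ?A (prod_topology X ?D) fst"
      "continuous_map ?A (prod_topology (gtop G) ?D) (\<lambda>t. fst (snd t))"
      "continuous_map ?A (prod_topology X ?D) (\<lambda>t. snd (snd t))"
      using continuous_map_fibred_projections[of "G \<times>\<^sub>G \<R>" ?Z ?P] by auto
    have pB: "continuous_map ?B (prod_topology X ?D) fst"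
      "continuous_map ?B (prod_topology (gtop H) ?D) (\<lambda>t. fst (snd t))"
      "continuous_map ?B (prod_topology X ?D) (\<lambda>t. snd (snd t))"
      using continuous_map_fibred_projections[of "H \<times>\<^sub>G \<R>" ?Z ?Q] by auto
    have "continuous_map ?A (prod_topology (gtop H) ?D)
        (\<lambda>t. (f (fst (fst t)) (fst (fst (snd t))) (fst (snd (snd t))), snd (snd (fst t)), snd (snd
          (snd (snd t)))))"
      by (intro continuous_map_pairedI f_continuous_comp disc
          continuous_map_o[OF pA(1) continuous_map_fst] continuous_map_o[OF pA(1) continuous_map_snd]
          continuous_map_o[OF pA(2) continuous_map_fst]
          continuous_map_o[OF pA(3) continuous_map_fst] continuous_map_o[OF pA(3) continuous_map_snd])
        (auto simp: arrows_fibred)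
    then show "continuous_map ?A (gtop (H \<times>\<^sub>G \<R>)) (\<lambda>t. ?F (fst t) (fst (snd t)) (snd (snd t)))"
      by (simp add: case_prod_unfold)
    have "continuous_map ?B (prod_topology (gtop G) ?D)
        (\<lambda>t. (f' (fst (fst t)) (fst (fst (snd t))) (fst (snd (snd t))), fst (snd (fst t)), fst
          (snd (snd (snd t)))))"
      by (intro continuous_map_pairedI bridge.f_continuous_comp[OF bridge_sym] disc
          continuous_map_o[OF pB(1) continuous_map_fst] continuous_map_o[OF pB(1) continuous_map_snd]
          continuous_map_o[OF pB(2) continuous_map_fst]
          continuous_map_o[OF pB(3) continuous_map_fst] continuous_map_o[OF pB(3) continuous_map_snd])
        (auto simp: arrows_fibred)
    then show "continuous_map ?B (gtop (G \<times>\<^sub>G \<R>)) (\<lambda>t. ?F' (fst t) (fst (snd t)) (snd (snd t)))"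
      by (simp add: case_prod_unfold)
  qed (auto simp: f_mult)
qed

lemma bridge_surjective_imp_stably_isomorphic:
  assumes G: "ample_Hausdorff_groupoid G" "sigma_compact_space (unit_space G)"
    and H: "ample_Hausdorff_groupoid H" "sigma_compact_space (unit_space H)"
    and surj: "p ` topspace X = units G" "q ` topspace X = units H"
  shows "G \<times>\<^sub>G \<R> \<cong>\<^sub>G H \<times>\<^sub>G \<R>"
proof -
  note aG = ample_unit_space[OF G(1)] and aH = ample_unit_space[OF H(1)]
  have surj': "p ` topspace X = topspace (unit_space G)" "q ` topspace X = topspace (unit_space H)"
    using surj by auto
  obtain A :: "nat \<Rightarrow> 'x set" where A: "(\<forall>n. openin X (A n) \<and> compactin X (A n) \<and> inj_on p (A n)
    \<and> inj_on q (A n)) \<and>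
      (\<Union>n. p ` A n) = topspace (unit_space G)"
    using countable_compact_open_cover[OF p_lh surj'(1) q_lh aG(1) G(2)] by blast
  obtain A' :: "nat \<Rightarrow> 'x set" where A': "(\<forall>n. openin X (A' n) \<and> compactin X (A' n) \<and> inj_on q
    (A' n) \<and> inj_on p (A' n)) \<and>
      (\<Union>n. q ` A' n) = topspace (unit_space H)"
    using countable_compact_open_cover[OF q_lh surj'(2) p_lh aH(1) H(2)] by blast
  let ?Z = "prod_topology X (discrete_topology (UNIV :: (nat \<times> nat) set))"
  define P where "P = (\<lambda>(x, m :: nat, n :: nat). (p x, m, m))"
  define Q where "Q = (\<lambda>(x, m :: nat, n :: nat). (q x, n, n))"
  interpret R: bridge "G \<times>\<^sub>G \<R>" "H \<times>\<^sub>G \<R>" ?Z P Q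
    "\<lambda>(x, m, n) (g, _) (x', m', n'). (f x g x', n, n')"
    "\<lambda>(x, m, n) (h, _) (x', m', n'). (f' x h x', m, m')"
    unfolding P_def Q_def by (rule bridge_times_R)
  \<comment> \<open>Stage \<open>2 j\<close> has to cover \<open>p ` A i \<times> {k}\<close>, where \<open>(i, k)\<close> has code \<open>j \<ge> k\<close>.  It uses the index
    \<open>j\<close> on the
    side of \<open>H\<close>, which is still unused: earlier even stages used smaller indices, and so did earlier
    odd stages, as they only cover indices bounded by their codes.  Odd stages are symmetric.\<close>
  define B where "B = interleave
    (\<lambda>j. case prod_decode j of (i, k) \<Rightarrow> A i \<times> {(k, j)})
    (\<lambda>j. case prod_decode j of (i, l) \<Rightarrow> A' i \<times> {(Suc j, l)})"
  have B0: "B (2 * prod_encode (i, k)) = A i \<times> {(k, prod_encode (i, k))}" for i k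
    unfolding B_def by simp
  \<comment> \<open>With code \<open>j\<close>, the even stage \<open>2 * j\<close> comes before
    this one and may use an index on the side of \<open>G\<close> as large as \<open>j\<close>;
    hence \<open>Suc j\<close>, not \<open>j\<close>, is the fresh index here.\<close>
  have B1: "B (Suc (2 * prod_encode (i, l))) = A' i \<times> {(Suc (prod_encode (i, l)), l)}" for i l
    unfolding B_def by simp
  have B_cases: "(\<exists>i k. n = 2 * prod_encode (i, k)) \<or> (\<exists>i l. n = Suc (2 * prod_encode (i, l)))" for n
    by (metis evenE oddE Suc_eq_plus1 prod_decode_inverse surj_pair)
  have B: "openin ?Z (B n)" "compactin ?Z (B n)" "inj_on P (B n)" "inj_on Q (B n)" for n
    using B_cases[of n] A A' unfolding P_def Q_def
    by (auto simp: B0 B1 openin_prod_Times_iff compactin_Times inj_on_def)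
  define C where "C = (\<Union>n. greedy_union P Q B n)"
  have HR: "Hausdorff_space (unit_space (G \<times>\<^sub>G \<R>))" "Hausdorff_space (unit_space (H \<times>\<^sub>G \<R>))"
    by (rule R.G.Hausdorff_unit_space R.H.Hausdorff_unit_space)+
  have op: "openin ?Z C"
    unfolding C_def using greedy_union_open[where B = B, OF R.p_lh HR(1) R.q_lh HR(2) B(1,2)] by blast
  have inj: "inj_on P C" "inj_on Q C" unfolding C_def by (rule greedy_union_inj[OF B(3,4)])+
  have CZ: "C \<subseteq> topspace ?Z" using op openin_subset by blast
  have "P ` C = units (G \<times>\<^sub>G \<R>)"
  proof
    show "P ` C \<subseteq> units (G \<times>\<^sub>G \<R>)" using CZ R.p_unit by blast
    show "units (G \<times>\<^sub>G \<R>) \<subseteq> P ` C"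
    proof
      fix w assume "w \<in> units (G \<times>\<^sub>G \<R>)"
      then obtain u k where w: "w = (u, k, k)" "u \<in> units G" unfolding units_prod units_R by auto
      then have "u \<in> (\<Union>n. p ` A n)" using A by simp
      then obtain i x where x: "x \<in> A i" "u = p x" by blast
      define j where "j = prod_encode (i, k)"
      have b: "(x, k, j) \<in> B (2 * j)" using x B0[of i k] unfolding j_def by simp
      have "n \<noteq> j" if "(y, m, n) \<in> B a" "a < 2 * j" for y m n a
      proof -
        consider i' l where "a = 2 * prod_encode (i', l)" | i' l where "a = Suc (2 * prod_encode
          (i', l))"
          using B_cases[of a] by blast
        then show ?thesis
        proof cases
          case 1
          then show ?thesis using that by (auto simp: B0)
        next
          case 2
          then show ?thesis using that le_prod_encode_2[of l i'] by (auto simp: B1)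
        qed
      qed
      then have "Q (x, k, j) \<notin> Q ` greedy_union P Q B (2 * j)"
        using greedy_union_subset[of P Q B "2 * j"] unfolding Q_def by fastforce
      then have "P (x, k, j) \<in> P ` C"
        unfolding C_def by (rule greedy_union_new[where B = B, OF b])
      then show "w \<in> P ` C" using w x by (simp add: P_def)
    qed
  qed
  moreover have "Q ` C = units (H \<times>\<^sub>G \<R>)"
  proof
    show "Q ` C \<subseteq> units (H \<times>\<^sub>G \<R>)" using CZ R.q_unit by blast
    show "units (H \<times>\<^sub>G \<R>) \<subseteq> Q ` C"
    proof
      fix w assume "w \<in> units (H \<times>\<^sub>G \<R>)"
      then obtain u l where w: "w = (u, l, l)" "u \<in> units H" unfolding units_prod units_R by auto
      then have "u \<in> (\<Union>n. q ` A' n)" using A' by simp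
      then obtain i x where x: "x \<in> A' i" "u = q x" by blast
      define j where "j = prod_encode (i, l)"
      have b: "(x, Suc j, l) \<in> B (Suc (2 * j))" using x B1[of i l] unfolding j_def by simp
      have "m \<noteq> Suc j" if "(y, m, n) \<in> B a" "a < Suc (2 * j)" for y m n a
      proof -
        consider i' k where "a = 2 * prod_encode (i', k)" | i' k where "a = Suc (2 * prod_encode
          (i', k))"
          using B_cases[of a] by blast
        then show ?thesis
        proof cases
          case 1
          then show ?thesis using that le_prod_encode_2[of k i'] by (auto simp: B0)
        next
          case 2
          then show ?thesis using that by (auto simp: B1)
        qed
      qed
      then have "P (x, Suc j, l) \<notin> P ` greedy_union Q P B (Suc (2 * j))"
        using greedy_union_subset[of Q P B "Suc (2 * j)"] unfolding P_def by fastforce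
      then have "Q (x, Suc j, l) \<in> Q ` C"
        unfolding C_def greedy_union_commute[of P] by (rule greedy_union_new[where B = B, OF b])
      then show "w \<in> Q ` C" using w x by (simp add: Q_def)
    qed
  qed
  \<comment> \<open>Both images are the whole unit spaces, so the two reductions along
    \<open>C\<close> are the two products themselves.\<close>
  ultimately show ?thesis
    using R.bridge_reduction[OF op inj] by (simp add: R.G.reduction_units R.H.reduction_units)
qed

lemma bridge_imp_stably_isomorphic:
  assumes G: "ample_Hausdorff_groupoid G" "sigma_compact_space (unit_space G)"
    and H: "ample_Hausdorff_groupoid H" "sigma_compact_space (unit_space H)"
  shows "G \<times>\<^sub>G \<R> \<cong>\<^sub>G H \<times>\<^sub>G \<R>"
  using bridge_surjective[OF ample_unit_space(3)[OF G(1)] ample_unit_space(3)[OF H(1)]]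
    bridge.bridge_surjective_imp_stably_isomorphic G H by metis

end

section \<open>Stable isomorphism and similarity\<close>

lemma groupoid_homD:
  assumes "groupoid_hom G H \<phi>"
  shows "g \<in> arrows G \<Longrightarrow> \<phi> g \<in> arrows H"
    "g \<in> arrows G \<Longrightarrow> \<phi> (grng G g) = grng H (\<phi> g)"
    "g \<in> arrows G \<Longrightarrow> \<phi> (gsrc G g) = gsrc H (\<phi> g)"
    "g \<in> arrows G \<Longrightarrow> h \<in> arrows G \<Longrightarrow> gsrc G g = grng G h \<Longrightarrow> \<phi> (gmult G g h) = gmult H (\<phi> g) (\<phi> h)"
  using assms unfolding groupoid_hom_def composable_def by auto

lemma groupoid_homI:
  assumes "\<And>g. g \<in> arrows G \<Longrightarrow> \<phi> g \<in> arrows H \<and> \<phi> (grng G g) = grng H (\<phi> g) \<and> \<phi> (gsrc G g) = gsrc H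
    (\<phi> g)"
    and "\<And>g h. g \<in> arrows G \<Longrightarrow> h \<in> arrows G \<Longrightarrow> gsrc G g = grng G h \<Longrightarrow>
      \<phi> (gmult G g h) = gmult H (\<phi> g) (\<phi> h)"
  shows "groupoid_hom G H \<phi>"
  using assms unfolding groupoid_hom_def composable_def by blast

lemma groupoid_hom_inverse:
  assumes "groupoid G" "homeomorphic_maps (gtop G) (gtop H) \<phi> \<psi>" "groupoid_hom G H \<phi>"
  shows "groupoid_hom H G \<psi>"
proof -
  interpret groupoid G by fact
  have \<psi>\<phi>: "\<psi> (\<phi> g) = g" if "g \<in> arrows G" for g using assms(2) that
    unfolding homeomorphic_maps_def by auto
  have \<psi>: "\<psi> h \<in> arrows G" "\<phi> (\<psi> h) = h" if "h \<in> arrows H" for h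
    using assms(2) that unfolding homeomorphic_maps_def by (auto intro: continuous_map_arrow)
  have r: "\<psi> (grng H h) = grng G (\<psi> h)" "\<psi> (gsrc H h) = gsrc G (\<psi> h)" if "h \<in> arrows H" for h
    using groupoid_homD(2,3)[OF assms(3) \<psi>(1)[OF that]] \<psi>[OF that] \<psi>\<phi>
      by (metis arrow_simps(1,2) unit_simps(1))+
  show ?thesis
  proof (rule groupoid_homI)
    fix h h' assume h: "h \<in> arrows H" "h' \<in> arrows H" "gsrc H h = grng H h'"
    then have "gsrc G (\<psi> h) = grng G (\<psi> h')" using r by metis
    then show "\<psi> (gmult H h h') = gmult G (\<psi> h) (\<psi> h')"
      using groupoid_homD(4)[OF assms(3), of "\<psi> h" "\<psi> h'"] h \<psi> \<psi>\<phi> by (metis mult_simps(1))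
  qed (use r \<psi> in auto)
qed

lemma isomorphic_obtain:
  assumes "G \<cong>\<^sub>G H" "groupoid G"
  obtains \<phi> \<psi> where "homeomorphic_maps (gtop G) (gtop H) \<phi> \<psi>" "groupoid_hom G H \<phi>" "groupoid_hom H G \<psi>"
  using assms groupoid_hom_inverse unfolding isomorphic_def groupoid_iso_def
    by (metis homeomorphic_map_maps)

lemma isomorphic_hom:
  assumes "homeomorphic_maps (gtop G) (gtop H) \<phi> \<psi>" "groupoid_hom G H \<phi>"
  shows "G \<cong>\<^sub>G H"
  using assms homeomorphic_maps_imp_map unfolding isomorphic_def groupoid_iso_def by blast

lemma isomorphic_sym:
  assumes "G \<cong>\<^sub>G H" "groupoid G"
  shows "H \<cong>\<^sub>G G"
  using isomorphic_obtain[OF assms] isomorphic_hom homeomorphic_maps_sym by metis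

lemma groupoid_hom_compose:
  assumes "groupoid_hom G H \<phi>" "groupoid_hom H K \<psi>"
  shows "groupoid_hom G K (\<lambda>g. \<psi> (\<phi> g))"
proof (rule groupoid_homI)
  note h1 = groupoid_homD[OF assms(1)] and h2 = groupoid_homD[OF assms(2)]
  show "\<psi> (\<phi> g) \<in> arrows K \<and> \<psi> (\<phi> (grng G g)) = grng K (\<psi> (\<phi> g)) \<and> \<psi> (\<phi> (gsrc G g)) = gsrc K (\<psi> (\<phi> g))"
    if "g \<in> arrows G" for g
    using that h1 h2 by simp
  show "\<psi> (\<phi> (gmult G g h)) = gmult K (\<psi> (\<phi> g)) (\<psi> (\<phi> h))"
    if "g \<in> arrows G" "h \<in> arrows G" "gsrc G g = grng G h" for g h
    using that h1 h2 by metis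
qed

lemma isomorphic_trans:
  assumes "G \<cong>\<^sub>G H" "H \<cong>\<^sub>G K"
  shows "G \<cong>\<^sub>G K"
proof -
  obtain \<phi> \<psi> where "groupoid_iso G H \<phi>" "groupoid_iso H K \<psi>" using assms unfolding isomorphic_def
    by blast
  then have "groupoid_iso G K (\<lambda>g. \<psi> (\<phi> g))"
    using groupoid_hom_compose[of G H \<phi> K \<psi>] homeomorphic_map_compose[of "gtop G" "gtop H" \<phi> "gtop K" \<psi>]
    unfolding groupoid_iso_def by (simp add: comp_def)
  then show ?thesis unfolding isomorphic_def by blast
qed

lemma isomorphic_prod:
  assumes "G \<cong>\<^sub>G H"
  shows "G \<times>\<^sub>G K \<cong>\<^sub>G H \<times>\<^sub>G K"
proof -
  obtain \<phi> \<psi> where h: "homeomorphic_maps (gtop G) (gtop H) \<phi> \<psi>" "groupoid_hom G H \<phi>"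
    using assms unfolding isomorphic_def groupoid_iso_def homeomorphic_map_maps by blast
  have "homeomorphic_maps (gtop K) (gtop K) id id" by (simp add: homeomorphic_maps_def)
  then have "homeomorphic_maps (prod_topology (gtop G) (gtop K)) (prod_topology (gtop H) (gtop K))
      (\<lambda>(x, y). (\<phi> x, id y)) (\<lambda>(x, y). (\<psi> x, id y))"
    using h(1) homeomorphic_maps_prod by blast
  moreover have "groupoid_hom (G \<times>\<^sub>G K) (H \<times>\<^sub>G K) (\<lambda>(x, y). (\<phi> x, id y))"
    by (rule groupoid_homI) (use groupoid_homD[OF h(2)] in \<open>auto simp: map_prod_def\<close>)
  ultimately show ?thesis using isomorphic_hom by (metis prod_groupoid_simps(1))
qed

lemma local_homeomorphism_fst_discrete:
  "local_homeomorphism (prod_topology X (discrete_topology A)) X fst"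
  unfolding local_homeomorphism_iff
proof (intro conjI ballI)
  fix t assume "t \<in> topspace (prod_topology X (discrete_topology A))"
  then show "\<exists>U. openin (prod_topology X (discrete_topology A)) U \<and> t \<in> U \<and> inj_on fst U"
    by (intro exI[of _ "topspace X \<times> {snd t}"]) (auto simp: openin_prod_Times_iff inj_on_def)
qed (auto simp: continuous_map_fst open_map_fst)

lemma local_homeomorphism_slice_discrete:
  fixes X :: "'a topology"
  shows "local_homeomorphism X (prod_topology X (discrete_topology UNIV)) (\<lambda>x. (x, c))"
  unfolding local_homeomorphism_iff
proof (intro conjI ballI)
  have "(\<lambda>x. (x, c)) ` U = U \<times> {c}" for U :: "'a set" by auto
  then show "open_map X (prod_topology X (discrete_topology UNIV)) (\<lambda>x. (x, c))"
    unfolding open_map_def by (simp add: openin_prod_Times_iff)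
qed (auto simp: inj_on_def intro!: continuous_map_pairedI)

lemma local_homeomorphism_continuous_hom:
  "etale_hom G H \<phi> \<Longrightarrow> continuous_hom G H \<phi>"
  unfolding etale_hom_def continuous_hom_def using local_homeomorphismD by blast

definition corner :: "('a \<times> nat \<times> nat \<Rightarrow> 'b \<times> nat \<times> nat) \<Rightarrow> 'a \<Rightarrow> 'b" where
  "corner \<phi> g = fst (\<phi> (g, 0, 0))"

text \<open>The corner is a composite of three local homeomorphisms: the inclusion of the slice at
  \<open>(0, 0)\<close>, the homeomorphism \<phi>, and the projection that forgets the discrete
  coordinate. Since products are formed coordinatewise, forgetting it preserves
  multiplication.\<close>

lemma corner_etale_hom:
  assumes "homeomorphic_map (gtop (G \<times>\<^sub>G \<R>)) (gtop (H \<times>\<^sub>G \<R>)) \<phi>" "groupoid_hom (G \<times>\<^sub>G \<R>) (H \<times>\<^sub>G \<R>) \<phi>"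
  shows "etale_hom G H (corner \<phi>)"
  unfolding etale_hom_def
proof
  note h = groupoid_homD[OF assms(2)]
  show "groupoid_hom G H (corner \<phi>)"
  proof (rule groupoid_homI)
    fix g assume "g \<in> arrows G"
    then have "(g, 0, 0) \<in> arrows (G \<times>\<^sub>G \<R>)" by simp
    from h(1-3)[OF this] show "corner \<phi> g \<in> arrows H \<and> corner \<phi> (grng G g) = grng H (corner \<phi> g) \<and>
        corner \<phi> (gsrc G g) = gsrc H (corner \<phi> g)"
      unfolding corner_def by (auto simp: mem_Times_iff)
  next
    fix g k assume "g \<in> arrows G" "k \<in> arrows G" "gsrc G g = grng G k"
    then show "corner \<phi> (gmult G g k) = gmult H (corner \<phi> g) (corner \<phi> k)"
      using h(4)[of "(g, 0, 0)" "(k, 0, 0)"] unfolding corner_def by (simp add: case_prod_unfold)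
  qed
  have "local_homeomorphism (prod_topology (gtop G) (discrete_topology UNIV)) (prod_topology
    (gtop H) (discrete_topology UNIV)) \<phi>"
    using homeomorphic_imp_local_homeomorphism[OF assms(1)] by simp
  from local_homeomorphism_compose[OF local_homeomorphism_compose[OF
    local_homeomorphism_slice_discrete this]
      local_homeomorphism_fst_discrete]
  show "local_homeomorphism (gtop G) (gtop H) (corner \<phi>)" unfolding corner_def .
qed

text \<open>The map \<open>corner \<psi>\<close> drops the index at which \<psi> lands, and
  \<open>corner \<phi>\<close> restarts at index 0. If \<psi> sends \<open>(v, 0, 0)\<close> to
  \<open>(u, a, a)\<close>, then \<open>(u, a, 0)\<close> is an arrow that bridges this change of
  index, and the \<open>H\<close>-coordinate of its image under \<phi> is the correction
  \<open>\<theta> v\<close>.\<close>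

lemma corner_similar:
  assumes G: "topological_groupoid G" and H: "topological_groupoid H"
    and hm: "homeomorphic_maps (gtop (G \<times>\<^sub>G \<R>)) (gtop (H \<times>\<^sub>G \<R>)) \<phi> \<psi>"
    and \<phi>: "groupoid_hom (G \<times>\<^sub>G \<R>) (H \<times>\<^sub>G \<R>) \<phi>" and \<psi>: "groupoid_hom (H \<times>\<^sub>G \<R>) (G \<times>\<^sub>G \<R>) \<psi>"
  shows "similar_homs H H (corner \<phi> \<circ> corner \<psi>) id"
proof -
  interpret G: topological_groupoid G by fact
  interpret H: topological_groupoid H by fact
  note h\<phi> = groupoid_homD[OF \<phi>] and h\<psi> = groupoid_homD[OF \<psi>]
  have "homeomorphic_map (gtop (G \<times>\<^sub>G \<R>)) (gtop (H \<times>\<^sub>G \<R>)) \<phi>" "homeomorphic_map (gtop (H \<times>\<^sub>G \<R>))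
    (gtop (G \<times>\<^sub>G \<R>)) \<psi>"
    using hm homeomorphic_maps_map by auto
  then have c: "continuous_hom G H (corner \<phi>)" "continuous_hom H G (corner \<psi>)"
    using corner_etale_hom \<phi> \<psi> local_homeomorphism_continuous_hom by blast+
  let ?D = "discrete_topology (UNIV :: (nat \<times> nat) set)"
  have cont: "continuous_map (prod_topology (gtop G) ?D) (prod_topology (gtop H) ?D) \<phi>"
    "continuous_map (prod_topology (gtop H) ?D) (prod_topology (gtop G) ?D) \<psi>"
    using hm unfolding homeomorphic_maps_def by auto
  have \<phi>\<psi>: "\<phi> (\<psi> t) = t" if "fst t \<in> arrows H" for t
    using hm that unfolding homeomorphic_maps_def by (cases t; auto)+
  define \<theta> where "\<theta> v = fst (\<phi> (fst (\<psi> (v, 0, 0)), fst (snd (\<psi> (v, 0, 0))), 0))" for v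
  have "continuous_map (unit_space H) (gtop H) \<theta>"
  proof -
    have "continuous_map (unit_space H) (prod_topology (gtop H) ?D) (\<lambda>v. (v, 0, 0))"
      unfolding unit_space_def by (intro continuous_map_pairedI continuous_map_from_subtopology) auto
    from continuous_map_o[OF this cont(2)]
    have \<psi>0: "continuous_map (unit_space H) (prod_topology (gtop G) ?D) (\<lambda>v. \<psi> (v, 0, 0))" .
    have "continuous_map ?D ?D (\<lambda>n. (fst n, 0))" by simp
    from continuous_map_o[OF continuous_map_o[OF \<psi>0 continuous_map_snd] this]
    have "continuous_map (unit_space H) ?D (\<lambda>v. (fst (snd (\<psi> (v, 0, 0))), 0))" .
    with continuous_map_o[OF \<psi>0 continuous_map_fst]
    have "continuous_map (unit_space H) (prod_topology (gtop G) ?D)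
        (\<lambda>v. (fst (\<psi> (v, 0, 0)), fst (snd (\<psi> (v, 0, 0))), 0))"
      by (rule continuous_map_pairedI)
    from continuous_map_o[OF continuous_map_o[OF this cont(1)] continuous_map_fst]
    show ?thesis unfolding \<theta>_def .
  qed
  moreover have "gsrc H (\<theta> (grng H h)) = grng H (corner \<phi> (corner \<psi> h)) \<and> gsrc H h = grng H (\<theta>
    (gsrc H h)) \<and>
      gmult H (\<theta> (grng H h)) (corner \<phi> (corner \<psi> h)) = gmult H h (\<theta> (gsrc H h))"
    if h: "h \<in> arrows H" for h
  proof -
    obtain k a b where k: "\<psi> (h, 0, 0) = (k, a, b)" by (metis prod.collapse)
    have hR: "(h, 0, 0) \<in> arrows (H \<times>\<^sub>G \<R>)" using h by simp
    have kG: "k \<in> arrows G" using h\<psi>(1)[OF hR] k by simp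
    have r: "\<psi> (grng H h, 0, 0) = (grng G k, a, a)" "\<psi> (gsrc H h, 0, 0) = (gsrc G k, b, b)"
      using h\<psi>(2,3)[OF hR] k by auto
    have eqs: "\<theta> (grng H h) = fst (\<phi> (grng G k, a, 0))" "\<theta> (gsrc H h) = fst (\<phi> (gsrc G k, b, 0))"
      "corner \<phi> (corner \<psi> h) = fst (\<phi> (k, 0, 0))" "\<phi> (k, a, b) = (h, 0, 0)"
      "\<phi> (gsrc G k, b, b) = (gsrc H h, 0, 0)"
      using \<phi>\<psi>[of "(h, 0, 0)"] \<phi>\<psi>[of "(gsrc H h, 0, 0)"] h k r unfolding \<theta>_def corner_def by auto
    have p: "(grng G k, a, 0) \<in> arrows (G \<times>\<^sub>G \<R>)" "(gsrc G k, b, 0) \<in> arrows (G \<times>\<^sub>G \<R>)"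
      "(k, 0, 0) \<in> arrows (G \<times>\<^sub>G \<R>)" "(k, a, b) \<in> arrows (G \<times>\<^sub>G \<R>)"
      using kG by auto
    have "\<phi> (grng G k, 0, 0) = map_prod (gsrc H) (gsrc \<R>) (\<phi> (grng G k, a, 0))"
      "\<phi> (grng G k, 0, 0) = map_prod (grng H) (grng \<R>) (\<phi> (k, 0, 0))"
      "\<phi> (gsrc G k, b, b) = map_prod (grng H) (grng \<R>) (\<phi> (gsrc G k, b, 0))"
      using h\<phi>(3)[OF p(1)] h\<phi>(2)[OF p(3)] h\<phi>(2)[OF p(2)] kG by auto
    then have 1: "gsrc H (fst (\<phi> (grng G k, a, 0))) = grng H (fst (\<phi> (k, 0, 0)))"
      "gsrc H h = grng H (fst (\<phi> (gsrc G k, b, 0)))"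
      using eqs(5) by (metis fst_map_prod fst_conv)+
    \<comment> \<open>Naturality is the image under \<phi> of two factorisations of the single arrow
      \<open>(k, a, 0)\<close>: through \<open>(k, 0, 0)\<close> on the right and through
      \<open>(k, a, b)\<close> on the left.\<close>
    have "\<phi> (gmult (G \<times>\<^sub>G \<R>) (grng G k, a, 0) (k, 0, 0)) = gmult (H \<times>\<^sub>G \<R>) (\<phi> (grng G k, a, 0)) (\<phi>
      (k, 0, 0))"
      by (rule h\<phi>(4)[OF p(1,3)]) (use kG in simp)
    moreover have "\<phi> (gmult (G \<times>\<^sub>G \<R>) (k, a, b) (gsrc G k, b, 0)) = gmult (H \<times>\<^sub>G \<R>) (\<phi> (k, a, b))
      (\<phi> (gsrc G k, b, 0))"
      by (rule h\<phi>(4)[OF p(4,2)]) (use kG in simp)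
    ultimately have "gmult (H \<times>\<^sub>G \<R>) (\<phi> (grng G k, a, 0)) (\<phi> (k, 0, 0)) =
        gmult (H \<times>\<^sub>G \<R>) (h, 0, 0) (\<phi> (gsrc G k, b, 0))"
      using kG eqs(4) by simp
    then have "gmult H (fst (\<phi> (grng G k, a, 0))) (fst (\<phi> (k, 0, 0))) = gmult H h (fst (\<phi>
      (gsrc G k, b, 0)))"
      by (simp add: case_prod_unfold)
    then show ?thesis using 1 eqs by simp
  qed
  moreover have "continuous_hom H H (corner \<phi> \<circ> corner \<psi>)" "continuous_hom H H id"
    using c groupoid_hom_compose[of H G "corner \<psi>" H "corner \<phi>"] continuous_map_compose
    unfolding continuous_hom_def by (auto simp: comp_def groupoid_hom_def intro: continuous_map_o)
  ultimately show ?thesis unfolding similar_homs_def by (auto intro!: exI[of _ \<theta>])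
qed

lemma stably_isomorphic_imp_similar:
  assumes G: "topological_groupoid G" and H: "topological_groupoid H" and iso: "G \<times>\<^sub>G \<R> \<cong>\<^sub>G H \<times>\<^sub>G \<R>"
  shows "similar G H"
proof -
  interpret GR: topological_groupoid "G \<times>\<^sub>G \<R>"
    by (rule topological_groupoid_prod[OF G topological_groupoid_R])
  obtain \<phi> \<psi> where h: "homeomorphic_maps (gtop (G \<times>\<^sub>G \<R>)) (gtop (H \<times>\<^sub>G \<R>)) \<phi> \<psi>"
    "groupoid_hom (G \<times>\<^sub>G \<R>) (H \<times>\<^sub>G \<R>) \<phi>" "groupoid_hom (H \<times>\<^sub>G \<R>) (G \<times>\<^sub>G \<R>) \<psi>"
    using isomorphic_obtain[OF iso GR.groupoid_axioms] by blast
  have "etale_hom G H (corner \<phi>)" "etale_hom H G (corner \<psi>)"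
    using h corner_etale_hom homeomorphic_maps_map by blast+
  moreover have "similar_homs H H (corner \<phi> \<circ> corner \<psi>) id" by (rule corner_similar[OF G H h])
  moreover have "similar_homs G G (corner \<psi> \<circ> corner \<phi>) id"
    by (rule corner_similar[OF H G]) (use h homeomorphic_maps_sym in blast)+
  ultimately show ?thesis unfolding similar_def by blast
qed

text \<open>A similarity is an equivalence of categories with continuous natural isomorphisms
  \<theta> and \<eta>. So \<rho> is fully faithful, and an arrow \<open>h\<close> from
  \<open>\<rho> y\<close> to \<open>\<rho> x\<close> is lifted by conjugating
  \<open>\<sigma> h\<close> with \<open>\<theta> x\<close> and \<open>\<theta> y\<close>, which is
  continuous. The arrow \<open>\<eta> v\<close> joins \<open>v\<close> to the image
  \<open>\<rho> (\<sigma> v)\<close>, which gives \<open>q_full\<close>.\<close>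

lemma similar_imp_bridge:
  assumes G: "ample_Hausdorff_groupoid G" and H: "ample_Hausdorff_groupoid H" and sim: "similar G H"
  obtains \<rho> f' where "bridge G H (unit_space G) (\<lambda>x. x) \<rho> (\<lambda>x g y. \<rho> g) f'"
proof -
  note aG = ample_unit_space[OF G] and aH = ample_unit_space[OF H]
  interpret G: topological_groupoid G by fact
  interpret H: topological_groupoid H by fact
  obtain \<rho> \<sigma> where \<rho>: "etale_hom G H \<rho>" and \<sigma>: "etale_hom H G \<sigma>"
    and s1: "similar_homs G G (\<sigma> \<circ> \<rho>) id" and s2: "similar_homs H H (\<rho> \<circ> \<sigma>) id"
    using sim unfolding similar_def by blast
  have "groupoid_hom G H \<rho>" "groupoid_hom H G \<sigma>" using \<rho> \<sigma> unfolding etale_hom_def by auto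
  note h\<rho> = groupoid_homD[OF this(1)] and h\<sigma> = groupoid_homD[OF this(2)]
  have l\<rho>: "local_homeomorphism (gtop G) (gtop H) \<rho>" and l\<sigma>: "local_homeomorphism (gtop H) (gtop G) \<sigma>"
    using \<rho> \<sigma> unfolding etale_hom_def by auto
  obtain \<theta> where c\<theta>: "continuous_map (unit_space G) (gtop G) \<theta>" and \<theta>0: "\<forall>g\<in>arrows G.
      gsrc G (\<theta> (grng G g)) = grng G (\<sigma> (\<rho> g)) \<and> gsrc G g = grng G (\<theta> (gsrc G g)) \<and>
      gmult G (\<theta> (grng G g)) (\<sigma> (\<rho> g)) = gmult G g (\<theta> (gsrc G g))"
    using s1 unfolding similar_homs_def by auto
  obtain \<eta> where c\<eta>: "continuous_map (unit_space H) (gtop H) \<eta>" and \<eta>0: "\<forall>g\<in>arrows H.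
      gsrc H (\<eta> (grng H g)) = grng H (\<rho> (\<sigma> g)) \<and> gsrc H g = grng H (\<eta> (gsrc H g)) \<and>
      gmult H (\<eta> (grng H g)) (\<rho> (\<sigma> g)) = gmult H g (\<eta> (gsrc H g))"
    using s2 unfolding similar_homs_def by auto
  have \<rho>u: "\<rho> u \<in> units H" if "u \<in> units G" for u
    using h\<rho>(1-3)[of u] that unfolding units_def by simp
  have \<sigma>u: "\<sigma> u \<in> units G" if "u \<in> units H" for u
    using h\<sigma>(1-3)[of u] that unfolding units_def by simp
  have \<theta>: "\<theta> u \<in> arrows G" "grng G (\<theta> u) = u" "gsrc G (\<theta> u) = \<sigma> (\<rho> u)" if "u \<in> units G" for u
  proof -
    show "\<theta> u \<in> arrows G" using continuous_map_arrow[OF c\<theta>] that by simp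
    show "grng G (\<theta> u) = u" "gsrc G (\<theta> u) = \<sigma> (\<rho> u)"
      using bspec[OF \<theta>0, of u] that \<sigma>u[OF \<rho>u[OF that]] by auto
  qed
  have \<eta>: "\<eta> u \<in> arrows H" "grng H (\<eta> u) = u" "gsrc H (\<eta> u) = \<rho> (\<sigma> u)" if "u \<in> units H" for u
  proof -
    show "\<eta> u \<in> arrows H" using continuous_map_arrow[OF c\<eta>] that by simp
    show "grng H (\<eta> u) = u" "gsrc H (\<eta> u) = \<rho> (\<sigma> u)"
      using bspec[OF \<eta>0, of u] that \<rho>u[OF \<sigma>u[OF that]] by auto
  qed
  have \<theta>_eq: "gmult G (\<theta> (grng G g)) (\<sigma> (\<rho> g)) = gmult G g (\<theta> (gsrc G g))" if "g \<in> arrows G" for g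
    using \<theta>0 that by blast
  have \<eta>_eq: "gmult H (\<eta> (grng H g)) (\<rho> (\<sigma> g)) = gmult H g (\<eta> (gsrc H g))" if "g \<in> arrows H" for g
    using \<eta>0 that by blast
  \<comment> \<open>Naturality of \<eta> recovers an arrow from its endpoints and its image under
    \<sigma>.\<close>
  have \<sigma>_inj: "h = k" if "h \<in> arrows H" "k \<in> arrows H" "grng H h = grng H k" "gsrc H h = gsrc H k"
    "\<sigma> h = \<sigma> k" for h k
  proof -
    have eq: "gmult H h (\<eta> (gsrc H h)) = gmult H k (\<eta> (gsrc H h))"
      using \<eta>_eq[OF that(1)] \<eta>_eq[OF that(2)] that by simp
    show ?thesis
      by (rule H.right_cancel[of "\<eta> (gsrc H h)" h k]) (use eq that(1-4) \<eta>[of "gsrc H h"] in auto)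
  qed
  define f' where "f' x h y = gmult G (gmult G (\<theta> x) (\<sigma> h)) (ginv G (\<theta> y))" for x h y
  have f': "f' x h y \<in> arrows G" "grng G (f' x h y) = x" "gsrc G (f' x h y) = y"
    "gmult G (f' x h y) (\<theta> y) = gmult G (\<theta> x) (\<sigma> h)"
    if "x \<in> units G" "y \<in> units G" "h \<in> arrows H" "grng H h = \<rho> x" "gsrc H h = \<rho> y" for x h y
    using that \<theta>[of x] \<theta>[of y] h\<sigma>(1-3)[of h] unfolding f'_def by auto
  have "bridge G H (unit_space G) (\<lambda>x. x) \<rho> (\<lambda>x g y. \<rho> g) f'"
  proof
    have "local_homeomorphism (unit_space G) (unit_space G) id"
      by (rule homeomorphic_imp_local_homeomorphism) simp
    then show "local_homeomorphism (unit_space G) (unit_space G) (\<lambda>x. x)" by (simp add: id_def)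
    show "local_homeomorphism (unit_space G) (unit_space H) \<rho>"
      unfolding unit_space_def by (rule local_homeomorphism_open_subtopology[OF l\<rho> aG(5)])
        (use \<rho>u in auto)
    show "\<exists>g\<in>arrows G. \<exists>x\<in>topspace (unit_space G). grng G g = u \<and> gsrc G g = x" if "u \<in> units G" for u
      using that by (intro bexI[of _ u] bexI[of _ u]) auto
    show "\<exists>h\<in>arrows H. \<exists>x\<in>topspace (unit_space G). grng H h = v \<and> gsrc H h = \<rho> x" if "v \<in> units H" for v
      using \<eta>[OF that] \<sigma>u[OF that] by (intro bexI[of _ "\<eta> v"] bexI[of _ "\<sigma> v"]) auto
    show "\<rho> g \<in> arrows H \<and> grng H (\<rho> g) = \<rho> x \<and> gsrc H (\<rho> g) = \<rho> y \<and> f' x (\<rho> g) y = g"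
      if "x \<in> topspace (unit_space G)" "y \<in> topspace (unit_space G)" "g \<in> arrows G" "grng G g = x"
        "gsrc G g = y" for x y g
    proof -
      have "f' x (\<rho> g) y = gmult G (gmult G g (\<theta> y)) (ginv G (\<theta> y))"
        using \<theta>_eq[of g] that unfolding f'_def by simp
      also have "\<dots> = g" using that \<theta>[of y] by simp
      finally show ?thesis using h\<rho>(1-3)[of g] that by simp
    qed
    show "f' x h y \<in> arrows G \<and> grng G (f' x h y) = x \<and> gsrc G (f' x h y) = y \<and> \<rho> (f' x h y) = h"
      if "x \<in> topspace (unit_space G)" "y \<in> topspace (unit_space G)" "h \<in> arrows H" "grng H h
        = \<rho> x" "gsrc H h = \<rho> y" for x y h
    proof -
      have xy: "x \<in> units G" "y \<in> units G" using that by auto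
      note f'' = f'[OF xy that(3-5)]
      have \<rho>f: "\<rho> (f' x h y) \<in> arrows H" "grng H (\<rho> (f' x h y)) = \<rho> x" "gsrc H (\<rho> (f' x h y)) = \<rho> y"
        using h\<rho>(1-3)[OF f''(1)] f'' by auto
      \<comment> \<open>Naturality of \<theta> only compares the two arrows after applying \<sigma>;
        faithfulness of \<sigma> then brings the equality back to \<open>H\<close>.\<close>
      have eq: "gmult G (\<theta> x) (\<sigma> (\<rho> (f' x h y))) = gmult G (\<theta> x) (\<sigma> h)"
        using \<theta>_eq[OF f''(1)] f'' by simp
      have "\<sigma> (\<rho> (f' x h y)) = \<sigma> h"
        by (rule G.left_cancel[of "\<theta> x" "\<sigma> (\<rho> (f' x h y))" "\<sigma> h"])
          (use eq \<theta>[OF xy(1)] h\<sigma>(1)[OF \<rho>f(1)] h\<sigma>(1)[OF that(3)] h\<sigma>(2)[OF \<rho>f(1), symmetric]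
            h\<sigma>(2)[OF that(3), symmetric] \<rho>f(2) that(4) in auto)
      then have "\<rho> (f' x h y) = h" using \<sigma>_inj[OF \<rho>f(1) that(3)] \<rho>f that by simp
      then show ?thesis using f'' by simp
    qed
    show "\<rho> (gmult G g g') = gmult H (\<rho> g) (\<rho> g')"
      if "g \<in> arrows G" "g' \<in> arrows G" "gsrc G g = y" "grng G g' = y" for g g' y
      using h\<rho>(4) that by simp
    show "continuous_map (gtop (fibred_groupoid G (unit_space G) (\<lambda>x. x))) (gtop H) (\<lambda>t. \<rho> (fst
      (snd t)))"
      by (rule continuous_map_o[OF continuous_map_fibred_projections(2) local_homeomorphismD(1)[OF l\<rho>]])
    let ?B = "gtop (fibred_groupoid H (unit_space G) \<rho>)"
    note pB = continuous_map_fibred_projections[of H "unit_space G" \<rho>]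
    show "continuous_map ?B (gtop G) (\<lambda>t. f' (fst t) (fst (snd t)) (snd (snd t)))"
      unfolding f'_def
      by (intro G.continuous_mult_comp G.continuous_inv_comp continuous_map_o[OF pB(1) c\<theta>]
          continuous_map_o[OF pB(3) c\<theta>] continuous_map_o[OF pB(2) local_homeomorphismD(1)[OF l\<sigma>]])
        (auto simp: arrows_fibred \<theta> h\<sigma>(1) simp flip: h\<sigma>(2,3))
  qed
  then show ?thesis by (rule that)
qed

section \<open>Constructing bridges\<close>

lemma unit_space_homeomorphic:
  assumes "homeomorphic_maps (gtop G) (gtop H) \<phi> \<psi>" "groupoid_hom G H \<phi>" "groupoid_hom H G \<psi>"
  shows "homeomorphic_maps (unit_space G) (unit_space H) \<phi> \<psi>"
proof -
  have "\<phi> u \<in> units H" if "u \<in> units G" for u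
    using groupoid_homD(1-3)[OF assms(2), of u] that unfolding units_def by simp
  moreover have "\<psi> u \<in> units G" if "u \<in> units H" for u
    using groupoid_homD(1-3)[OF assms(3), of u] that unfolding units_def by simp
  ultimately show ?thesis unfolding unit_space_def
    by (intro homeomorphic_maps_subtopologies_alt[OF assms(1)]) auto
qed

lemma units_reduction: "U \<subseteq> units G \<Longrightarrow> units (reduction G U) = U"
  unfolding units_def by (auto simp: arrows_reduction)

lemma unit_space_reduction:
  assumes "U \<subseteq> units G"
  shows "unit_space (reduction G U) = subtopology (unit_space G) U"
proof -
  have "{g \<in> arrows G. grng G g \<in> U \<and> gsrc G g \<in> U} \<inter> U = units G \<inter> U"
    using assms unfolding units_def by auto
  then show ?thesis unfolding unit_space_def units_reduction[OF assms]
    by (simp add: subtopology_subtopology)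
qed

lemma (in groupoid) groupoid_reduction:
  assumes "U \<subseteq> units G"
  shows "groupoid (reduction G U)"
  by unfold_locales (use assms in \<open>auto simp: arrows_reduction composable_def assoc units_reduction\<close>)

lemma full_inverse:
  assumes "groupoid G" "full G U" "u \<in> units G"
  obtains g where "g \<in> arrows G" "grng G g = u" "gsrc G g \<in> U"
proof -
  interpret groupoid G by fact
  obtain h where "h \<in> arrows G" "gsrc G h = u" "grng G h \<in> U"
    using assms unfolding full_def orbit_def by auto
  then show ?thesis using that[of "ginv G h"] by simp
qed

text \<open>The open set \<open>X\<close> is itself the bridge space, mapped to \<open>G\<close> by
  inclusion and to \<open>H\<close> by \<phi>. Both are local homeomorphisms because
  \<open>X\<close> and \<open>Y\<close> are open, and fullness of these sets is the orbit condition
  of a bridge.\<close>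

lemma weakly_Kakutani_imp_bridge:
  fixes G :: "'a grpd"
  assumes G: "ample_Hausdorff_groupoid G" and H: "ample_Hausdorff_groupoid H"
    and w: "weakly_Kakutani_equivalent G H"
  obtains X :: "'a topology" and p q f f' where "bridge G H X p q f f'"
proof -
  note aG = ample_unit_space[OF G] and aH = ample_unit_space[OF H]
  interpret G: topological_groupoid G by fact
  interpret H: topological_groupoid H by fact
  obtain X Y where X: "openin (unit_space G) X" "full G X" and Y: "openin (unit_space H) Y" "full H Y"
    and iso: "reduction G X \<cong>\<^sub>G reduction H Y"
    using w unfolding weakly_Kakutani_equivalent_def by blast
  have XG: "X \<subseteq> units G" and YH: "Y \<subseteq> units H" using X(2) Y(2) unfolding full_def by auto
  obtain \<phi> \<psi> where hm: "homeomorphic_maps (gtop (reduction G X)) (gtop (reduction H Y)) \<phi> \<psi>"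
    and hom: "groupoid_hom (reduction G X) (reduction H Y) \<phi>" "groupoid_hom (reduction H Y)
      (reduction G X) \<psi>"
    by (rule isomorphic_obtain[OF iso G.groupoid_reduction[OF XG]])
  have hu: "homeomorphic_maps (subtopology (unit_space G) X) (subtopology (unit_space H) Y) \<phi> \<psi>"
    using unit_space_homeomorphic[OF hm hom] XG YH by (simp add: unit_space_reduction)
  then have lh: "local_homeomorphism (subtopology (unit_space G) X) (subtopology (unit_space H) Y) \<phi>"
    using homeomorphic_imp_local_homeomorphism homeomorphic_maps_map by blast
  have \<phi>X: "\<phi> x \<in> Y" if "x \<in> X" for x
    using local_homeomorphism_funcset[OF lh, of x] that XG YH by auto
  have \<psi>Y: "\<psi> y \<in> X \<and> \<phi> (\<psi> y) = y" if "y \<in> Y" for y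
    using hu that XG YH unfolding homeomorphic_maps_def
      by (auto simp: continuous_map_in_subtopology Pi_iff)
  have inv: "\<psi> (\<phi> g) = g" if "g \<in> arrows (reduction G X)" for g
    using hm that unfolding homeomorphic_maps_def topspace_gtop by blast
  have inv': "\<phi> (\<psi> h) = h" if "h \<in> arrows (reduction H Y)" for h
    using hm that unfolding homeomorphic_maps_def topspace_gtop by blast
  note h\<phi> = groupoid_homD[OF hom(1)] and h\<psi> = groupoid_homD[OF hom(2)]
  let ?X = "subtopology (unit_space G) X"
  have tX: "topspace ?X = X" using XG by auto
  have red: "g \<in> arrows (reduction G X) \<longleftrightarrow> g \<in> arrows G \<and> grng G g \<in> X \<and> gsrc G g \<in> X" for g
    by (simp add: arrows_reduction)
  have redH: "g \<in> arrows (reduction H Y) \<longleftrightarrow> g \<in> arrows H \<and> grng H g \<in> Y \<and> gsrc H g \<in> Y" for g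
    by (simp add: arrows_reduction)
  have "bridge G H ?X (\<lambda>x. x) \<phi> (\<lambda>x g y. \<phi> g) (\<lambda>x h y. \<psi> h)"
  proof
    show "local_homeomorphism ?X (unit_space G) (\<lambda>x. x)"
      by (rule local_homeomorphism_open_inclusion[OF X(1)])
    show "local_homeomorphism ?X (unit_space H) \<phi>"
      using local_homeomorphism_compose[OF lh local_homeomorphism_open_inclusion[OF Y(1)]] .
    show "\<exists>g\<in>arrows G. \<exists>x\<in>topspace ?X. grng G g = u \<and> gsrc G g = x" if "u \<in> units G" for u
      unfolding tX using full_inverse[OF aG(7) X(2) that] by metis
    show "\<exists>h\<in>arrows H. \<exists>x\<in>topspace ?X. grng H h = v \<and> gsrc H h = \<phi> x" if "v \<in> units H" for v
      unfolding tX using full_inverse[OF aH(7) Y(2) that] \<psi>Y by metis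
    show "\<phi> g \<in> arrows H \<and> grng H (\<phi> g) = \<phi> x \<and> gsrc H (\<phi> g) = \<phi> y \<and> \<psi> (\<phi> g) = g"
      if "x \<in> topspace ?X" "y \<in> topspace ?X" "g \<in> arrows G" "grng G g = x" "gsrc G g = y" for x y g
    proof -
      have g: "g \<in> arrows (reduction G X)" using that tX red by simp
      then show ?thesis using h\<phi>(1-3)[OF g] inv[OF g] that redH by simp
    qed
    show "\<psi> h \<in> arrows G \<and> grng G (\<psi> h) = x \<and> gsrc G (\<psi> h) = y \<and> \<phi> (\<psi> h) = h"
      if "x \<in> topspace ?X" "y \<in> topspace ?X" "h \<in> arrows H" "grng H h = \<phi> x" "gsrc H h = \<phi> y" for x y h
    proof -
      have xy: "x \<in> X" "y \<in> X" using that tX by auto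
      have h: "h \<in> arrows (reduction H Y)" using that xy \<phi>X redH by simp
      have "\<psi> (\<phi> x) = x" "\<psi> (\<phi> y) = y" using xy XG by (auto intro!: inv simp: red)
      then show ?thesis using h\<psi>(1-3)[OF h] inv'[OF h] that red by simp
    qed
    show "\<phi> (gmult G g g') = gmult H (\<phi> g) (\<phi> g')"
      if "x \<in> topspace ?X" "y \<in> topspace ?X" "z \<in> topspace ?X" "g \<in> arrows G" "g' \<in> arrows G"
        "grng G g = x" "gsrc G g = y" "grng G g' = y" "gsrc G g' = z" for x y z g g'
      using h\<phi>(4)[of g g'] that tX red by simp
    have c: "continuous_map (gtop (reduction G X)) (gtop H) \<phi>" "continuous_map (gtop
      (reduction H Y)) (gtop G) \<psi>"
      using hm unfolding homeomorphic_maps_def by (auto simp: continuous_map_in_subtopology)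
    let ?A = "gtop (fibred_groupoid G ?X (\<lambda>x. x))" and ?B = "gtop (fibred_groupoid H ?X \<phi>)"
    have "continuous_map ?A (gtop (reduction G X)) (\<lambda>t. fst (snd t))"
      using continuous_map_fibred_projections(2)[of G ?X "\<lambda>x. x"]
      by (auto simp: continuous_map_in_subtopology arrows_fibred tX)
    from continuous_map_o[OF this c(1)] show "continuous_map ?A (gtop H) (\<lambda>t. \<phi> (fst (snd t)))" .
    have "continuous_map ?B (gtop (reduction H Y)) (\<lambda>t. fst (snd t))"
      using continuous_map_fibred_projections(2)[of H ?X \<phi>]
      by (auto simp: continuous_map_in_subtopology arrows_fibred tX) (metis \<phi>X)+
    from continuous_map_o[OF this c(2)] show "continuous_map ?B (gtop G) (\<lambda>t. \<psi> (fst (snd t)))" .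
  qed
  then show ?thesis by (rule that)
qed

section \<open>Bridges from ampliations and from weak equivalences\<close>

lemma groupoid_fibred:
  assumes "groupoid G" "\<And>x. x \<in> topspace X \<Longrightarrow> p x \<in> units G"
  shows "groupoid (fibred_groupoid G X p)"
proof -
  interpret groupoid G by fact
  show ?thesis
    by unfold_locales
      (auto simp: arrows_fibred composable_def assoc assms(2) units_def[of "fibred_groupoid G X p"])
qed

text \<open>The given isomorphism lies over no common space. On units it restricts to a
  homeomorphism \<open>a\<close> from \<open>X\<close> to \<open>Y\<close>; replacing
  \<open>Y\<close> by \<open>X\<close> along \<open>a\<close>, and \<eta> by its composite with
  \<open>a\<close>, makes it an isomorphism over the identity of \<open>X\<close>.\<close>

lemma isomorphic_ampliations_imp_bridge:
  assumes G: "ample_Hausdorff_groupoid G" and H: "ample_Hausdorff_groupoid H"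
    and a: "isomorphic_ampliations TYPE('u) G H"
  obtains X :: "'u topology" and p q f f' where "bridge G H X p q f f'"
proof -
  note aG = ample_unit_space[OF G] and aH = ample_unit_space[OF H]
  interpret G: topological_groupoid G by fact
  interpret H: topological_groupoid H by fact
  obtain X :: "'u topology" and p and Y :: "'u topology" and \<eta>
    where p: "local_homeomorphism X (unit_space G) p" "p ` topspace X = units G"
      and \<eta>: "local_homeomorphism Y (unit_space H) \<eta>" "\<eta> ` topspace Y = units H"
      and iso: "fibred_groupoid G X p \<cong>\<^sub>G fibred_groupoid H Y \<eta>"
    using a unfolding isomorphic_ampliations_def ampliation_map_def by blast
  let ?GX = "fibred_groupoid G X p" and ?HY = "fibred_groupoid H Y \<eta>"
  have pu: "p x \<in> units G" if "x \<in> topspace X" for x using p(2) that by auto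
  have \<eta>u: "\<eta> y \<in> units H" if "y \<in> topspace Y" for y using \<eta>(2) that by auto
  have "groupoid ?GX" by (rule groupoid_fibred[OF G.groupoid_axioms pu])
  then obtain \<Phi> \<Psi> where hm: "homeomorphic_maps (gtop ?GX) (gtop ?HY) \<Phi> \<Psi>"
    and hom: "groupoid_hom ?GX ?HY \<Phi>" "groupoid_hom ?HY ?GX \<Psi>"
    using isomorphic_obtain[OF iso] by blast
  note h\<Phi> = groupoid_homD[OF hom(1)] and h\<Psi> = groupoid_homD[OF hom(2)]
  define a where "a x = fst (\<Phi> (x, p x, x))" for x
  define b where "b y = fst (\<Psi> (y, \<eta> y, y))" for y
  define f where "f x g y = fst (snd (\<Phi> (x, g, y)))" for x g y
  define f' where "f' x h y = fst (snd (\<Psi> (x, h, y)))" for x h y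
  have uX: "(x, p x, x) \<in> arrows ?GX" if "x \<in> topspace X" for x
    using that pu[OF that] by (simp add: arrows_fibred)
  have uY: "(y, \<eta> y, y) \<in> arrows ?HY" if "y \<in> topspace Y" for y
    using that \<eta>u[OF that] by (simp add: arrows_fibred)
  \<comment> \<open>Compatibility with range and source forces the outer coordinates of the image to
    depend on \<open>x\<close> alone and on \<open>y\<close> alone, through the same map
    \<open>a\<close>.\<close>
  have \<Phi>: "\<Phi> (x, g, y) = (a x, f x g y, a y)" if "(x, g, y) \<in> arrows ?GX" for x g y
    using h\<Phi>(2,3)[OF that] that unfolding a_def f_def
    by (cases "\<Phi> (x, g, y)") (auto simp: arrows_fibred)
  have \<Psi>: "\<Psi> (x, h, y) = (b x, f' x h y, b y)" if "(x, h, y) \<in> arrows ?HY" for x h y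
    using h\<Psi>(2,3)[OF that] that unfolding b_def f'_def
    by (cases "\<Psi> (x, h, y)") (auto simp: arrows_fibred)
  have \<Psi>\<Phi>: "\<Psi> (\<Phi> t) = t" if "t \<in> arrows ?GX" for t
    using hm that unfolding homeomorphic_maps_def topspace_gtop by blast
  have \<Phi>\<Psi>: "\<Phi> (\<Psi> t) = t" if "t \<in> arrows ?HY" for t
    using hm that unfolding homeomorphic_maps_def topspace_gtop by blast
  have a: "a x \<in> topspace Y" "\<Phi> (x, p x, x) = (a x, \<eta> (a x), a x)" "b (a x) = x"
    if "x \<in> topspace X" for x
  proof -
    note eq = \<Phi>[OF uX[OF that]]
    show aY: "a x \<in> topspace Y" using h\<Phi>(1)[OF uX[OF that]] unfolding eq by (simp add: arrows_fibred)
    have "f x (p x) x = grng H (f x (p x) x)"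
      using h\<Phi>(2)[OF uX[OF that]] pu[OF that] eq by simp
    then show \<Phi>u: "\<Phi> (x, p x, x) = (a x, \<eta> (a x), a x)"
      using h\<Phi>(1,2)[OF uX[OF that]] that pu[OF that] unfolding eq by (simp add: arrows_fibred)
    show "b (a x) = x" using \<Psi>\<Phi>[OF uX[OF that]] \<Psi>[OF uY[OF aY]] unfolding \<Phi>u by simp
  qed
  have b: "b y \<in> topspace X" "\<Psi> (y, \<eta> y, y) = (b y, p (b y), b y)" "a (b y) = y"
    if "y \<in> topspace Y" for y
  proof -
    note eq = \<Psi>[OF uY[OF that]]
    show bX: "b y \<in> topspace X" using h\<Psi>(1)[OF uY[OF that]] unfolding eq by (simp add: arrows_fibred)
    have "f' y (\<eta> y) y = grng G (f' y (\<eta> y) y)"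
      using h\<Psi>(2)[OF uY[OF that]] \<eta>u[OF that] eq by simp
    then show \<Psi>u: "\<Psi> (y, \<eta> y, y) = (b y, p (b y), b y)"
      using h\<Psi>(1,2)[OF uY[OF that]] that \<eta>u[OF that] unfolding eq by (simp add: arrows_fibred)
    show "a (b y) = y" using \<Phi>\<Psi>[OF uY[OF that]] \<Phi>[OF uX[OF bX]] unfolding \<Psi>u by simp
  qed
  have c\<Phi>: "continuous_map (gtop ?GX) (gtop ?HY) \<Phi>" and c\<Psi>: "continuous_map (gtop ?HY) (gtop ?GX) \<Psi>"
    using hm unfolding homeomorphic_maps_def by auto
  have ca: "continuous_map X Y a"
  proof -
    have "continuous_map X (gtop ?GX) (\<lambda>x. (x, p x, x))"
      using local_homeomorphismD(1)[OF p(1)] pu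
      by (auto simp: continuous_map_into_fibred continuous_map_into_unit_space)
    from continuous_map_o[OF continuous_map_o[OF this c\<Phi>] continuous_map_fibred_projections(1)]
    show ?thesis unfolding a_def .
  qed
  have cb: "continuous_map Y X b"
  proof -
    have "continuous_map Y (gtop ?HY) (\<lambda>x. (x, \<eta> x, x))"
      using local_homeomorphismD(1)[OF \<eta>(1)] \<eta>u
      by (auto simp: continuous_map_into_fibred continuous_map_into_unit_space)
    from continuous_map_o[OF continuous_map_o[OF this c\<Psi>] continuous_map_fibred_projections(1)]
    show ?thesis unfolding b_def .
  qed
  have ab: "homeomorphic_maps X Y a b" unfolding homeomorphic_maps_def using ca cb a(3) b(3) by blast
  define q where "q x = \<eta> (a x)" for x
  define f'' where "f'' x h y = f' (a x) h (a y)" for x h y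
  have f: "f x g y \<in> arrows H \<and> grng H (f x g y) = q x \<and> gsrc H (f x g y) = q y \<and> f'' x (f x g y) y = g"
    if "x \<in> topspace X" "y \<in> topspace X" "g \<in> arrows G" "grng G g = p x" "gsrc G g = p y" for x y g
  proof -
    have t: "(x, g, y) \<in> arrows ?GX" using that by (simp add: arrows_fibred)
    have s: "(a x, f x g y, a y) \<in> arrows ?HY" using h\<Phi>(1)[OF t] unfolding \<Phi>[OF t] .
    then show ?thesis
      using \<Psi>\<Phi>[OF t] unfolding \<Phi>[OF t] \<Psi>[OF s] q_def f''_def by (simp add: arrows_fibred)
  qed
  have f': "f'' x h y \<in> arrows G \<and> grng G (f'' x h y) = p x \<and> gsrc G (f'' x h y) = p y \<and> f x
    (f'' x h y) y = h"
    if "x \<in> topspace X" "y \<in> topspace X" "h \<in> arrows H" "grng H h = q x" "gsrc H h = q y" for x y h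
  proof -
    have t: "(a x, h, a y) \<in> arrows ?HY" using that a(1) unfolding q_def by (simp add: arrows_fibred)
    have s: "(x, f'' x h y, y) \<in> arrows ?GX"
      using h\<Psi>(1)[OF t] that unfolding \<Psi>[OF t] f''_def by (simp add: a(3))
    then show ?thesis
      using \<Phi>\<Psi>[OF t] that \<Phi>[OF s] unfolding \<Psi>[OF t] f''_def by (simp add: arrows_fibred a(3))
  qed
  have "bridge G H X p q f f''"
  proof
    show "local_homeomorphism X (unit_space G) p" by fact
    show "local_homeomorphism X (unit_space H) q"
      unfolding q_def
      by (rule local_homeomorphism_compose[OF homeomorphic_imp_local_homeomorphism \<eta>(1)])
        (use ab homeomorphic_maps_map in blast)
    show "\<exists>g\<in>arrows G. \<exists>x\<in>topspace X. grng G g = u \<and> gsrc G g = p x" if u: "u \<in> units G" for u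
    proof -
      obtain x where "x \<in> topspace X" "p x = u" using p(2) u by (metis imageE)
      then show ?thesis using u by (intro bexI[of _ u] bexI[of _ x]) auto
    qed
    show "\<exists>h\<in>arrows H. \<exists>x\<in>topspace X. grng H h = v \<and> gsrc H h = q x" if v: "v \<in> units H" for v
    proof -
      obtain y where "y \<in> topspace Y" "\<eta> y = v" using \<eta>(2) v by (metis imageE)
      then show ?thesis using v b unfolding q_def by (intro bexI[of _ v] bexI[of _ "b y"]) auto
    qed
    show "f x (gmult G g g') z = gmult H (f x g y) (f y g' z)"
      if "x \<in> topspace X" "y \<in> topspace X" "z \<in> topspace X" "g \<in> arrows G" "g' \<in> arrows G"
        "grng G g = p x" "gsrc G g = p y" "grng G g' = p y" "gsrc G g' = p z" for x y z g g'
    proof -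
      have t: "(x, g, y) \<in> arrows ?GX" "(y, g', z) \<in> arrows ?GX" "(x, gmult G g g', z) \<in> arrows ?GX"
        using that by (auto simp: arrows_fibred)
      have "gsrc ?GX (x, g, y) = grng ?GX (y, g', z)" using that by simp
      from h\<Phi>(4)[OF t(1,2) this] show ?thesis using \<Phi>[OF t(1)] \<Phi>[OF t(2)] \<Phi>[OF t(3)] by simp
    qed
    show "continuous_map (gtop ?GX) (gtop H) (\<lambda>t. f (fst t) (fst (snd t)) (snd (snd t)))"
      using continuous_map_o[OF c\<Phi> continuous_map_fibred_projections(2)] unfolding f_def by simp
    let ?B = "gtop (fibred_groupoid H X q)"
    note pB = continuous_map_fibred_projections[of H X q]
    have "continuous_map ?B (gtop ?HY) (\<lambda>t. (a (fst t), fst (snd t), a (snd (snd t))))"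
      using continuous_map_o[OF pB(1) ca] continuous_map_o[OF pB(3) ca] pB(2)
      by (auto simp: continuous_map_into_fibred arrows_fibred q_def)
    from continuous_map_o[OF continuous_map_o[OF this c\<Psi>] continuous_map_fibred_projections(2)]
    show "continuous_map ?B (gtop G) (\<lambda>t. f'' (fst t) (fst (snd t)) (snd (snd t)))"
      unfolding f''_def f'_def .
  qed (use f f' in auto)
  then show ?thesis by (rule that)
qed

text \<open>The definition makes a map on pairs \<open>(u, \<gamma>)\<close> a local homeomorphism,
  not \<phi> itself. On units \<phi> is recovered by restricting that map to the section of pairs
  \<open>(u, \<phi> u)\<close>, which is open because the units of \<open>G\<close> are
  open.\<close>

lemma weak_equivalenceD:
  assumes G: "ample_Hausdorff_groupoid G" and we: "weak_equivalence K G \<phi>"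
  shows "local_homeomorphism (unit_space K) (unit_space G) \<phi>"
    and "u \<in> units G \<Longrightarrow> \<exists>g \<in> arrows G. \<exists>x \<in> units K. grng G g = u \<and> gsrc G g = \<phi> x"
proof -
  note aG = ample_unit_space[OF G]
  interpret G: topological_groupoid G by fact
  let ?P = "subtopology (prod_topology (unit_space K) (gtop G)) {(u, \<gamma>). \<phi> u = grng G \<gamma>}"
  have hom: "groupoid_hom K G \<phi>" and c: "continuous_map (gtop K) (gtop G) \<phi>"
    and lh: "local_homeomorphism ?P (unit_space G) (\<lambda>(u, \<gamma>). gsrc G \<gamma>)"
    and surj: "(\<lambda>(u, \<gamma>). gsrc G \<gamma>) ` topspace ?P = units G"
    using we unfolding weak_equivalence_def continuous_hom_def by (auto simp: Let_def)
  note h = groupoid_homD[OF hom]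
  have \<phi>u: "\<phi> u \<in> units G" if "u \<in> units K" for u
    using h(1-3)[of u] that unfolding units_def by simp
  have "local_homeomorphism (unit_space K) ?P (\<lambda>u. (u, \<phi> u))"
    unfolding local_homeomorphism_iff
  proof (intro conjI ballI)
    show "continuous_map (unit_space K) ?P (\<lambda>u. (u, \<phi> u))"
    proof -
      have "continuous_map (unit_space K) (gtop G) \<phi>"
        using c unfolding unit_space_def by (rule continuous_map_from_subtopology)
      then have "continuous_map (unit_space K) (prod_topology (unit_space K) (gtop G)) (\<lambda>u. (u, \<phi> u))"
        by (intro continuous_map_pairedI) auto
      then show ?thesis using \<phi>u by (auto simp: continuous_map_in_subtopology)
    qed
    show "open_map (unit_space K) ?P (\<lambda>u. (u, \<phi> u))"
      unfolding open_map_def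
    proof (intro allI impI)
      fix U assume U: "openin (unit_space K) U"
      then have "U \<subseteq> units K" using openin_subset by force
      \<comment> \<open>A unit \<gamma> whose range is \<open>\<phi> u\<close> is
        \<open>\<phi> u\<close>, so the image of the section is cut out by an open
        condition.\<close>
      then have "(\<lambda>u. (u, \<phi> u)) ` U = {(u, \<gamma>). \<phi> u = grng G \<gamma>} \<inter> (U \<times> units G)"
        using \<phi>u by auto
      moreover have "openin (prod_topology (unit_space K) (gtop G)) (U \<times> units G)"
        using U aG(5) by (simp add: openin_prod_Times_iff)
      ultimately show "openin ?P ((\<lambda>u. (u, \<phi> u)) ` U)" by (simp add: openin_subtopology_Int2)
    qed
  qed (auto simp: inj_on_def)
  from local_homeomorphism_compose[OF this lh]
  show "local_homeomorphism (unit_space K) (unit_space G) \<phi>"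
    by (rule local_homeomorphism_eq) (use \<phi>u in auto)
  show "\<exists>g \<in> arrows G. \<exists>x \<in> units K. grng G g = u \<and> gsrc G g = \<phi> x" if u: "u \<in> units G"
  proof -
    have "u \<in> (\<lambda>(u, \<gamma>). gsrc G \<gamma>) ` topspace ?P" using surj u by simp
    then obtain x \<gamma> where "x \<in> units K" "\<gamma> \<in> arrows G" "\<phi> x = grng G \<gamma>" "gsrc G \<gamma> = u" by auto
    then show ?thesis by (intro bexI[of _ "ginv G \<gamma>"] bexI[of _ x]) auto
  qed
qed

text \<open>The bridge space is the unit space of \<open>K\<close>. An arrow of \<open>G\<close>
  with prescribed endpoints there lifts uniquely to \<open>K\<close>, by the fibred product
  condition for \<phi>, and is pushed to \<open>H\<close> by \<psi>; the inverse lifts along \<psi>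
  and pushes by \<phi>.\<close>

lemma Morita_imp_bridge:
  assumes G: "ample_Hausdorff_groupoid G" and H: "ample_Hausdorff_groupoid H"
    and m: "Morita_equivalent TYPE('u) G H"
  obtains X :: "'u topology" and p q f f' where "bridge G H X p q f f'"
proof -
  note aG = ample_unit_space[OF G] and aH = ample_unit_space[OF H]
  interpret G: topological_groupoid G by fact
  interpret H: topological_groupoid H by fact
  obtain K :: "'u grpd" and \<phi> \<psi> where K: "Hausdorff_etale_groupoid K"
    and w: "weak_equivalence K G \<phi>" "weak_equivalence K H \<psi>"
    using m unfolding Morita_equivalent_def by blast
  interpret K: Hausdorff_etale_groupoid K by fact
  obtain d where d: "homeomorphic_maps (gtop K) (gtop (fibred_groupoid G (unit_space K) \<phi>))
      (\<lambda>g. (grng K g, \<phi> g, gsrc K g)) d" and hom\<phi>: "groupoid_hom K G \<phi>" and c\<phi>: "continuous_map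
        (gtop K) (gtop G) \<phi>"
    using w(1) unfolding weak_equivalence_def groupoid_iso_def continuous_hom_def
    by (auto simp: homeomorphic_map_maps)
  obtain e where e: "homeomorphic_maps (gtop K) (gtop (fibred_groupoid H (unit_space K) \<psi>))
      (\<lambda>g. (grng K g, \<psi> g, gsrc K g)) e" and hom\<psi>: "groupoid_hom K H \<psi>" and c\<psi>: "continuous_map
        (gtop K) (gtop H) \<psi>"
    using w(2) unfolding weak_equivalence_def groupoid_iso_def continuous_hom_def
    by (auto simp: homeomorphic_map_maps)
  note h\<phi> = groupoid_homD[OF hom\<phi>] and h\<psi> = groupoid_homD[OF hom\<psi>]
  have d1: "d (grng K k, \<phi> k, gsrc K k) = k" and e1: "e (grng K k, \<psi> k, gsrc K k) = k"
    if "k \<in> arrows K" for k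
    using d e that unfolding homeomorphic_maps_def by auto
  have d2: "d (x, g, y) \<in> arrows K" "grng K (d (x, g, y)) = x" "gsrc K (d (x, g, y)) = y" "\<phi> (d
    (x, g, y)) = g"
    if "x \<in> units K" "y \<in> units K" "g \<in> arrows G" "grng G g = \<phi> x" "gsrc G g = \<phi> y" for x g y
  proof -
    have t: "(x, g, y) \<in> arrows (fibred_groupoid G (unit_space K) \<phi>)" using that
      by (simp add: arrows_fibred)
    then show "d (x, g, y) \<in> arrows K" using d unfolding homeomorphic_maps_def
      by (auto intro: continuous_map_arrow)
    have "\<forall>t\<in>arrows (fibred_groupoid G (unit_space K) \<phi>). (grng K (d t), \<phi> (d t), gsrc K (d t)) = t"
      using d unfolding homeomorphic_maps_def topspace_gtop by blast
    from bspec[OF this t] show "grng K (d (x, g, y)) = x" "gsrc K (d (x, g, y)) = y" "\<phi> (d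
      (x, g, y)) = g" by auto
  qed
  have e2: "e (x, g, y) \<in> arrows K" "grng K (e (x, g, y)) = x" "gsrc K (e (x, g, y)) = y" "\<psi> (e
    (x, g, y)) = g"
    if "x \<in> units K" "y \<in> units K" "g \<in> arrows H" "grng H g = \<psi> x" "gsrc H g = \<psi> y" for x g y
  proof -
    have t: "(x, g, y) \<in> arrows (fibred_groupoid H (unit_space K) \<psi>)" using that
      by (simp add: arrows_fibred)
    then show "e (x, g, y) \<in> arrows K" using e unfolding homeomorphic_maps_def
      by (auto intro: continuous_map_arrow)
    have "\<forall>t\<in>arrows (fibred_groupoid H (unit_space K) \<psi>). (grng K (e t), \<psi> (e t), gsrc K (e t)) = t"
      using e unfolding homeomorphic_maps_def topspace_gtop by blast
    from bspec[OF this t] show "grng K (e (x, g, y)) = x" "gsrc K (e (x, g, y)) = y" "\<psi> (e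
      (x, g, y)) = g" by auto
  qed
  have "bridge G H (unit_space K) \<phi> \<psi> (\<lambda>x g y. \<psi> (d (x, g, y))) (\<lambda>x h y. \<phi> (e (x, h, y)))"
  proof
    show "\<exists>g\<in>arrows G. \<exists>x\<in>topspace (unit_space K). grng G g = u \<and> gsrc G g = \<phi> x" if "u \<in> units G" for u
      using weak_equivalenceD(2)[OF G w(1) that] by simp
    show "\<exists>g\<in>arrows H. \<exists>x\<in>topspace (unit_space K). grng H g = u \<and> gsrc H g = \<psi> x" if "u \<in> units H" for u
      using weak_equivalenceD(2)[OF H w(2) that] by simp
    show "\<psi> (d (x, g, y)) \<in> arrows H \<and> grng H (\<psi> (d (x, g, y))) = \<psi> x \<and> gsrc H (\<psi> (d (x, g, y))) = \<psi> y \<and>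
        \<phi> (e (x, \<psi> (d (x, g, y)), y)) = g"
      if "x \<in> topspace (unit_space K)" "y \<in> topspace (unit_space K)" "g \<in> arrows G"
        "grng G g = \<phi> x" "gsrc G g = \<phi> y" for x y g
      using d2[of x y g] that e1[of "d (x, g, y)"] h\<psi>(1)[of "d (x, g, y)"] h\<psi>(2,3)[of "d
        (x, g, y)", symmetric]
      by simp
    show "\<phi> (e (x, h, y)) \<in> arrows G \<and> grng G (\<phi> (e (x, h, y))) = \<phi> x \<and> gsrc G (\<phi> (e (x, h, y))) = \<phi> y \<and>
        \<psi> (d (x, \<phi> (e (x, h, y)), y)) = h"
      if "x \<in> topspace (unit_space K)" "y \<in> topspace (unit_space K)" "h \<in> arrows H"
        "grng H h = \<psi> x" "gsrc H h = \<psi> y" for x y h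
      using e2[of x y h] that d1[of "e (x, h, y)"] h\<phi>(1)[of "e (x, h, y)"] h\<phi>(2,3)[of "e
        (x, h, y)", symmetric]
      by simp
    show "\<psi> (d (x, gmult G g g', z)) = gmult H (\<psi> (d (x, g, y))) (\<psi> (d (y, g', z)))"
      if "x \<in> topspace (unit_space K)" "y \<in> topspace (unit_space K)" "z \<in> topspace (unit_space K)"
        "g \<in> arrows G" "g' \<in> arrows G" "grng G g = \<phi> x" "gsrc G g = \<phi> y" "grng G g' = \<phi> y"
          "gsrc G g' = \<phi> z"
      for x y z g g'
    proof -
      let ?k = "gmult K (d (x, g, y)) (d (y, g', z))"
      have xyz: "x \<in> units K" "y \<in> units K" "z \<in> units K" using that by auto
      note k1 = d2[OF xyz(1,2) that(4,6,7)] and k2 = d2[OF xyz(2,3) that(5,8,9)]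
      have k: "?k \<in> arrows K" "grng K ?k = x" "gsrc K ?k = z" "\<phi> ?k = gmult G g g'"
        using k1 k2 h\<phi>(4)[of "d (x, g, y)" "d (y, g', z)"] by auto
      \<comment> \<open>The lift of a product is the product of the lifts, since \<open>d\<close>
        recovers an arrow of \<open>K\<close> from its endpoints and its image.\<close>
      then have "d (x, gmult G g g', z) = ?k" using d1[OF k(1)] by simp
      then show ?thesis using h\<psi>(4)[of "d (x, g, y)" "d (y, g', z)"] k1 k2 by simp
    qed
    show "continuous_map (gtop (fibred_groupoid G (unit_space K) \<phi>)) (gtop H) (\<lambda>t. \<psi> (d
      (fst t, fst (snd t), snd (snd t))))"
      using d c\<psi> unfolding homeomorphic_maps_def by (auto intro: continuous_map_o)
    show "continuous_map (gtop (fibred_groupoid H (unit_space K) \<psi>)) (gtop G) (\<lambda>t. \<phi> (e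
      (fst t, fst (snd t), snd (snd t))))"
      using e c\<phi> unfolding homeomorphic_maps_def by (auto intro: continuous_map_o)
  qed (use weak_equivalenceD(1) G H w in auto)
  then show ?thesis by (rule that)
qed

section \<open>Free and proper actions: division maps and bridges\<close>

text \<open>For \<open>A\<close> an action groupoid and \<open>A\<^sub>0\<close> the open set of
  pairs whose arrow is a unit, the map \<open>E\<close> sends \<open>A\<^sub>0\<close> onto the
  diagonal. As \<open>E\<close> is open, the diagonal is open in the fibre product of
  \<open>Z\<close> with itself along \<open>r\<close>; a square inside it around
  \<open>(z, z)\<close> shows that \<open>r\<close> is injective near \<open>z\<close>.\<close>

lemma locally_injective_by_division:
  assumes E: "homeomorphic_maps A (subtopology (prod_topology Z Z) {(z, z'). r z = r z'}) E D"
    and A0: "openin A A\<^sub>0" "\<And>a. a \<in> A\<^sub>0 \<Longrightarrow> fst (E a) = snd (E a)"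
    and diag: "\<And>z. z \<in> topspace Z \<Longrightarrow> (z, z) \<in> E ` A\<^sub>0"
    and z: "z \<in> topspace Z"
  shows "\<exists>U. openin Z U \<and> z \<in> U \<and> inj_on r U"
proof -
  let ?I = "subtopology (prod_topology Z Z) {(z, z'). r z = r z'}"
  have "open_map A ?I E" by (rule homeomorphic_imp_open_map[OF homeomorphic_maps_imp_map[OF E]])
  then have "openin ?I (E ` A\<^sub>0)" using A0(1) unfolding open_map_def by blast
  then obtain T where T: "openin (prod_topology Z Z) T" "E ` A\<^sub>0 = T \<inter> {(z, z'). r z = r z'}"
    by (auto simp: openin_subtopology)
  then have "(z, z) \<in> T" using diag[OF z] by blast
  then obtain U V where UV: "openin Z U" "openin Z V" "z \<in> U" "z \<in> V" "U \<times> V \<subseteq> T"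
    using T(1) openin_prod_topology_alt[of Z Z T] by metis
  have "inj_on r (U \<inter> V)"
  proof (rule inj_onI)
    fix x y assume "x \<in> U \<inter> V" "y \<in> U \<inter> V" "r x = r y"
    then have "(x, y) \<in> E ` A\<^sub>0" using UV T by auto
    then obtain a where "a \<in> A\<^sub>0" "(x, y) = E a" by auto
    then show "x = y" using A0(2)[of a] by (metis fst_conv snd_conv)
  qed
  then show ?thesis using UV by (intro exI[of _ "U \<inter> V"]) auto
qed

lemma induces_homeomorphismD:
  assumes "induces_homeomorphism Z orb Y r"
  shows "r ` topspace Z = topspace Y"
    and "x \<in> topspace Z \<Longrightarrow> y \<in> topspace Z \<Longrightarrow> r x = r y \<Longrightarrow> orb x = orb y"
proof -
  obtain h where h: "homeomorphic_map (quotient_topology Z orb) Y h" "\<forall>x\<in>topspace Z. h (orb x) = r x"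
    using assms unfolding induces_homeomorphism_def by blast
  have "h ` (orb ` topspace Z) = topspace Y" using homeomorphic_imp_surjective_map[OF h(1)] by simp
  then show "r ` topspace Z = topspace Y" using h(2) by (simp add: image_image)
  have "inj_on h (orb ` topspace Z)" using homeomorphic_imp_injective_map[OF h(1)] by simp
  then show "x \<in> topspace Z \<Longrightarrow> y \<in> topspace Z \<Longrightarrow> r x = r y \<Longrightarrow> orb x = orb y"
    using h(2) by (metis imageI inj_onD)
qed

text \<open>Everything rests on the equation \<open>ract z h = lact g z'\<close>. With
  \<open>z\<close> and \<open>z'\<close> fixed, each of \<open>g\<close> and \<open>h\<close>
  determines the other: existence is the description of the orbit spaces, uniqueness is freeness,
  and properness makes the solution continuous. Commutation of the actions makes it
  multiplicative.\<close>

lemma Renault_bridge: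
  assumes G: "ample_Hausdorff_groupoid G" and H: "ample_Hausdorff_groupoid H"
    and lsp: "left_space G Z r lact" and lfp: "left_free_proper G Z r lact"
    and rsp: "right_space H Z s ract" and rfp: "right_free_proper H Z s ract"
    and comm: "actions_commute G H Z r s lact ract"
    and r: "induces_homeomorphism Z (right_orbit H s ract) (unit_space G) r"
    and s: "induces_homeomorphism Z (left_orbit G r lact) (unit_space H) s"
  obtains f f' where "bridge G H Z r s f f'"
proof -
  note aG = ample_unit_space[OF G] and aH = ample_unit_space[OF H]
  interpret G: topological_groupoid G by fact
  interpret H: topological_groupoid H by fact
  let ?ZH = "subtopology (prod_topology Z (gtop H)) (right_fibred H Z s)"
  let ?GZ = "subtopology (prod_topology (gtop G) Z) (left_fibred G Z r)"
  have tZH: "topspace ?ZH = right_fibred H Z s" and tGZ: "topspace ?GZ = left_fibred G Z r"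
    unfolding right_fibred_def left_fibred_def by auto
  have cr: "continuous_map Z (unit_space G) r" and cs: "continuous_map Z (unit_space H) s"
    and opr: "open_map Z (unit_space G) r" and ops: "open_map Z (unit_space H) s"
    and cl: "continuous_map ?GZ Z (\<lambda>(g, z). lact g z)" and cra: "continuous_map ?ZH Z
      (\<lambda>(z, h). ract z h)"
    using lsp rsp unfolding left_space_def right_space_def by auto
  have ru: "r z \<in> units G" and su: "s z \<in> units H" if "z \<in> topspace Z" for z
    using cr cs that by (auto simp: continuous_map_def Pi_iff)
  have lZ: "lact g z \<in> topspace Z" "r (lact g z) = grng G g" "s (lact g z) = s z"
    if "g \<in> arrows G" "z \<in> topspace Z" "gsrc G g = r z" for g z
  proof -
    have m: "(g, z) \<in> left_fibred G Z r" using that unfolding left_fibred_def by simp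
    then show "lact g z \<in> topspace Z" using cl tGZ by (auto simp: continuous_map_def Pi_iff)
    show "r (lact g z) = grng G g" using lsp m unfolding left_space_def by auto
    have "(z, s z) \<in> right_fibred H Z s" using that su[OF that(2)] unfolding right_fibred_def by simp
    then show "s (lact g z) = s z" using comm m unfolding actions_commute_def by blast
  qed
  have rZ: "ract z h \<in> topspace Z" "s (ract z h) = gsrc H h" "r (ract z h) = r z"
    if "h \<in> arrows H" "z \<in> topspace Z" "s z = grng H h" for h z
  proof -
    have m: "(z, h) \<in> right_fibred H Z s" using that unfolding right_fibred_def by simp
    then show "ract z h \<in> topspace Z" using cra tZH by (auto simp: continuous_map_def Pi_iff)
    show "s (ract z h) = gsrc H h" using rsp m unfolding right_space_def by auto
    have "(r z, z) \<in> left_fibred G Z r" using that ru[OF that(2)] unfolding left_fibred_def by simp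
    then show "r (ract z h) = r z" using comm m unfolding actions_commute_def by blast
  qed
  have lr: "ract (lact g z) h = lact g (ract z h)"
    if "g \<in> arrows G" "h \<in> arrows H" "z \<in> topspace Z" "gsrc G g = r z" "s z = grng H h" for g z h
    using that comm unfolding actions_commute_def left_fibred_def right_fibred_def by blast
  have rmult: "ract z (gmult H h k) = ract (ract z h) k"
    if "h \<in> arrows H" "k \<in> arrows H" "z \<in> topspace Z" "s z = grng H h" "gsrc H h = grng H k" for z h k
    using that rsp unfolding right_space_def right_fibred_def composable_def by blast
  have lmult: "lact (gmult G g g') z = lact g (lact g' z)"
    if "g \<in> arrows G" "g' \<in> arrows G" "z \<in> topspace Z" "gsrc G g = grng G g'" "gsrc G g' = r z"
      for z g g'
    using that lsp unfolding left_space_def left_fibred_def composable_def by blast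
  have lunit: "lact (r z) z = z" and runit: "ract z (s z) = z" if "z \<in> topspace Z" for z
    using that lsp rsp unfolding left_space_def right_space_def by auto
  let ?EH = "\<lambda>(z, h). (z, ract z h)" and ?EG = "\<lambda>(g, z). (lact g z, z)"
  let ?IH = "subtopology (prod_topology Z Z) {(z, z'). r z = r z'}"
  let ?IG = "subtopology (prod_topology Z Z) {(z, z'). s z = s z'}"
  have injH: "inj_on ?EH (right_fibred H Z s)" and injG: "inj_on ?EG (left_fibred G Z r)"
    using rfp lfp unfolding right_free_proper_def left_free_proper_def by auto
  \<comment> \<open>The action of \<open>H\<close> preserves \<open>r\<close>; conversely,
    \<open>r\<close> is injective on the orbit space of \<open>H\<close>, so two points with equal
    \<open>r\<close> lie in one orbit.\<close>
  have imH: "?EH ` right_fibred H Z s = topspace Z \<times> topspace Z \<inter> {(z, z'). r z = r z'}"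
  proof (intro set_eqI iffI)
    fix t assume "t \<in> ?EH ` right_fibred H Z s"
    then show "t \<in> topspace Z \<times> topspace Z \<inter> {(z, z'). r z = r z'}"
      using rZ unfolding right_fibred_def by auto
  next
    fix t assume "t \<in> topspace Z \<times> topspace Z \<inter> {(z, z'). r z = r z'}"
    then obtain z z' where t: "t = (z, z')" "z \<in> topspace Z" "z' \<in> topspace Z" "r z = r z'" by auto
    have "z' \<in> right_orbit H s ract z'"
      using runit[OF t(3)] su[OF t(3)] unfolding right_orbit_def
        by (intro CollectI exI[of _ "s z'"]) simp
    then have "z' \<in> right_orbit H s ract z" using induces_homeomorphismD(2)[OF r t(2-4)] by simp
    then obtain h where "z' = ract z h" "h \<in> arrows H" "s z = grng H h" unfolding right_orbit_def
      by blast
    then show "t \<in> ?EH ` right_fibred H Z s"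
      using t unfolding right_fibred_def by (intro image_eqI[of _ _ "(z, h)"]) auto
  qed
  have imG: "?EG ` left_fibred G Z r = topspace Z \<times> topspace Z \<inter> {(z, z'). s z = s z'}"
  proof (intro set_eqI iffI)
    fix t assume "t \<in> ?EG ` left_fibred G Z r"
    then show "t \<in> topspace Z \<times> topspace Z \<inter> {(z, z'). s z = s z'}"
      using lZ unfolding left_fibred_def by auto
  next
    fix t assume "t \<in> topspace Z \<times> topspace Z \<inter> {(z, z'). s z = s z'}"
    then obtain z z' where t: "t = (z, z')" "z \<in> topspace Z" "z' \<in> topspace Z" "s z = s z'" by auto
    have "z \<in> left_orbit G r lact z"
      using lunit[OF t(2)] ru[OF t(2)] unfolding left_orbit_def by (intro CollectI exI[of _ "r z"]) simp
    then have "z \<in> left_orbit G r lact z'" using induces_homeomorphismD(2)[OF s t(2-4)] by simp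
    then obtain g where "z = lact g z'" "g \<in> arrows G" "gsrc G g = r z'" unfolding left_orbit_def
      by blast
    then show "t \<in> ?EG ` left_fibred G Z r"
      using t unfolding left_fibred_def by (intro image_eqI[of _ _ "(g, z')"]) auto
  qed
  have "continuous_map ?ZH (prod_topology Z Z) ?EH"
    using continuous_map_pairedI[OF continuous_map_subtopology_fst[of Z "gtop H"
      "right_fibred H Z s"] cra]
    by (simp add: case_prod_unfold)
  \<comment> \<open>A proper map is closed, so an injective proper one is an embedding. Its inverse,
    defined on the fibre product, gives the continuous division map \<open>dH\<close>.\<close>
  then have "embedding_map ?ZH (prod_topology Z Z) ?EH"
    using rfp injH unfolding right_free_proper_def
    by (intro injective_closed_imp_embedding_map proper_imp_closed_map) (simp_all only: tZH)
  then obtain DH where DH: "homeomorphic_maps ?ZH ?IH ?EH DH"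
    unfolding embedding_map_def tZH imH by (auto simp: homeomorphic_map_maps subtopology_restrict
      Int_commute simp flip: topspace_prod_topology)
  have "continuous_map ?GZ (prod_topology Z Z) ?EG"
    using continuous_map_pairedI[OF cl continuous_map_subtopology_snd[of "gtop G" Z
      "left_fibred G Z r"]]
    by (simp add: case_prod_unfold)
  then have "embedding_map ?GZ (prod_topology Z Z) ?EG"
    using lfp injG unfolding left_free_proper_def
    by (intro injective_closed_imp_embedding_map proper_imp_closed_map) (simp_all only: tGZ)
  then obtain DG where DG: "homeomorphic_maps ?GZ ?IG ?EG DG"
    unfolding embedding_map_def tGZ imG by (auto simp: homeomorphic_map_maps subtopology_restrict
      Int_commute simp flip: topspace_prod_topology)
  define dH where "dH z z' = snd (DH (z, z'))" for z z'
  define dG where "dG z z' = fst (DG (z, z'))" for z z'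
  have dH: "dH z z' \<in> arrows H" "grng H (dH z z') = s z" "gsrc H (dH z z') = s z'" "ract z
    (dH z z') = z'"
    if "z \<in> topspace Z" "z' \<in> topspace Z" "r z = r z'" for z z'
  proof -
    have t: "(z, z') \<in> topspace ?IH" using that by simp
    then have D: "DH (z, z') \<in> right_fibred H Z s" "?EH (DH (z, z')) = (z, z')"
      using DH tZH unfolding homeomorphic_maps_def by (auto simp: continuous_map_def Pi_iff)
    then have "fst (DH (z, z')) = z" "ract z (dH z z') = z'" unfolding dH_def
      by (auto simp: case_prod_unfold)
    then show "dH z z' \<in> arrows H" "grng H (dH z z') = s z" "ract z (dH z z') = z'"
      using D(1) unfolding dH_def right_fibred_def by (auto simp: case_prod_unfold)
    then show "gsrc H (dH z z') = s z'" using rZ(2)[of "dH z z'" z] that by simp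
  qed
  have dG: "dG z z' \<in> arrows G" "grng G (dG z z') = r z" "gsrc G (dG z z') = r z'" "lact
    (dG z z') z' = z"
    if "z \<in> topspace Z" "z' \<in> topspace Z" "s z = s z'" for z z'
  proof -
    have t: "(z, z') \<in> topspace ?IG" using that by simp
    then have D: "DG (z, z') \<in> left_fibred G Z r" "?EG (DG (z, z')) = (z, z')"
      using DG tGZ unfolding homeomorphic_maps_def by (auto simp: continuous_map_def Pi_iff)
    then have "snd (DG (z, z')) = z'" "lact (dG z z') z' = z" unfolding dG_def
      by (auto simp: case_prod_unfold)
    then show "dG z z' \<in> arrows G" "gsrc G (dG z z') = r z'" "lact (dG z z') z' = z"
      using D(1) unfolding dG_def left_fibred_def by (auto simp: case_prod_unfold)
    then show "grng G (dG z z') = r z" using lZ(2)[of "dG z z'" z'] that by simp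
  qed
  have dH_unique: "h = k"
    if "h \<in> arrows H" "k \<in> arrows H" "z \<in> topspace Z" "s z = grng H h" "s z = grng H k" "ract z h
      = ract z k" for h k z
    using inj_onD[OF injH, of "(z, h)" "(z, k)"] that unfolding right_fibred_def by simp
  have dG_unique: "g = k"
    if "g \<in> arrows G" "k \<in> arrows G" "z \<in> topspace Z" "gsrc G g = r z" "gsrc G k = r z" "lact g z
      = lact k z" for g k z
    using inj_onD[OF injG, of "(g, z)" "(k, z)"] that unfolding left_fibred_def by simp
  have cdH: "continuous_map T (gtop H) (\<lambda>t. dH (a t) (b t))"
    if "continuous_map T Z a" "continuous_map T Z b" "\<And>t. t \<in> topspace T \<Longrightarrow> r (a t) = r (b t)"
    for T :: "('c \<times> 'd \<times> 'e) topology" and a b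
  proof -
    have 1: "continuous_map T ?IH (\<lambda>t. (a t, b t))"
      using that by (auto simp: continuous_map_in_subtopology intro: continuous_map_pairedI)
    have 2: "continuous_map ?IH ?ZH DH" using DH unfolding homeomorphic_maps_def by blast
    show ?thesis
      unfolding dH_def by (rule continuous_map_o[OF continuous_map_o[OF 1 2]
        continuous_map_subtopology_snd])
  qed
  have cdG: "continuous_map T (gtop G) (\<lambda>t. dG (a t) (b t))"
    if "continuous_map T Z a" "continuous_map T Z b" "\<And>t. t \<in> topspace T \<Longrightarrow> s (a t) = s (b t)"
    for T :: "('c \<times> 'd \<times> 'e) topology" and a b
  proof -
    have 1: "continuous_map T ?IG (\<lambda>t. (a t, b t))"
      using that by (auto simp: continuous_map_in_subtopology intro: continuous_map_pairedI)
    have 2: "continuous_map ?IG ?GZ DG" using DG unfolding homeomorphic_maps_def by blast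
    show ?thesis
      unfolding dG_def by (rule continuous_map_o[OF continuous_map_o[OF 1 2]
        continuous_map_subtopology_fst])
  qed
  have lh_r: "local_homeomorphism Z (unit_space G) r"
    unfolding local_homeomorphism_iff
  proof (intro conjI ballI cr opr)
    \<comment> \<open>The fibres of \<open>r\<close> are the \<open>H\<close>-orbits, so openness of
      the units of \<open>H\<close> is what separates the points of a fibre; for \<open>s\<close>
      the roles are exchanged.\<close>
    let ?A = "right_fibred H Z s \<inter> (topspace Z \<times> units H)"
    have "openin ?ZH ?A"
      using aH(5) by (intro openin_subtopology_Int2) (simp add: openin_prod_Times_iff)
    then show "\<exists>U. openin Z U \<and> z \<in> U \<and> inj_on r U" if "z \<in> topspace Z" for z
    proof (rule locally_injective_by_division[OF DH _ _ _ that])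
      show "fst (?EH t) = snd (?EH t)" if "t \<in> ?A" for t
        using that runit unfolding right_fibred_def by auto
      show "(z, z) \<in> ?EH ` ?A" if "z \<in> topspace Z" for z
        using that runit su[OF that] unfolding right_fibred_def
          by (intro image_eqI[of _ _ "(z, s z)"]) auto
    qed
  qed
  have lh_s: "local_homeomorphism Z (unit_space H) s"
    unfolding local_homeomorphism_iff
  proof (intro conjI ballI cs ops)
    let ?A = "left_fibred G Z r \<inter> (units G \<times> topspace Z)"
    have "openin ?GZ ?A"
      using aG(5) by (intro openin_subtopology_Int2) (simp add: openin_prod_Times_iff)
    then show "\<exists>U. openin Z U \<and> z \<in> U \<and> inj_on s U" if "z \<in> topspace Z" for z
    proof (rule locally_injective_by_division[OF DG _ _ _ that])
      show "fst (?EG t) = snd (?EG t)" if "t \<in> ?A" for t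
        using that lunit unfolding left_fibred_def by auto
      show "(z, z) \<in> ?EG ` ?A" if "z \<in> topspace Z" for z
        using that lunit ru[OF that] unfolding left_fibred_def
          by (intro image_eqI[of _ _ "(r z, z)"]) auto
    qed
  qed
  \<comment> \<open>The unique solution \<open>h\<close> of \<open>ract z h = lact g z'\<close>; the
    next line solves the same equation for \<open>g\<close>.\<close>
  define f where "f z g z' = dH z (lact g z')" for z g z'
  define f' where "f' z h z' = dG (ract z h) z'" for z h z'
  have f: "f z g z' \<in> arrows H" "grng H (f z g z') = s z" "gsrc H (f z g z') = s z'" "ract z
    (f z g z') = lact g z'"
    if "z \<in> topspace Z" "z' \<in> topspace Z" "g \<in> arrows G" "grng G g = r z" "gsrc G g = r z'" for z g z'
    using lZ[of g z'] dH[of z "lact g z'"] that unfolding f_def by auto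
  have f': "f' z h z' \<in> arrows G" "grng G (f' z h z') = r z" "gsrc G (f' z h z') = r z'" "lact
    (f' z h z') z' = ract z h"
    if "z \<in> topspace Z" "z' \<in> topspace Z" "h \<in> arrows H" "grng H h = s z" "gsrc H h = s z'" for z h z'
    using rZ[of h z] dG[of "ract z h" z'] that unfolding f'_def by auto
  have "bridge G H Z r s f f'"
  proof
    show "\<exists>g\<in>arrows G. \<exists>x\<in>topspace Z. grng G g = u \<and> gsrc G g = r x" if u: "u \<in> units G" for u
    proof -
      have "u \<in> r ` topspace Z" using induces_homeomorphismD(1)[OF r] u by simp
      then show ?thesis using u by (auto intro!: bexI[of _ u])
    qed
    show "\<exists>h\<in>arrows H. \<exists>x\<in>topspace Z. grng H h = v \<and> gsrc H h = s x" if v: "v \<in> units H" for v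
    proof -
      have "v \<in> s ` topspace Z" using induces_homeomorphismD(1)[OF s] v by simp
      then show ?thesis using v by (auto intro!: bexI[of _ v])
    qed
    show "f x g y \<in> arrows H \<and> grng H (f x g y) = s x \<and> gsrc H (f x g y) = s y \<and> f' x (f x g y) y = g"
      if "x \<in> topspace Z" "y \<in> topspace Z" "g \<in> arrows G" "grng G g = r x" "gsrc G g = r y" for x y g
    proof -
      note k = f[OF that] and k' = f'[OF that(1,2) f(1-3)[OF that]]
      have "f' x (f x g y) y = g"
        by (rule dG_unique[OF k'(1) that(3,2) k'(3) that(5)]) (simp only: k'(4) k(4))
      then show ?thesis using k by simp
    qed
    show "f' x h y \<in> arrows G \<and> grng G (f' x h y) = r x \<and> gsrc G (f' x h y) = r y \<and> f x
      (f' x h y) y = h"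
      if "x \<in> topspace Z" "y \<in> topspace Z" "h \<in> arrows H" "grng H h = s x" "gsrc H h = s y" for x y h
    proof -
      note k' = f'[OF that] and k = f[OF that(1,2) f'(1-3)[OF that]]
      have "f x (f' x h y) y = h"
        by (rule dH_unique[OF k(1) that(3,1) k(2)[symmetric] that(4)[symmetric]])
          (simp only: k'(4) k(4))
      then show ?thesis using k' by simp
    qed
    show "f x (gmult G g g') z = gmult H (f x g y) (f y g' z)"
      if "x \<in> topspace Z" "y \<in> topspace Z" "z \<in> topspace Z" "g \<in> arrows G" "g' \<in> arrows G"
        "grng G g = r x" "gsrc G g = r y" "grng G g' = r y" "gsrc G g' = r z" for x y z g g'
    proof -
      note f1 = f[OF that(1,2,4,6,7)] and f2 = f[OF that(2,3,5,8,9)]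
      have gg: "gmult G g g' \<in> arrows G" "grng G (gmult G g g') = r x" "gsrc G (gmult G g g') = r z"
        using that by auto
      note f3 = f[OF that(1,3) gg]
      have "ract x (gmult H (f x g y) (f y g' z)) = ract (lact g y) (f y g' z)"
        using rmult[OF f1(1) f2(1) that(1)] f1 f2 by simp
      also have "\<dots> = lact g (lact g' z)"
        using lr[OF that(4) f2(1) that(2)] f2 that by simp
      also have "\<dots> = ract x (f x (gmult G g g') z)"
        using lmult[OF that(4,5,3)] f3 that by simp
      finally have eq: "ract x (gmult H (f x g y) (f y g' z)) = ract x (f x (gmult G g g') z)" .
      have m: "gmult H (f x g y) (f y g' z) \<in> arrows H" "s x = grng H (gmult H (f x g y) (f y g' z))"
        using f1(1-3) f2(1-3) by auto
      show ?thesis by (rule dH_unique[OF f3(1) m(1) that(1) f3(2)[symmetric] m(2) eq[symmetric]])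
    qed
    let ?A = "gtop (fibred_groupoid G Z r)" and ?B = "gtop (fibred_groupoid H Z s)"
    note pA = continuous_map_fibred_projections[of G Z r] and pB
      = continuous_map_fibred_projections[of H Z s]
    have "continuous_map ?A ?GZ (\<lambda>t. (fst (snd t), snd (snd t)))"
      unfolding continuous_map_in_subtopology
      by (intro conjI continuous_map_pairedI pA) (auto simp: arrows_fibred left_fibred_def)
    from continuous_map_o[OF this cl]
    have "continuous_map ?A Z (\<lambda>t. lact (fst (snd t)) (snd (snd t)))" by (simp add: case_prod_unfold)
    then show "continuous_map ?A (gtop H) (\<lambda>t. f (fst t) (fst (snd t)) (snd (snd t)))"
      unfolding f_def by (intro cdH pA) (use lZ in \<open>auto simp: arrows_fibred\<close>)
    have "continuous_map ?B ?ZH (\<lambda>t. (fst t, fst (snd t)))"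
      unfolding continuous_map_in_subtopology
      by (intro conjI continuous_map_pairedI pB) (auto simp: arrows_fibred right_fibred_def)
    from continuous_map_o[OF this cra]
    have "continuous_map ?B Z (\<lambda>t. ract (fst t) (fst (snd t)))" by (simp add: case_prod_unfold)
    then show "continuous_map ?B (gtop G) (\<lambda>t. f' (fst t) (fst (snd t)) (snd (snd t)))"
      unfolding f'_def by (intro cdG pB) (use rZ in \<open>auto simp: arrows_fibred\<close>)
  qed (fact lh_r lh_s)+
  then show ?thesis by (rule that)
qed

lemma bridge_surjective_imp_isomorphic_ampliations:
  assumes "bridge G H X p q f f'" "locally_compact_space X" "Hausdorff_space X"
    and surj: "p ` topspace X = units G" "q ` topspace X = units H"
  shows "fibred_groupoid G X p \<cong>\<^sub>G fibred_groupoid H X q" "ampliation_map G X p" "ampliation_map H X q"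
proof -
  interpret bridge G H X p q f f' by fact
  show "ampliation_map G X p" "ampliation_map H X q"
    using assms p_lh q_lh unfolding ampliation_map_def by auto
  let ?A = "fibred_groupoid G X p" and ?B = "fibred_groupoid H X q"
  let ?\<phi> = "\<lambda>t. (fst t, f (fst t) (fst (snd t)) (snd (snd t)), snd (snd t))"
  let ?\<psi> = "\<lambda>t. (fst t, f' (fst t) (fst (snd t)) (snd (snd t)), snd (snd t))"
  have "continuous_map (gtop ?A) (gtop ?B) ?\<phi>" "continuous_map (gtop ?B) (gtop ?A) ?\<psi>"
    using f_continuous f'_continuous continuous_map_fibred_projections[of G X p]
      continuous_map_fibred_projections[of H X q]
    by (auto simp: continuous_map_into_fibred arrows_fibred)
  then have "homeomorphic_maps (gtop ?A) (gtop ?B) ?\<phi> ?\<psi>"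
    unfolding homeomorphic_maps_def by (auto simp: arrows_fibred)
  then show "?A \<cong>\<^sub>G ?B"
    by (rule isomorphicI) (auto simp: arrows_fibred f_mult f_unit[symmetric])
qed

section \<open>Morita equivalence\<close>

lemma homeomorphic_maps_imp_local_homeomorphism:
  assumes "homeomorphic_maps X Y f g"
  shows "local_homeomorphism X Y f" "local_homeomorphism Y X g"
  using assms homeomorphic_imp_local_homeomorphism unfolding homeomorphic_maps_map by auto

text \<open>With the range and source of an arrow as its endpoints in the unit space, the axioms of
  a bridge say that \<rho> itself is a continuous homomorphism. So a bridge of this shape can stand
  in for the similarity it came from.\<close>

lemma similar_bridge_hom:
  assumes br: "bridge G H (unit_space G) (\<lambda>x. x) \<rho> (\<lambda>x g y. \<rho> g) f'"
  shows "groupoid_hom G H \<rho>" "continuous_map (gtop G) (gtop H) \<rho>"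
proof -
  interpret G: topological_groupoid G by (rule bridge.axioms(1)[OF br])
  interpret H: topological_groupoid H by (rule bridge.axioms(2)[OF br])
  show "groupoid_hom G H \<rho>"
  proof (rule groupoid_homI)
    show "\<rho> g \<in> arrows H \<and> \<rho> (grng G g) = grng H (\<rho> g) \<and> \<rho> (gsrc G g) = gsrc H (\<rho> g)"
      if "g \<in> arrows G" for g
    proof -
      have u: "grng G g \<in> topspace (unit_space G)" "gsrc G g \<in> topspace (unit_space G)" using that
        by auto
      show ?thesis using bridge.f_arrow[OF br u that refl refl] by metis
    qed
    show "\<rho> (gmult G g h) = gmult H (\<rho> g) (\<rho> h)"
      if "g \<in> arrows G" "h \<in> arrows G" "gsrc G g = grng G h" for g h
    proof -
      have u: "grng G g \<in> topspace (unit_space G)" "gsrc G g \<in> topspace (unit_space G)"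
        "gsrc G h \<in> topspace (unit_space G)" using that by auto
      show ?thesis by (rule bridge.f_mult[OF br u that(1,2) refl refl that(3)[symmetric] refl])
    qed
  qed
  have "continuous_map (gtop G) (gtop G) (\<lambda>g. g)" by simp
  from bridge.f_continuous_comp[OF br G.continuous_rng_comp(1)[OF this] this
    G.continuous_src_comp(1)[OF this]]
  show "continuous_map (gtop G) (gtop H) \<rho>" by simp
qed

text \<open>The map on pairs is a base change of \<rho> on units followed by the source map, hence a
  local homeomorphism, and \<open>q_full\<close> makes it onto. The inverse required by the fibred
  product condition is \<open>f'\<close>, which is continuous by the bridge axioms.\<close>

lemma similar_bridge_imp_weak_equivalence:
  assumes br: "bridge G H (unit_space G) (\<lambda>x. x) \<rho> (\<lambda>x g y. \<rho> g) f'"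
    and src: "local_homeomorphism (gtop H) (unit_space H) (gsrc H)"
  shows "weak_equivalence G H \<rho>"
proof -
  interpret G: topological_groupoid G by (rule bridge.axioms(1)[OF br])
  interpret H: topological_groupoid H by (rule bridge.axioms(2)[OF br])
  note hom = similar_bridge_hom[OF br] and h = groupoid_homD[OF similar_bridge_hom(1)[OF br]]
  let ?P = "subtopology (prod_topology (unit_space G) (gtop H)) {(u, \<gamma>). \<rho> u = grng H \<gamma>}"
  have "local_homeomorphism ?P (unit_space H) (\<lambda>(u, \<gamma>). gsrc H \<gamma>)"
    using local_homeomorphism_compose[OF local_homeomorphism_pullback_snd[OF bridge.q_lh[OF br]
      H.continuous_rng] src]
    by (simp add: case_prod_unfold)
  moreover have "(\<lambda>(u, \<gamma>). gsrc H \<gamma>) ` topspace ?P = units H"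
  proof
    show "units H \<subseteq> (\<lambda>(u, \<gamma>). gsrc H \<gamma>) ` topspace ?P"
    proof
      fix v assume "v \<in> units H"
      then obtain h x where "h \<in> arrows H" "x \<in> units G" "grng H h = v" "gsrc H h = \<rho> x"
        using bridge.q_full[OF br] by (metis topspace_unit_space)
      then show "v \<in> (\<lambda>(u, \<gamma>). gsrc H \<gamma>) ` topspace ?P"
        by (intro image_eqI[of _ _ "(x, ginv H h)"]) auto
    qed
  qed auto
  moreover have "groupoid_iso G (fibred_groupoid H (unit_space G) \<rho>) (\<lambda>g. (grng G g, \<rho> g, gsrc G g))"
    unfolding groupoid_iso_def
  proof
    show "groupoid_hom G (fibred_groupoid H (unit_space G) \<rho>) (\<lambda>g. (grng G g, \<rho> g, gsrc G g))"
      by (rule groupoid_homI) (auto simp: arrows_fibred h)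
    have id: "continuous_map (gtop G) (gtop G) (\<lambda>g. g)" by simp
    have "continuous_map (gtop G) (gtop (fibred_groupoid H (unit_space G) \<rho>)) (\<lambda>g.
      (grng G g, \<rho> g, gsrc G g))"
      using G.continuous_rng_comp(1)[OF id] G.continuous_src_comp(1)[OF id] hom(2) h(2,3)
      by (simp add: continuous_map_into_fibred)
    then have "homeomorphic_maps (gtop G) (gtop (fibred_groupoid H (unit_space G) \<rho>))
        (\<lambda>g. (grng G g, \<rho> g, gsrc G g)) (\<lambda>t. f' (fst t) (fst (snd t)) (snd (snd t)))"
      unfolding homeomorphic_maps_def using bridge.f'_continuous[OF br] bridge.f_arrow[OF br]
        bridge.f'_arrow[OF br]
      by (auto simp: arrows_fibred)
    then show "homeomorphic_map (gtop G) (gtop (fibred_groupoid H (unit_space G) \<rho>)) (\<lambda>g.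
      (grng G g, \<rho> g, gsrc G g))"
      by (rule homeomorphic_maps_imp_map)
  qed
  ultimately show ?thesis using hom unfolding weak_equivalence_def continuous_hom_def
    by (simp add: Let_def)
qed

section \<open>Copies of spaces and groupoids along injections into other types\<close>

text \<open>Along an injection, the quotient topology is a homeomorphic copy of \<open>X\<close>
  carried by the image; in this way a space enters a prescribed type.\<close>

lemma quotient_topology_homeomorphic:
  assumes "inj e"
  shows "homeomorphic_maps (quotient_topology X e) X (inv e) e"
proof -
  have "openin X U \<longleftrightarrow> openin (quotient_topology X e) (e ` U)" if "U \<subseteq> topspace X" for U
  proof -
    have "{x \<in> topspace X. e x \<in> e ` U} = U" using that assms by (auto dest: injD)
    then show ?thesis using that by (auto simp: openin_quotient_topology)
  qed
  moreover have "{y \<in> topspace (quotient_topology X e). inv e y \<in> U} = e ` (topspace X \<inter> U)" for U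
    using assms by auto
  ultimately have "openin (quotient_topology X e) {y \<in> topspace (quotient_topology X e). inv e y \<in> U}"
    if "openin X U" for U
    using that by (metis inf.absorb_iff2 openin_subset)
  then have "continuous_map (quotient_topology X e) X (inv e)"
    using assms unfolding continuous_map_def by auto
  moreover have "continuous_map X (quotient_topology X e) e"
    unfolding continuous_map_def by (auto simp: openin_quotient_topology)
  ultimately show ?thesis using assms unfolding homeomorphic_maps_def by auto
qed

definition transport :: "('a \<Rightarrow> 'c) \<Rightarrow> 'a grpd \<Rightarrow> 'c grpd" where
  "transport e G =
     \<lparr>gtop = quotient_topology (gtop G) e,
      grng = (\<lambda>k. e (grng G (inv e k))),
      gsrc = (\<lambda>k. e (gsrc G (inv e k))),
      gmult = (\<lambda>k l. e (gmult G (inv e k) (inv e l))),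
      ginv = (\<lambda>k. e (ginv G (inv e k)))\<rparr>"

lemma transport_simps:
  "gtop (transport e G) = quotient_topology (gtop G) e"
  "grng (transport e G) = (\<lambda>k. e (grng G (inv e k)))"
  "gsrc (transport e G) = (\<lambda>k. e (gsrc G (inv e k)))"
  "gmult (transport e G) = (\<lambda>k l. e (gmult G (inv e k) (inv e l)))"
  "ginv (transport e G) = (\<lambda>k. e (ginv G (inv e k)))"
  "arrows (transport e G) = e ` arrows G"
  unfolding transport_def by (auto simp flip: topspace_gtop)

lemma transport_maps:
  assumes "inj e"
  shows "homeomorphic_maps (gtop (transport e G)) (gtop G) (inv e) e"
    "groupoid_hom (transport e G) G (inv e)" "groupoid_hom G (transport e G) e"
  using quotient_topology_homeomorphic[OF assms] assms
  by (auto simp: transport_simps intro!: groupoid_homI)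

lemma transport_ample_Hausdorff:
  assumes e: "inj e" and G: "ample_Hausdorff_groupoid G"
  shows "ample_Hausdorff_groupoid (transport e G)"
proof -
  note aG = ample_unit_space[OF G]
  interpret G: topological_groupoid G by fact
  let ?K = "transport e G"
  note m = transport_maps[OF e, of G]
  note u = unit_space_homeomorphic[OF m]
  have c: "continuous_map (gtop ?K) (gtop G) (inv e)" "continuous_map (gtop G) (gtop ?K) e"
    "continuous_map (unit_space G) (unit_space ?K) e"
    using m(1) u unfolding homeomorphic_maps_def by auto
  have lh: "local_homeomorphism (gtop ?K) (gtop G) (inv e)" "local_homeomorphism (unit_space G)
    (unit_space ?K) e"
    "local_homeomorphism (unit_space ?K) (unit_space G) (inv e)" "local_homeomorphism (gtop G)
      (gtop ?K) e"
    using homeomorphic_maps_imp_local_homeomorphism[OF m(1)]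
      homeomorphic_maps_imp_local_homeomorphism[OF u] by auto
  have hs: "gtop G homeomorphic_space gtop ?K" "unit_space G homeomorphic_space unit_space ?K"
    using m(1) u homeomorphic_maps_imp_homeomorphic_space homeomorphic_space_sym by blast+
  have units: "units ?K = e ` units G"
    using e unfolding units_def by (auto simp: transport_simps inj_eq[OF e])
  interpret K: groupoid ?K
  proof
    show "g \<in> arrows ?K \<Longrightarrow> grng ?K g \<in> units ?K" "g \<in> arrows ?K \<Longrightarrow> gsrc ?K g \<in> units ?K" for g
      using e by (auto simp: units transport_simps)
  qed (use e in \<open>auto simp: transport_simps composable_def G.assoc inj_eq\<close>)
  show ?thesis
  proof
    show "locally_compact_space (gtop ?K)"
      using G.locally_compact hs(1) homeomorphic_locally_compact_space by blast
    show "Hausdorff_space (unit_space ?K)" using aG(2) hs(2) homeomorphic_Hausdorff_space by blast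
    show "Hausdorff_space (gtop ?K)" using aG(8) hs(1) homeomorphic_Hausdorff_space by blast
    show "local_homeomorphism (gtop ?K) (unit_space ?K) (grng ?K)"
      using local_homeomorphism_compose[OF local_homeomorphism_compose[OF lh(1) aG(3)] lh(2)]
      by (simp add: transport_simps)
    then show "continuous_map (gtop ?K) (unit_space ?K) (grng ?K)" by (rule local_homeomorphismD)
    show "local_homeomorphism (gtop ?K) (unit_space ?K) (gsrc ?K)"
      using local_homeomorphism_compose[OF local_homeomorphism_compose[OF lh(1) aG(4)] lh(2)]
      by (simp add: transport_simps)
    then show "continuous_map (gtop ?K) (unit_space ?K) (gsrc ?K)" by (rule local_homeomorphismD)
    show "continuous_map (gtop ?K) (gtop ?K) (ginv ?K)"
      using continuous_map_o[OF G.continuous_inv_comp[OF c(1)] c(2)] by (simp add: transport_simps)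
    let ?C = "subtopology (prod_topology (gtop ?K) (gtop ?K)) (composable ?K)"
    have "continuous_map ?C (gtop G) (\<lambda>t. gmult G (inv e (fst t)) (inv e (snd t)))"
      by (intro G.continuous_mult_comp continuous_map_o[OF _ c(1)] continuous_map_subtopology_fst
          continuous_map_subtopology_snd)
        (use e in \<open>auto simp: composable_def transport_simps inj_eq\<close>)
    from continuous_map_o[OF this c(2)]
    show "continuous_map ?C (gtop ?K) (\<lambda>(g, h). gmult ?K g h)"
      by (simp add: transport_simps case_prod_unfold)
    show "openin (gtop ?K) (units ?K)"
      unfolding units using local_homeomorphismD(2)[OF lh(4)] aG(5) unfolding open_map_def by blast
    show "zero_dimensional_space (unit_space ?K)"
      by (rule zero_dimensional_space_local_homeomorphism[OF lh(3) aG(1)])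
  qed
qed

lemma stably_isomorphic_imp_weak_equivalence:
  assumes G: "ample_Hausdorff_groupoid G" and H: "ample_Hausdorff_groupoid H"
    and iso: "G \<times>\<^sub>G \<R> \<cong>\<^sub>G H \<times>\<^sub>G \<R>"
  shows "\<exists>\<rho>. weak_equivalence G H \<rho>"
proof -
  have "similar G H"
    by (rule stably_isomorphic_imp_similar[OF ample_unit_space(6)[OF G] ample_unit_space(6)[OF H] iso])
  then obtain \<rho> f' where "bridge G H (unit_space G) (\<lambda>x. x) \<rho> (\<lambda>x g y. \<rho> g) f'"
    using similar_imp_bridge[OF G H] by blast
  then show ?thesis using similar_bridge_imp_weak_equivalence ample_unit_space(4)[OF H] by blast
qed

text \<open>The middle groupoid is a copy of \<open>G\<close> in the type \<open>'u\<close>. Being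
  isomorphic to \<open>G\<close>, it is stably isomorphic to \<open>G\<close> and therefore to
  \<open>H\<close>, so both weak equivalences come from one lemma.\<close>

lemma stably_isomorphic_imp_Morita:
  assumes G: "ample_Hausdorff_groupoid (G :: 'a grpd)" and H: "ample_Hausdorff_groupoid H"
    and iso: "G \<times>\<^sub>G \<R> \<cong>\<^sub>G H \<times>\<^sub>G \<R>" and e: "inj (e :: 'a \<Rightarrow> 'u)"
  shows "Morita_equivalent TYPE('u) G H"
proof -
  let ?K = "transport e G"
  have K: "ample_Hausdorff_groupoid ?K" by (rule transport_ample_Hausdorff[OF e G])
  have "?K \<cong>\<^sub>G G" using transport_maps[OF e] isomorphic_hom by blast
  then have 1: "?K \<times>\<^sub>G \<R> \<cong>\<^sub>G G \<times>\<^sub>G \<R>" by (rule isomorphic_prod)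
  then have 2: "?K \<times>\<^sub>G \<R> \<cong>\<^sub>G H \<times>\<^sub>G \<R>" using iso by (rule isomorphic_trans)
  have "Hausdorff_etale_groupoid ?K"
    using K by (simp add: ample_Hausdorff_groupoid_def ample_groupoid_def Hausdorff_etale_groupoid_def)
  then show ?thesis
    using stably_isomorphic_imp_weak_equivalence[OF K G 1]
      stably_isomorphic_imp_weak_equivalence[OF K H 2]
    unfolding Morita_equivalent_def by blast
qed

section \<open>Linking groupoids\<close>

lemma fullI:
  assumes "U \<subseteq> units G" "\<And>u. u \<in> units G \<Longrightarrow> \<exists>g \<in> arrows G. gsrc G g = u \<and> grng G g \<in> U"
  shows "full G U"
  using assms unfolding full_def orbit_def by blast

lemma full_open_units: "groupoid G \<Longrightarrow> openin (unit_space G) (units G) \<and> full G (units G)"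
proof -
  assume "groupoid G"
  then interpret groupoid G .
  have "full G (units G)"
  proof (rule fullI)
    fix u assume "u \<in> units G"
    then show "\<exists>g\<in>arrows G. gsrc G g = u \<and> grng G g \<in> units G" by (intro bexI[of _ u]) auto
  qed simp
  then show ?thesis using openin_topspace[of "unit_space G"] by simp
qed

lemma sigma_compact_cover:
  assumes "sigma_compact_space Y" "homeomorphic_map Y (subtopology X U) f" "U \<subseteq> topspace X"
  shows "\<exists>\<K>. countable \<K> \<and> (\<forall>K \<in> \<K>. compactin X K) \<and> \<Union>\<K> = U"
proof -
  obtain \<K> where \<K>: "countable \<K>" "\<forall>K \<in> \<K>. compactin Y K" "\<Union>\<K> = topspace Y"
    using assms(1) unfolding sigma_compact_space_def by metis
  have "compactin X (f ` K)" if "K \<in> \<K>" for K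
    using image_compactin[of Y K "subtopology X U" f] homeomorphic_imp_continuous_map[OF assms(2)]
      \<K>(2) that
    by (auto simp: compactin_subtopology)
  moreover have "\<Union>((`) f ` \<K>) = U"
    using homeomorphic_imp_surjective_map[OF assms(2)] \<K>(3) assms(3)
      by (auto simp: image_Union[symmetric])
  ultimately show ?thesis using \<K>(1) by (intro exI[of _ "(`) f ` \<K>"]) auto
qed

text \<open>The definition of a linking groupoid does not mention \<sigma>-compactness, but the unit
  space of \<open>L\<close> is a union of homeomorphic copies of those of \<open>G\<close> and
  \<open>H\<close> and inherits it. Hence bridges apply to the pairs \<open>G\<close>,
  \<open>L\<close> and \<open>H\<close>, \<open>L\<close>, and transitivity removes
  \<open>L\<close>.\<close>

lemma linking_imp_stably_isomorphic:
  assumes G: "ample_Hausdorff_groupoid G" "sigma_compact_space (unit_space G)"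
    and H: "ample_Hausdorff_groupoid H" "sigma_compact_space (unit_space H)"
    and l: "has_linking_groupoid TYPE('u) G H"
  shows "G \<times>\<^sub>G \<R> \<cong>\<^sub>G H \<times>\<^sub>G \<R>"
proof -
  obtain L :: "'u grpd" and X Y where L: "ample_Hausdorff_groupoid L" and XY: "X \<union> Y = units L"
    and X: "clopenin (unit_space L) X" "full L X" and Y: "clopenin (unit_space L) Y" "full L Y"
    and iso: "reduction L X \<cong>\<^sub>G G" "reduction L Y \<cong>\<^sub>G H"
    using l unfolding has_linking_groupoid_def by blast
  interpret L: groupoid L by (rule ample_unit_space(7)[OF L])
  have piece: "K \<cong>\<^sub>G reduction L U" "weakly_Kakutani_equivalent K L"
      "\<exists>\<K>. countable \<K> \<and> (\<forall>K \<in> \<K>. compactin (unit_space L) K) \<and> \<Union>\<K> = U"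
    if "clopenin (unit_space L) U" "full L U" "reduction L U \<cong>\<^sub>G K"
      "ample_Hausdorff_groupoid K" "sigma_compact_space (unit_space K)" for K :: "'k grpd" and U
  proof -
    interpret K: groupoid K by (rule ample_unit_space(7)[OF that(4)])
    have U: "U \<subseteq> units L" using that(2) unfolding full_def by blast
    show iso: "K \<cong>\<^sub>G reduction L U" by (rule isomorphic_sym[OF that(3) L.groupoid_reduction[OF U]])
    \<comment> \<open>\<open>K\<close> is its own reduction to all units, which form a full open
      set.\<close>
    then show "weakly_Kakutani_equivalent K L"
      using full_open_units[OF K.groupoid_axioms] that(1,2)
      unfolding weakly_Kakutani_equivalent_def clopenin_def by (metis K.reduction_units)
    obtain \<phi> \<psi> where "homeomorphic_maps (gtop K) (gtop (reduction L U)) \<phi> \<psi>"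
      "groupoid_hom K (reduction L U) \<phi>" "groupoid_hom (reduction L U) K \<psi>"
      by (rule isomorphic_obtain[OF iso K.groupoid_axioms])
    from unit_space_homeomorphic[OF this]
    show "\<exists>\<K>. countable \<K> \<and> (\<forall>K \<in> \<K>. compactin (unit_space L) K) \<and> \<Union>\<K> = U"
      using sigma_compact_cover[OF that(5)] U homeomorphic_maps_imp_map unit_space_reduction[OF U]
      by (metis topspace_unit_space)
  qed
  note p1 = piece[OF X iso(1) G] and p2 = piece[OF Y iso(2) H]
  obtain \<K> where \<K>: "countable \<K>" "\<forall>K \<in> \<K>. compactin (unit_space L) K" "\<Union>\<K> = X" using p1(3) by metis
  obtain \<M> where \<M>: "countable \<M>" "\<forall>K \<in> \<M>. compactin (unit_space L) K" "\<Union>\<M> = Y" using p2(3) by metis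
  have Ls: "sigma_compact_space (unit_space L)"
    unfolding sigma_compact_space_def
    by (rule exI[of _ "\<K> \<union> \<M>"]) (use \<K> \<M> XY in auto)
  have "G \<times>\<^sub>G \<R> \<cong>\<^sub>G L \<times>\<^sub>G \<R>"
    by (rule weakly_Kakutani_imp_bridge[OF G(1) L p1(2)])
      (rule bridge.bridge_imp_stably_isomorphic[OF _ G L Ls])
  moreover have "H \<times>\<^sub>G \<R> \<cong>\<^sub>G L \<times>\<^sub>G \<R>"
    by (rule weakly_Kakutani_imp_bridge[OF H(1) L p2(2)])
      (rule bridge.bridge_imp_stably_isomorphic[OF _ H L Ls])
  moreover have "groupoid (H \<times>\<^sub>G \<R>)"
    using topological_groupoid_prod[OF ample_unit_space(6)[OF H(1)] topological_groupoid_R]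
    by (simp add: topological_groupoid_def)
  ultimately show ?thesis using isomorphic_trans isomorphic_sym by blast
qed

lemma reduction_homeomorphic:
  assumes h: "homeomorphic_maps (gtop K) (gtop L) \<phi> \<psi>" "groupoid_hom K L \<phi>" "groupoid_hom L K \<psi>"
    and K: "groupoid K" and U: "U \<subseteq> units L"
  shows "reduction K (\<psi> ` U) \<cong>\<^sub>G reduction L U"
proof -
  interpret K: groupoid K by fact
  note hp = groupoid_homD[OF h(2)] and hs = groupoid_homD[OF h(3)]
  have \<phi>\<psi>: "\<phi> (\<psi> u) = u" if "u \<in> U" for u
    using h(1) subsetD[OF units_subset_arrows subsetD[OF U that]] unfolding homeomorphic_maps_def
      by simp
  have "homeomorphic_maps (gtop (reduction K (\<psi> ` U))) (gtop (reduction L U)) \<phi> \<psi>"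
    unfolding reduction_simps
    by (rule homeomorphic_maps_subtopologies_alt[OF h(1)])
      (use hp(1-3) hs(1-3) \<phi>\<psi> in \<open>auto simp flip: hp(2,3) hs(2,3)\<close>)
  then show ?thesis
    by (rule isomorphicI) (use hp in \<open>auto simp: arrows_reduction\<close>)
qed

lemma full_homeomorphic:
  assumes e: "groupoid_hom L K e" and units: "units K = e ` units L" and U: "full L U"
  shows "full K (e ` U)"
proof (rule fullI)
  show "e ` U \<subseteq> units K" using U units unfolding full_def by blast
  fix k assume "k \<in> units K"
  then obtain v where v: "v \<in> units L" "k = e v" using units by blast
  then obtain g where g: "g \<in> arrows L" "gsrc L g = v" "grng L g \<in> U"
    using U unfolding full_def orbit_def by auto
  then show "\<exists>g\<in>arrows K. gsrc K g = k \<and> grng K g \<in> e ` U"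
    using groupoid_homD(1-3)[OF e g(1)] v by (metis imageI)
qed

lemma linking_transport:
  fixes L :: "'x grpd" and e :: "'x \<Rightarrow> 'u"
  assumes e: "inj e" and L: "has_linking_groupoid TYPE('x) G H"
  shows "has_linking_groupoid TYPE('u) G H"
proof -
  obtain L :: "'x grpd" and X Y where L: "ample_Hausdorff_groupoid L"
    and XY: "X \<union> Y = units L" "X \<inter> Y = {}" "clopenin (unit_space L) X" "clopenin (unit_space L) Y"
      "full L X" "full L Y"
    and iso: "reduction L X \<cong>\<^sub>G G" "reduction L Y \<cong>\<^sub>G H"
    using L unfolding has_linking_groupoid_def by blast
  let ?K = "transport e L"
  note m = transport_maps[OF e, of L]
  note K = transport_ample_Hausdorff[OF e L]
  note u = unit_space_homeomorphic[OF m]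
  have units: "units ?K = e ` units L"
    using homeomorphic_imp_surjective_map[of "unit_space L" "unit_space ?K" e] u
    by (simp add: homeomorphic_maps_map)
  have cl: "clopenin (unit_space ?K) (e ` U)" if "clopenin (unit_space L) U" for U
  proof -
    have "homeomorphic_map (unit_space L) (unit_space ?K) e" using u
      by (simp add: homeomorphic_maps_map)
    then show ?thesis
      using that homeomorphic_imp_open_map homeomorphic_imp_closed_map
      unfolding clopenin_def open_map_def closed_map_def by blast
  qed
  have fl: "full ?K (e ` U)" if "full L U" for U
    by (rule full_homeomorphic[OF m(3) units that])
  have red: "reduction ?K (e ` U) \<cong>\<^sub>G reduction L U" if "U \<subseteq> units L" for U
    by (rule reduction_homeomorphic[OF m ample_unit_space(7)[OF K] that])
  have "reduction ?K (e ` X) \<cong>\<^sub>G G" "reduction ?K (e ` Y) \<cong>\<^sub>G H"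
    using isomorphic_trans[OF red iso(1)] isomorphic_trans[OF red iso(2)] XY(1) by blast+
  moreover have "e ` X \<union> e ` Y = units ?K" using XY(1) units by blast
  moreover have "e ` X \<inter> e ` Y = {}" using XY(2) e by (auto dest: injD)
  ultimately show ?thesis
    using K cl[OF XY(3)] cl[OF XY(4)] fl[OF XY(5)] fl[OF XY(6)] unfolding has_linking_groupoid_def
      by blast
qed

section \<open>Construction of a linking groupoid\<close>

lemma reduction_ample_Hausdorff:
  assumes G: "ample_Hausdorff_groupoid G" and U: "openin (unit_space G) U"
  shows "ample_Hausdorff_groupoid (reduction G U)"
proof -
  note aG = ample_unit_space[OF G]
  interpret G: topological_groupoid G by fact
  let ?L = "reduction G U"
  let ?A = "{g \<in> arrows G. grng G g \<in> U \<and> gsrc G g \<in> U}"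
  have UG: "U \<subseteq> units G" using openin_subset[OF U] by simp
  interpret L: groupoid ?L by (rule G.groupoid_reduction[OF UG])
  note us = unit_space_reduction[OF UG]
  have "?A = {g \<in> topspace (gtop G). grng G g \<in> U} \<inter> {g \<in> topspace (gtop G). gsrc G g \<in> U}" by auto
  then have A: "openin (gtop G) ?A"
    using openin_continuous_map_preimage[OF G.continuous_rng U] openin_continuous_map_preimage[OF
      G.continuous_src U] by auto
  have lr: "local_homeomorphism (gtop ?L) (unit_space ?L) (grng ?L)"
    unfolding us reduction_simps by (rule local_homeomorphism_open_subtopology[OF aG(3) A]) auto
  have ls: "local_homeomorphism (gtop ?L) (unit_space ?L) (gsrc ?L)"
    unfolding us reduction_simps by (rule local_homeomorphism_open_subtopology[OF aG(4) A]) auto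
  have z: "zero_dimensional_space (unit_space ?L)"
    unfolding us
    by (rule zero_dimensional_space_local_homeomorphism[OF local_homeomorphism_open_inclusion[OF
      U] aG(1)])
  have c: "continuous_map (gtop ?L) (gtop G) (\<lambda>g. g)" by simp
  show ?thesis
  proof
    \<comment> \<open>The arrow space is locally homeomorphic to a zero-dimensional unit space, so
      every arrow has a compact open neighbourhood.\<close>
    show "locally_compact_space (gtop ?L)"
      by (rule zero_dimensional_imp_locally_compact[OF
        zero_dimensional_space_local_homeomorphism[OF lr z]])
    show "Hausdorff_space (gtop ?L)" "Hausdorff_space (unit_space ?L)"
      using aG(2,8) by (auto simp: us intro: Hausdorff_space_subtopology)
    show "continuous_map (gtop ?L) (gtop ?L) (ginv ?L)"
      using G.continuous_inv_comp[OF c] by (auto simp: continuous_map_in_subtopology)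
    let ?C = "subtopology (prod_topology (gtop ?L) (gtop ?L)) (composable ?L)"
    have "continuous_map ?C (gtop G) (\<lambda>t. gmult G (fst t) (snd t))"
      by (intro G.continuous_mult_comp continuous_map_o[OF continuous_map_subtopology_fst c]
          continuous_map_o[OF continuous_map_subtopology_snd c]) (auto simp: composable_def)
    then show "continuous_map ?C (gtop ?L) (\<lambda>(g, h). gmult ?L g h)"
      by (auto simp: case_prod_unfold continuous_map_in_subtopology composable_def arrows_reduction)
    have "openin (gtop G) U" using U aG(5) unfolding unit_space_def by (rule openin_trans_full)
    moreover have "U = ?A \<inter> U" using UG subsetD[OF UG] by auto
    ultimately show "openin (gtop ?L) (units ?L)"
      unfolding units_reduction[OF UG] reduction_simps by (metis openin_subtopology_Int2)
  qed (fact lr ls z local_homeomorphismD(1)[OF lr] local_homeomorphismD(1)[OF ls])+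
qed

lemma times_R_ample_Hausdorff:
  assumes G: "ample_Hausdorff_groupoid G"
  shows "ample_Hausdorff_groupoid (G \<times>\<^sub>G \<R>)"
proof -
  note aG = ample_unit_space[OF G]
  interpret K: topological_groupoid "G \<times>\<^sub>G \<R>"
    by (rule topological_groupoid_prod[OF aG(6) topological_groupoid_R])
  show ?thesis
  proof
    show "Hausdorff_space (gtop (G \<times>\<^sub>G \<R>))" using aG(8) by (simp add: Hausdorff_space_prod_topology)
    show "openin (gtop (G \<times>\<^sub>G \<R>)) (units (G \<times>\<^sub>G \<R>))"
      using aG(5) by (simp add: units_prod openin_prod_Times_iff)
    show "local_homeomorphism (gtop (G \<times>\<^sub>G \<R>)) (unit_space (G \<times>\<^sub>G \<R>)) (grng (G \<times>\<^sub>G \<R>))"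
      "local_homeomorphism (gtop (G \<times>\<^sub>G \<R>)) (unit_space (G \<times>\<^sub>G \<R>)) (gsrc (G \<times>\<^sub>G \<R>))"
      unfolding unit_space_prod unit_space_R prod_groupoid_simps R_simps
      by (intro local_homeomorphism_map_prod aG(3,4) local_homeomorphism_discrete; auto simp: units_R)+
    show "zero_dimensional_space (unit_space (G \<times>\<^sub>G \<R>))"
      unfolding unit_space_prod unit_space_R
      by (rule zero_dimensional_space_local_homeomorphism[OF local_homeomorphism_fst_discrete aG(1)])
  qed
qed

text \<open>The arrow \<open>(g, i, m)\<close> takes any index \<open>m\<close> to \<open>i\<close>,
  so a single slice of a full set is full; between units of the slice both indices are frozen at
  \<open>i\<close>, which leaves the reduction of \<open>G\<close>.\<close>

lemma slice_times_R:
  fixes i :: nat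
  assumes G: "groupoid G" and A: "openin (unit_space G) A" "full G A"
  shows "openin (unit_space (G \<times>\<^sub>G \<R>)) (A \<times> {(i, i)})" "full (G \<times>\<^sub>G \<R>) (A \<times> {(i, i)})"
    "reduction (G \<times>\<^sub>G \<R>) (A \<times> {(i, i)}) \<cong>\<^sub>G reduction G A"
proof -
  interpret groupoid G by fact
  show "openin (unit_space (G \<times>\<^sub>G \<R>)) (A \<times> {(i, i)})"
    using A(1) by (simp add: unit_space_prod unit_space_R openin_prod_Times_iff units_R)
  have AG: "A \<subseteq> units G" using A(2) unfolding full_def by blast
  show "full (G \<times>\<^sub>G \<R>) (A \<times> {(i, i)})"
  proof (rule fullI)
    show "A \<times> {(i, i)} \<subseteq> units (G \<times>\<^sub>G \<R>)" using AG by (auto simp: units_prod units_R)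
    fix w assume "w \<in> units (G \<times>\<^sub>G \<R>)"
    then obtain u m where u: "u \<in> units G" "w = (u, m, m)" by (auto simp: units_prod units_R)
    then obtain g where "g \<in> arrows G" "gsrc G g = u" "grng G g \<in> A"
      using A(2) unfolding full_def orbit_def by auto
    then show "\<exists>g\<in>arrows (G \<times>\<^sub>G \<R>). gsrc (G \<times>\<^sub>G \<R>) g = w \<and> grng (G \<times>\<^sub>G \<R>) g \<in> A \<times> {(i, i)}"
      using u by (intro bexI[of _ "(g, i, m)"]) auto
  qed
  have "continuous_map (gtop (reduction (G \<times>\<^sub>G \<R>) (A \<times> {(i, i)}))) (gtop G) fst"
    by (simp add: continuous_map_subtopology_fst)
  then have "continuous_map (gtop (reduction (G \<times>\<^sub>G \<R>) (A \<times> {(i, i)}))) (gtop (reduction G A)) fst"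
    by (auto simp: continuous_map_in_subtopology)
  moreover have "continuous_map (gtop (reduction G A)) (gtop (G \<times>\<^sub>G \<R>)) (\<lambda>g. (g, i, i))"
    by (auto intro!: continuous_map_pairedI)
  then have "continuous_map (gtop (reduction G A)) (gtop (reduction (G \<times>\<^sub>G \<R>) (A \<times> {(i, i)})))
    (\<lambda>g. (g, i, i))"
    by (auto simp: continuous_map_in_subtopology)
  ultimately have "homeomorphic_maps (gtop (reduction (G \<times>\<^sub>G \<R>) (A \<times> {(i, i)}))) (gtop
    (reduction G A)) fst (\<lambda>g. (g, i, i))"
    unfolding homeomorphic_maps_def by auto
  then show "reduction (G \<times>\<^sub>G \<R>) (A \<times> {(i, i)}) \<cong>\<^sub>G reduction G A"
    by (rule isomorphicI) (auto simp: arrows_reduction)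
qed

lemma reduction_reduction:
  assumes "X \<subseteq> U"
  shows "reduction (reduction G U) X = reduction G X"
proof -
  have "{g \<in> arrows G. grng G g \<in> U \<and> gsrc G g \<in> U} \<inter>
      {g \<in> arrows (reduction G U). grng G g \<in> X \<and> gsrc G g \<in> X} = {g \<in> arrows G. grng G g \<in> X
        \<and> gsrc G g \<in> X}"
    using assms by (auto simp: arrows_reduction)
  then show ?thesis
    unfolding reduction_def[of "reduction G U"] reduction_def[of G X]
    by (simp add: subtopology_subtopology)
qed

text \<open>Disjoint full open sets need not exhaust the units of \<open>K\<close>. After reduction
  to their union they do, and each is then the complement of the other open set, hence
  clopen.\<close>

lemma linking_of_partition:
  fixes K :: "'k grpd"
  assumes K: "ample_Hausdorff_groupoid K" and XY: "X \<inter> Y = {}"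
    and X: "openin (unit_space K) X" "full K X" and Y: "openin (unit_space K) Y" "full K Y"
    and iso: "reduction K X \<cong>\<^sub>G G" "reduction K Y \<cong>\<^sub>G H"
  shows "has_linking_groupoid TYPE('k) G H"
proof -
  let ?U = "X \<union> Y"
  let ?L = "reduction K ?U"
  have U: "openin (unit_space K) ?U" "?U \<subseteq> units K" using X Y unfolding full_def by auto
  have op: "openin (unit_space ?L) X" "openin (unit_space ?L) Y"
    unfolding unit_space_reduction[OF U(2)] using X(1) Y(1)
      by (auto simp: openin_open_subtopology[OF U(1)])
  moreover have "?U - X = Y" "?U - Y = X" using XY by auto
  ultimately have cl: "clopenin (unit_space ?L) X" "clopenin (unit_space ?L) Y"
    unfolding clopenin_def closedin_def by (auto simp: units_reduction[OF U(2)])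
  have "full ?L V" if V: "full K V" "V \<subseteq> ?U" for V
  proof (rule fullI)
    fix u assume "u \<in> units ?L"
    then have u: "u \<in> ?U" "u \<in> units K" using U by (auto simp: units_reduction)
    then obtain g where "g \<in> arrows K" "gsrc K g = u" "grng K g \<in> V"
      using V(1) unfolding full_def orbit_def by auto
    then show "\<exists>g\<in>arrows ?L. gsrc ?L g = u \<and> grng ?L g \<in> V"
      using u V(2) by (intro bexI[of _ g]) (auto simp: arrows_reduction)
  qed (use V(2) in \<open>simp add: units_reduction[OF U(2)]\<close>)
  then have "full ?L X" "full ?L Y" using X(2) Y(2) by auto
  moreover have "reduction ?L X \<cong>\<^sub>G G" "reduction ?L Y \<cong>\<^sub>G H"
    using iso by (simp_all add: reduction_reduction)
  ultimately show ?thesis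
    using reduction_ample_Hausdorff[OF K U(1)] XY cl units_reduction[OF U(2)]
    unfolding has_linking_groupoid_def by blast
qed

text \<open>The slice at 0 is a copy of \<open>G\<close> in \<open>G \<times>\<^sub>G \<R>\<close>,
  and the isomorphism moves the slice at 0 of \<open>H \<times>\<^sub>G \<R>\<close> into the same
  groupoid, where the two may overlap. A second factor \<R> separates them by placing them at the
  indices 0 and 1.\<close>

lemma stably_isomorphic_imp_linking:
  fixes G :: "'a grpd" and H :: "'b grpd"
  assumes G: "ample_Hausdorff_groupoid G" and H: "ample_Hausdorff_groupoid H"
    and iso: "G \<times>\<^sub>G \<R> \<cong>\<^sub>G H \<times>\<^sub>G \<R>"
  shows "has_linking_groupoid TYPE(('a \<times> nat \<times> nat) \<times> nat \<times> nat) G H"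
proof -
  let ?G = "G \<times>\<^sub>G \<R>" and ?H = "H \<times>\<^sub>G \<R>"
  note GR = times_R_ample_Hausdorff[OF G]
  interpret G: groupoid G by (rule ample_unit_space(7)[OF G])
  interpret H: groupoid H by (rule ample_unit_space(7)[OF H])
  interpret GR: groupoid ?G by (rule ample_unit_space(7)[OF GR])
  obtain \<phi> \<psi> where m: "homeomorphic_maps (gtop ?G) (gtop ?H) \<phi> \<psi>" "groupoid_hom ?G ?H \<phi>"
    "groupoid_hom ?H ?G \<psi>"
    by (rule isomorphic_obtain[OF iso GR.groupoid_axioms])
  have u: "homeomorphic_map (unit_space ?H) (unit_space ?G) \<psi>"
    using unit_space_homeomorphic[OF m] by (simp add: homeomorphic_maps_map)
  have units: "units ?G = \<psi> ` units ?H" using homeomorphic_imp_surjective_map[OF u] by simp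
  let ?X = "units G \<times> {(0 :: nat, 0 :: nat)}" and ?V = "units H \<times> {(0 :: nat, 0 :: nat)}"
  let ?Y = "\<psi> ` ?V"
  have "openin (unit_space G) (units G)" "full G (units G)" "openin (unit_space H) (units H)"
    "full H (units H)"
    using full_open_units G.groupoid_axioms H.groupoid_axioms by blast+
  note X = slice_times_R[OF G.groupoid_axioms this(1,2), of 0] and V
    = slice_times_R[OF H.groupoid_axioms this(3,4), of 0]
  have V': "?V \<subseteq> units ?H" using V(2) unfolding full_def by blast
  have oY: "openin (unit_space ?G) ?Y" using homeomorphic_imp_open_map[OF u] V(1)
    unfolding open_map_def by blast
  have fY: "full ?G ?Y" by (rule full_homeomorphic[OF m(3) units V(2)])
  have iY: "reduction ?G ?Y \<cong>\<^sub>G H"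
    using isomorphic_trans[OF reduction_homeomorphic[OF m GR.groupoid_axioms V'] V(3)]
      by (simp add: H.reduction_units)
  note X' = slice_times_R[OF GR.groupoid_axioms X(1,2), of 0] and Y'
    = slice_times_R[OF GR.groupoid_axioms oY fY, of 1]
  show ?thesis
  proof (rule linking_of_partition[OF times_R_ample_Hausdorff[OF GR] _ X'(1,2) Y'(1,2)])
    show "reduction (?G \<times>\<^sub>G \<R>) (?X \<times> {(0, 0)}) \<cong>\<^sub>G G"
      using isomorphic_trans[OF X'(3) X(3)] by (simp add: G.reduction_units)
    show "reduction (?G \<times>\<^sub>G \<R>) (?Y \<times> {(1, 1)}) \<cong>\<^sub>G H" by (rule isomorphic_trans[OF Y'(3) iY])
  qed auto
qed

section \<open>Renault equivalence\<close>

text \<open>A continuous open surjection is a quotient map, so it identifies \<open>Y\<close> with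
  the orbit space as soon as its fibres are the orbits. The induced map is evaluated at an arbitrary
  representative.\<close>

lemma induces_homeomorphismI:
  assumes c: "continuous_map Z Y r" and o: "open_map Z Y r" and s: "r ` topspace Z = topspace Y"
    and eq: "\<And>x y. x \<in> topspace Z \<Longrightarrow> y \<in> topspace Z \<Longrightarrow> orb x = orb y \<longleftrightarrow> r x = r y"
  shows "induces_homeomorphism Z orb Y r"
proof -
  define h where "h c = r (SOME x. x \<in> topspace Z \<and> orb x = c)" for c
  have h: "h (orb x) = r x" if "x \<in> topspace Z" for x
  proof -
    have "\<exists>y. y \<in> topspace Z \<and> orb y = orb x" using that by blast
    from someI_ex[OF this] show ?thesis unfolding h_def using eq that by blast
  qed
  let ?Q = "quotient_topology Z orb"
  have "homeomorphic_map ?Q Y h"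
  proof (rule bijective_open_imp_homeomorphic_map)
    show "continuous_map ?Q Y h"
      unfolding continuous_map_def
    proof (intro conjI allI impI)
      show "h \<in> topspace ?Q \<rightarrow> topspace Y" using h s by auto
      fix U assume U: "openin Y U"
      have pre: "{x \<in> topspace Z. orb x \<in> {c \<in> topspace ?Q. h c \<in> U}} = {x \<in> topspace Z. r x \<in> U}"
        by (auto simp flip: h)
      show "openin ?Q {c \<in> topspace ?Q. h c \<in> U}"
        unfolding openin_quotient_topology[of Z orb] pre
        using openin_continuous_map_preimage[OF c U] by auto
    qed
    show "open_map ?Q Y h"
      unfolding open_map_def
    proof (intro allI impI)
      fix W assume W: "openin ?Q W"
      then have W': "W \<subseteq> orb ` topspace Z" "openin Z {x \<in> topspace Z. orb x \<in> W}"
        by (auto simp: openin_quotient_topology)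
      have "h ` W = r ` {x \<in> topspace Z. orb x \<in> W}"
      proof (intro set_eqI iffI)
        fix y assume "y \<in> h ` W"
        then obtain w where w: "w \<in> W" "y = h w" by blast
        then obtain x where "x \<in> topspace Z" "w = orb x" using W'(1) by blast
        then show "y \<in> r ` {x \<in> topspace Z. orb x \<in> W}" using w h by auto
      next
        fix y assume "y \<in> r ` {x \<in> topspace Z. orb x \<in> W}"
        then obtain x where "x \<in> topspace Z" "orb x \<in> W" "y = r x" by blast
        then show "y \<in> h ` W" using h by (intro image_eqI[of _ _ "orb x"]) auto
      qed
      then show "openin Y (h ` W)" using o W'(2) unfolding open_map_def by simp
    qed
    show "h ` topspace ?Q = topspace Y" using h s by (simp add: image_image)
    show "inj_on h (topspace ?Q)" using h eq by (auto simp: inj_on_def)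
  qed
  then show ?thesis using h unfolding induces_homeomorphism_def by blast
qed

text \<open>Produces properness from a continuous division map \<open>D\<close>: a homeomorphism
  onto a closed subspace is a closed injection, and a closed injection is proper.\<close>

lemma homeomorphic_closed_imp_proper:
  assumes "homeomorphic_maps A (subtopology Y S) E D" "closedin Y (topspace Y \<inter> S)"
  shows "proper_map A Y E" "inj_on E (topspace A)"
proof -
  have m: "homeomorphic_map A (subtopology Y S) E" by (rule homeomorphic_maps_imp_map[OF assms(1)])
  then show inj: "inj_on E (topspace A)" by (rule homeomorphic_imp_injective_map)
  have "E ` topspace A = topspace Y \<inter> S" using homeomorphic_imp_surjective_map[OF m] by simp
  moreover have "subtopology Y S = subtopology Y (topspace Y \<inter> S)" by (simp only: subtopology_restrict)
  ultimately have "embedding_map A Y E" using m unfolding embedding_map_def by simp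
  then have "closed_map A Y E"
    using embedding_imp_closed_map assms(2) \<open>E ` topspace A = _\<close> by metis
  then show "proper_map A Y E" by (rule closed_injective_imp_proper_map[OF _ inj])
qed

text \<open>This is the bibundle of \<rho>: points are pairs \<open>(u, h)\<close> with
  \<open>\<rho> u = grng H h\<close>, the arrow \<open>g\<close> sends \<open>(u, h)\<close> to the
  pair of \<open>grng G g\<close> and \<open>gmult H (\<rho> g) h\<close>, and \<open>H\<close>
  multiplies \<open>h\<close> from the right. The space \<open>Z\<close> is an arbitrary
  homeomorphic copy with coordinates \<open>a\<close> and \<open>b\<close>, so that its type stays
  free. Freeness and properness of both actions are read off explicit division maps.\<close>

lemma similar_bridge_imp_Renault:
  fixes Z :: "'u topology"
  assumes G: "ample_Hausdorff_groupoid G" and H: "ample_Hausdorff_groupoid H"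
    and br: "bridge G H (unit_space G) (\<lambda>x. x) \<rho> (\<lambda>x g y. \<rho> g) f'"
    and Z: "homeomorphic_maps Z (subtopology (prod_topology (unit_space G) (gtop H)) {(u, h). \<rho> u
      = grng H h}) d e"
  shows "Renault_equivalent TYPE('u) G H"
proof -
  note aG = ample_unit_space[OF G] and aH = ample_unit_space[OF H]
  interpret G: topological_groupoid G by fact
  interpret H: topological_groupoid H by fact
  note h\<rho> = groupoid_homD[OF similar_bridge_hom(1)[OF br]] and c\<rho> = similar_bridge_hom(2)[OF br]
  note lh\<rho> = bridge.q_lh[OF br]
  have \<rho>u: "\<rho> u \<in> units H" if "u \<in> units G" for u
    using local_homeomorphism_funcset[OF lh\<rho>] that by simp
  have ff: "f' (grng G g) (\<rho> g) (gsrc G g) = g" if "g \<in> arrows G" for g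
    using bridge.f_arrow[OF br _ _ that refl refl] that by simp
  have ff': "f' u h v \<in> arrows G \<and> grng G (f' u h v) = u \<and> gsrc G (f' u h v) = v \<and> \<rho> (f' u h v) = h"
    if "u \<in> units G" "v \<in> units G" "h \<in> arrows H" "grng H h = \<rho> u" "gsrc H h = \<rho> v" for u h v
    using bridge.f'_arrow[OF br _ _ that(3-5)] that(1,2) by simp
  let ?P = "subtopology (prod_topology (unit_space G) (gtop H)) {(u, h). \<rho> u = grng H h}"
  define a where "a z = fst (d z)" for z
  define b where "b z = snd (d z)" for z
  have dP: "d z \<in> topspace ?P" if "z \<in> topspace Z" for z
    using Z that unfolding homeomorphic_maps_def by (metis PiE continuous_map_funspace)
  have a: "a z \<in> units G" and b: "b z \<in> arrows H" "grng H (b z) = \<rho> (a z)" and eab: "e (a z, b z) = z"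
    if "z \<in> topspace Z" for z
    using dP[OF that] Z that unfolding a_def b_def homeomorphic_maps_def by auto
  have e: "e (u, h) \<in> topspace Z" "a (e (u, h)) = u" "b (e (u, h)) = h"
    if "u \<in> units G" "h \<in> arrows H" "grng H h = \<rho> u" for u h
  proof -
    have "(u, h) \<in> topspace ?P" using that by simp
    then show "e (u, h) \<in> topspace Z" "a (e (u, h)) = u" "b (e (u, h)) = h"
      using Z unfolding homeomorphic_maps_def a_def b_def
      by (auto simp: continuous_map_def Pi_iff simp del: topspace_subtopology)
  qed
  have lhP: "local_homeomorphism Z ?P d" by (rule homeomorphic_maps_imp_local_homeomorphism(1)[OF Z])
  have lha: "local_homeomorphism Z (unit_space G) a"
    unfolding a_def using lh\<rho> aH(3)
    by (intro local_homeomorphism_compose[OF lhP] local_homeomorphism_pullback_fst)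
      (auto dest: local_homeomorphismD)
  have lhb: "local_homeomorphism Z (gtop H) b"
    unfolding b_def using lh\<rho> aH(3)
    by (intro local_homeomorphism_compose[OF lhP] local_homeomorphism_pullback_snd)
      (auto dest: local_homeomorphismD)
  define s where "s z = gsrc H (b z)" for z
  have lhs: "local_homeomorphism Z (unit_space H) s"
    unfolding s_def by (rule local_homeomorphism_compose[OF lhb aH(4)])
  have ca: "continuous_map Z (unit_space G) a" and cb: "continuous_map Z (gtop H) b"
    and cs: "continuous_map Z (unit_space H) s"
    using lha lhb lhs local_homeomorphismD(1) by blast+
  have ce: "continuous_map T Z (\<lambda>t. e (u t, h t))"
    if "continuous_map T (unit_space G) u" "continuous_map T (gtop H) h" "\<And>t. t \<in> topspace T \<Longrightarrow> \<rho>
      (u t) = grng H (h t)"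
    for T :: "'t topology" and u h
  proof -
    have "continuous_map T ?P (\<lambda>t. (u t, h t))"
      using that by (auto simp: continuous_map_in_subtopology intro: continuous_map_pairedI)
    moreover have "continuous_map ?P Z e" using Z unfolding homeomorphic_maps_def by blast
    ultimately show ?thesis by (rule continuous_map_o)
  qed
  have zZ: "zero_dimensional_space Z" by (rule zero_dimensional_space_local_homeomorphism[OF lha aG(1)])
  have lcZ: "locally_compact_space Z" by (rule zero_dimensional_imp_locally_compact[OF zZ])
  have HZ: "Hausdorff_space Z"
  proof -
    have "Hausdorff_space ?P" using aG(2) aH(8)
      by (intro Hausdorff_space_subtopology) (simp add: Hausdorff_space_prod_topology)
    then show ?thesis
      using homeomorphic_Hausdorff_space homeomorphic_maps_imp_homeomorphic_space[OF Z] by blast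
  qed
  define lact where "lact g z = e (grng G g, gmult H (\<rho> g) (b z))" for g z
  define ract where "ract z h = e (a z, gmult H (b z) h)" for z h
  have l: "lact g z \<in> topspace Z" "a (lact g z) = grng G g" "b (lact g z) = gmult H (\<rho> g) (b z)"
    "s (lact g z) = s z"
    if "g \<in> arrows G" "z \<in> topspace Z" "gsrc G g = a z" for g z
    using e[of "grng G g" "gmult H (\<rho> g) (b z)"] b[OF that(2)] h\<rho>(1)[OF that(1)] h\<rho>(2,3)[OF
      that(1), symmetric] that
    unfolding lact_def s_def by simp_all
  have r: "ract z h \<in> topspace Z" "a (ract z h) = a z" "b (ract z h) = gmult H (b z) h" "s
    (ract z h) = gsrc H h"
    if "h \<in> arrows H" "z \<in> topspace Z" "s z = grng H h" for h z
    using e[of "a z" "gmult H (b z) h"] b[OF that(2)] a[OF that(2)] that unfolding ract_def s_def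
      by simp_all
  let ?GZ = "subtopology (prod_topology (gtop G) Z) (left_fibred G Z a)"
  let ?ZH = "subtopology (prod_topology Z (gtop H)) (right_fibred H Z s)"
  have tGZ: "topspace ?GZ = left_fibred G Z a" and tZH: "topspace ?ZH = right_fibred H Z s"
    unfolding right_fibred_def left_fibred_def by auto
  have pG: "continuous_map ?GZ (gtop G) fst" "continuous_map ?GZ Z snd"
    and pH: "continuous_map ?ZH Z fst" "continuous_map ?ZH (gtop H) snd"
    by (auto intro: continuous_map_subtopology_fst continuous_map_subtopology_snd)
  have cl: "continuous_map ?GZ Z (\<lambda>(g, z). lact g z)"
  proof -
    have "continuous_map ?GZ Z (\<lambda>t. lact (fst t) (snd t))"
      unfolding lact_def
      by (intro ce H.continuous_mult_comp G.continuous_rng_comp continuous_map_o[OF pG(1) c\<rho>]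
          continuous_map_o[OF pG(2) cb] pG)
        (use b h\<rho> in \<open>auto simp: tGZ left_fibred_def simp flip: h\<rho>(2,3)\<close>)
    then show ?thesis by (simp add: case_prod_unfold)
  qed
  have cr: "continuous_map ?ZH Z (\<lambda>(z, h). ract z h)"
  proof -
    have "continuous_map ?ZH Z (\<lambda>t. ract (fst t) (snd t))"
      unfolding ract_def
      by (intro ce H.continuous_mult_comp continuous_map_o[OF pH(1) ca] continuous_map_o[OF pH(1)
        cb] pH)
        (use b in \<open>auto simp: tZH right_fibred_def s_def\<close>)
    then show ?thesis by (simp add: case_prod_unfold)
  qed
  have ls: "left_space G Z a lact"
    unfolding left_space_def
  proof (intro conjI lcZ HZ ca cl)
    show "open_map Z (unit_space G) a" by (rule local_homeomorphismD(2)[OF lha])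
    show "\<forall>(g, z)\<in>left_fibred G Z a. a (lact g z) = grng G g"
      using l unfolding left_fibred_def by auto
    show "\<forall>g h z. (g, h) \<in> composable G \<and> (h, z) \<in> left_fibred G Z a \<longrightarrow> lact (gmult G g h) z
      = lact g (lact h z)"
    proof (intro allI impI)
      fix g h z assume "(g, h) \<in> composable G \<and> (h, z) \<in> left_fibred G Z a"
      then have gh: "g \<in> arrows G" "h \<in> arrows G" "gsrc G g = grng G h" "gsrc G h = a z" "z
        \<in> topspace Z"
        unfolding composable_def left_fibred_def by auto
      have \<rho>gh: "\<rho> (gmult G g h) = gmult H (\<rho> g) (\<rho> h)" using h\<rho>(4) gh by simp
      have "gsrc H (\<rho> g) = grng H (\<rho> h)" "gsrc H (\<rho> h) = grng H (b z)"
        using h\<rho>(2,3)[symmetric] gh b by simp_all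
      then show "lact (gmult G g h) z = lact g (lact h z)"
        using l(3)[OF gh(2,5,4)] gh h\<rho>(1) b unfolding lact_def[of "gmult G g h"] lact_def[of g] \<rho>gh
        by (simp add: H.assoc)
    qed
    show "\<forall>z\<in>topspace Z. lact (a z) z = z"
    proof
      fix z assume z: "z \<in> topspace Z"
      have "gmult H (\<rho> (a z)) (b z) = b z" using b[OF z] by (intro H.unit_mult) auto
      then show "lact (a z) z = z" unfolding lact_def using eab[OF z] a[OF z] by simp
    qed
  qed
  have rs: "right_space H Z s ract"
    unfolding right_space_def
  proof (intro conjI lcZ HZ cs cr)
    show "open_map Z (unit_space H) s" by (rule local_homeomorphismD(2)[OF lhs])
    show "\<forall>(z, h)\<in>right_fibred H Z s. s (ract z h) = gsrc H h"
      using r unfolding right_fibred_def by auto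
    show "\<forall>z h k. (z, h) \<in> right_fibred H Z s \<and> (h, k) \<in> composable H \<longrightarrow> ract z (gmult H h k)
      = ract (ract z h) k"
    proof (intro allI impI)
      fix z h k assume "(z, h) \<in> right_fibred H Z s \<and> (h, k) \<in> composable H"
      then have hk: "h \<in> arrows H" "k \<in> arrows H" "gsrc H h = grng H k" "s z = grng H h" "z
        \<in> topspace Z"
        unfolding composable_def right_fibred_def by auto
      then show "ract z (gmult H h k) = ract (ract z h) k"
        using r[OF hk(1,5,4)] b[OF hk(5)] unfolding ract_def[of z "gmult H h k"] ract_def[of _ k] s_def
        by (simp add: H.assoc)
    qed
    show "\<forall>z\<in>topspace Z. ract z (s z) = z"
      using b eab unfolding ract_def s_def by simp
  qed
  have comm: "actions_commute G H Z a s lact ract"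
    unfolding actions_commute_def
  proof (intro allI impI)
    fix g z h assume "(g, z) \<in> left_fibred G Z a \<and> (z, h) \<in> right_fibred H Z s"
    then have *: "g \<in> arrows G" "h \<in> arrows H" "z \<in> topspace Z" "gsrc G g = a z" "s z = grng H h"
      unfolding left_fibred_def right_fibred_def by auto
    have "gsrc H (\<rho> g) = grng H (b z)" "gsrc H (b z) = grng H h"
      using h\<rho>(3)[OF *(1), symmetric] * b unfolding s_def by simp_all
    then have "ract (lact g z) h = lact g (ract z h)"
      using l(2,3)[OF *(1,3,4)] r(3)[OF *(2,3,5)] h\<rho>(1)[OF *(1)] b(1)[OF *(3)] *
      unfolding ract_def[of "lact g z"] lact_def[of g "ract z h"] by (simp add: H.assoc)
    then show "s (lact g z) = s z \<and> a (ract z h) = a z \<and> ract (lact g z) h = lact g (ract z h)"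
      using l(4)[OF *(1,3,4)] r(2)[OF *(2,3,5)] by simp
  qed
  have lfp: "left_free_proper G Z a lact"
  proof -
    let ?S = "{(z, z'). s z = s z'}"
    let ?I = "subtopology (prod_topology Z Z) ?S"
    \<comment> \<open>Equality of two continuous maps into a Hausdorff unit space is a closed
      condition.\<close>
    have cl1: "closedin (prod_topology Z Z) (topspace (prod_topology Z Z) \<inter> ?S)"
    proof -
      have "closedin (prod_topology Z Z) {t \<in> topspace (prod_topology Z Z). s (fst t) = s (snd t)}"
        by (intro closedin_continuous_maps_eq[OF aH(2)] continuous_map_o[OF _ cs]
          continuous_map_fst continuous_map_snd)
      moreover have "{t \<in> topspace (prod_topology Z Z). s (fst t) = s (snd t)} = topspace
        (prod_topology Z Z) \<inter> ?S" by auto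
      ultimately show ?thesis by simp
    qed
    have pI: "continuous_map ?I Z fst" "continuous_map ?I Z snd"
      by (auto intro: continuous_map_subtopology_fst continuous_map_subtopology_snd)
    \<comment> \<open>An arrow of \<open>G\<close> that takes \<open>snd t\<close> to
      \<open>fst t\<close> must have this arrow of \<open>H\<close> as its image under \<rho>, and
      \<open>f'\<close> provides the unique lift with the right endpoints.\<close>
    let ?k = "\<lambda>t. gmult H (b (fst t)) (ginv H (b (snd t)))"
    let ?D = "\<lambda>t. (f' (a (fst t)) (?k t) (a (snd t)), snd t)"
    have k: "?k t \<in> arrows H" "grng H (?k t) = \<rho> (a (fst t))" "gsrc H (?k t) = \<rho> (a (snd t))"
      if "t \<in> topspace ?I" for t
      using that b unfolding s_def by auto
    have "continuous_map ?I (gtop H) ?k"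
      by (intro H.continuous_mult_comp H.continuous_inv_comp continuous_map_o[OF pI(1) cb]
        continuous_map_o[OF pI(2) cb])
        (use b in \<open>auto simp: s_def\<close>)
    then have "continuous_map ?I (gtop G) (\<lambda>t. f' (a (fst t)) (?k t) (a (snd t)))"
      using k by (intro bridge.f_continuous_comp[OF bridge.bridge_sym[OF br]] continuous_map_o[OF
        pI(1) ca]
          continuous_map_o[OF pI(2) ca]) auto
    then have cD: "continuous_map ?I ?GZ ?D"
      unfolding continuous_map_in_subtopology[of ?I "prod_topology (gtop G) Z"]
      using k a ff' pI(2) by (auto simp: left_fibred_def intro!: continuous_map_pairedI)
    have cE: "continuous_map ?GZ ?I (\<lambda>(g, z). (lact g z, z))"
      unfolding continuous_map_in_subtopology
      using continuous_map_pairedI[OF cl pG(2)] l by (auto simp: case_prod_unfold left_fibred_def)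
    have "homeomorphic_maps ?GZ ?I (\<lambda>(g, z). (lact g z, z)) ?D"
      unfolding homeomorphic_maps_def
    proof (intro conjI cD cE ballI)
      fix t assume "t \<in> topspace ?GZ"
      then obtain g z where t: "t = (g, z)" "g \<in> arrows G" "z \<in> topspace Z" "gsrc G g = a z"
        unfolding tGZ left_fibred_def by auto
      have "gsrc H (\<rho> g) = grng H (b z)" using h\<rho>(3)[OF t(2), symmetric] t b by simp
      then have "gmult H (gmult H (\<rho> g) (b z)) (ginv H (b z)) = \<rho> g"
        using h\<rho>(1)[OF t(2)] b(1)[OF t(3)] by simp
      then show "?D ((\<lambda>(g, z). (lact g z, z)) t) = t"
        using l[OF t(2-4)] ff[OF t(2)] t by simp
    next
      fix t assume t: "t \<in> topspace ?I"
      then have z: "fst t \<in> topspace Z" "snd t \<in> topspace Z" "s (fst t) = s (snd t)" by auto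
      note f1 = ff'[OF a[OF z(1)] a[OF z(2)] k[OF t]]
      have "gmult H (?k t) (b (snd t)) = b (fst t)"
        using b z unfolding s_def by simp
      then have "lact (f' (a (fst t)) (?k t) (a (snd t))) (snd t) = fst t"
        unfolding lact_def using f1 eab[OF z(1)] by simp
      then show "(\<lambda>(g, z). (lact g z, z)) (?D t) = t" by simp
    qed
    from homeomorphic_closed_imp_proper[OF this cl1] show ?thesis
      unfolding left_free_proper_def tGZ by blast
  qed
  have rfp: "right_free_proper H Z s ract"
  proof -
    let ?S = "{(z, z'). a z = a z'}"
    let ?I = "subtopology (prod_topology Z Z) ?S"
    have cl1: "closedin (prod_topology Z Z) (topspace (prod_topology Z Z) \<inter> ?S)"
    proof -
      have "closedin (prod_topology Z Z) {t \<in> topspace (prod_topology Z Z). a (fst t) = a (snd t)}"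
        by (intro closedin_continuous_maps_eq[OF aG(2)] continuous_map_o[OF _ ca]
          continuous_map_fst continuous_map_snd)
      moreover have "{t \<in> topspace (prod_topology Z Z). a (fst t) = a (snd t)} = topspace
        (prod_topology Z Z) \<inter> ?S" by auto
      ultimately show ?thesis by simp
    qed
    have pI: "continuous_map ?I Z fst" "continuous_map ?I Z snd"
      by (auto intro: continuous_map_subtopology_fst continuous_map_subtopology_snd)
    \<comment> \<open>Both points have the same first coordinate, so dividing their second
      coordinates in \<open>H\<close> is enough.\<close>
    let ?k = "\<lambda>t. gmult H (ginv H (b (fst t))) (b (snd t))"
    have k: "?k t \<in> arrows H" "grng H (?k t) = s (fst t)" "gsrc H (?k t) = s (snd t)"
      if "t \<in> topspace ?I" for t
      using that b unfolding s_def by auto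
    have "continuous_map ?I (gtop H) ?k"
      by (intro H.continuous_mult_comp H.continuous_inv_comp continuous_map_o[OF pI(1) cb]
        continuous_map_o[OF pI(2) cb])
        (use b in auto)
    then have cD: "continuous_map ?I ?ZH (\<lambda>t. (fst t, ?k t))"
      unfolding continuous_map_in_subtopology[of ?I "prod_topology Z (gtop H)"]
      using k pI(1) by (auto simp: right_fibred_def intro!: continuous_map_pairedI)
    have cE: "continuous_map ?ZH ?I (\<lambda>(z, h). (z, ract z h))"
      unfolding continuous_map_in_subtopology
      using continuous_map_pairedI[OF pH(1) cr] r by (auto simp: case_prod_unfold right_fibred_def)
    have "homeomorphic_maps ?ZH ?I (\<lambda>(z, h). (z, ract z h)) (\<lambda>t. (fst t, ?k t))"
      unfolding homeomorphic_maps_def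
    proof (intro conjI cD cE ballI)
      fix t assume "t \<in> topspace ?ZH"
      then obtain z h where t: "t = (z, h)" "h \<in> arrows H" "z \<in> topspace Z" "s z = grng H h"
        unfolding tZH right_fibred_def by auto
      then show "(\<lambda>t. (fst t, ?k t)) ((\<lambda>(z, h). (z, ract z h)) t) = t"
        using r[OF t(2-4)] b[OF t(3)] unfolding s_def by simp
    next
      fix t assume t: "t \<in> topspace ?I"
      then have z: "fst t \<in> topspace Z" "snd t \<in> topspace Z" "a (fst t) = a (snd t)" by auto
      have "gmult H (b (fst t)) (?k t) = b (snd t)" using b z by simp
      then have "ract (fst t) (?k t) = snd t" unfolding ract_def using z eab[OF z(2)] by simp
      then show "(\<lambda>(z, h). (z, ract z h)) (fst t, ?k t) = t" by simp
    qed
    from homeomorphic_closed_imp_proper[OF this cl1] show ?thesis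
      unfolding right_free_proper_def tZH by blast
  qed
  have "induces_homeomorphism Z (right_orbit H s ract) (unit_space G) a"
  proof (rule induces_homeomorphismI[OF ca local_homeomorphismD(2)[OF lha]])
    show "a ` topspace Z = topspace (unit_space G)"
    proof
      show "topspace (unit_space G) \<subseteq> a ` topspace Z"
      proof
        fix u assume "u \<in> topspace (unit_space G)"
        then have "u \<in> units G" by simp
        then show "u \<in> a ` topspace Z" using e[of u "\<rho> u"] \<rho>u[of u]
          by (intro image_eqI[of _ _ "e (u, \<rho> u)"]) auto
      qed
    qed (use a in auto)
    have orb: "right_orbit H s ract z = {z' \<in> topspace Z. a z' = a z}" if z: "z \<in> topspace Z" for z
    proof (intro set_eqI iffI)
      fix w assume "w \<in> right_orbit H s ract z"
      then show "w \<in> {z' \<in> topspace Z. a z' = a z}" using r z unfolding right_orbit_def by auto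
    next
      fix w assume "w \<in> {z' \<in> topspace Z. a z' = a z}"
      then have w: "w \<in> topspace Z" "a w = a z" by auto
      let ?h = "gmult H (ginv H (b z)) (b w)"
      have "ract z ?h = w" unfolding ract_def using b[OF z] b[OF w(1)] w eab[OF w(1)] by simp
      moreover have "?h \<in> arrows H" "s z = grng H ?h" using b[OF z] b[OF w(1)] w unfolding s_def by auto
      ultimately show "w \<in> right_orbit H s ract z" unfolding right_orbit_def
        by (intro CollectI exI[of _ ?h]) simp
    qed
    show "right_orbit H s ract x = right_orbit H s ract y \<longleftrightarrow> a x = a y"
      if "x \<in> topspace Z" "y \<in> topspace Z" for x y
      using that by (auto simp: orb)
  qed
  moreover have "induces_homeomorphism Z (left_orbit G a lact) (unit_space H) s"
  proof (rule induces_homeomorphismI[OF cs local_homeomorphismD(2)[OF lhs]])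
    show "s ` topspace Z = topspace (unit_space H)"
    proof
      show "topspace (unit_space H) \<subseteq> s ` topspace Z"
      proof
        fix v assume "v \<in> topspace (unit_space H)"
        then obtain h x where "h \<in> arrows H" "x \<in> units G" "grng H h = v" "gsrc H h = \<rho> x"
          using bridge.q_full[OF br, of v] by auto
        then show "v \<in> s ` topspace Z"
          using e[of x "ginv H h"] unfolding s_def by (intro image_eqI[of _ _ "e (x, ginv H h)"]) auto
      qed
    qed (use b in \<open>auto simp: s_def\<close>)
    have orb: "left_orbit G a lact z = {z' \<in> topspace Z. s z' = s z}" if z: "z \<in> topspace Z" for z
    proof (intro set_eqI iffI)
      fix w assume "w \<in> left_orbit G a lact z"
      then show "w \<in> {z' \<in> topspace Z. s z' = s z}" using l z unfolding left_orbit_def by auto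
    next
      fix w assume "w \<in> {z' \<in> topspace Z. s z' = s z}"
      then have w: "w \<in> topspace Z" "gsrc H (b w) = gsrc H (b z)" unfolding s_def by auto
      let ?k = "gmult H (b w) (ginv H (b z))"
      let ?g = "f' (a w) ?k (a z)"
      have k: "?k \<in> arrows H" "grng H ?k = \<rho> (a w)" "gsrc H ?k = \<rho> (a z)" "gmult H ?k (b z) = b w"
        using b[OF z] b[OF w(1)] w by auto
      note g = ff'[OF a[OF w(1)] a[OF z] k(1-3)]
      have "lact ?g z = w" unfolding lact_def using g k(4) eab[OF w(1)] by simp
      then show "w \<in> left_orbit G a lact z"
        unfolding left_orbit_def using g by (intro CollectI exI[of _ ?g]) simp
    qed
    show "left_orbit G a lact x = left_orbit G a lact y \<longleftrightarrow> s x = s y"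
      if "x \<in> topspace Z" "y \<in> topspace Z" for x y
      using that by (auto simp: orb)
  qed
  ultimately show ?thesis unfolding Renault_equivalent_def using ls lfp rs rfp comm by blast
qed

lemma Renault_imp_bridge:
  assumes G: "ample_Hausdorff_groupoid G" and H: "ample_Hausdorff_groupoid H"
    and R: "Renault_equivalent TYPE('u) G H"
  obtains X :: "'u topology" and p q f f' where "bridge G H X p q f f'"
    "locally_compact_space X" "Hausdorff_space X" "p ` topspace X = units G" "q ` topspace X = units H"
proof -
  obtain Z :: "'u topology" and r s lact ract where
    lsp: "left_space G Z r lact" and lfp: "left_free_proper G Z r lact"
    and rsp: "right_space H Z s ract" and rfp: "right_free_proper H Z s ract"
    and comm: "actions_commute G H Z r s lact ract"
    and r: "induces_homeomorphism Z (right_orbit H s ract) (unit_space G) r"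
    and s: "induces_homeomorphism Z (left_orbit G r lact) (unit_space H) s"
    using R unfolding Renault_equivalent_def by blast
  obtain f f' where "bridge G H Z r s f f'"
    by (rule Renault_bridge[OF G H lsp lfp rsp rfp comm r s])
  moreover have "locally_compact_space Z" "Hausdorff_space Z" using lsp unfolding left_space_def by auto
  ultimately show ?thesis
    using that induces_homeomorphismD(1)[OF r] induces_homeomorphismD(1)[OF s] by simp
qed

section \<open>The equivalence theorem\<close>

theorem theorem3p12:
  fixes G :: "'a grpd" and H :: "'b grpd"
  assumes "ample_Hausdorff_groupoid G" and "sigma_compact_space (unit_space G)"
    and "ample_Hausdorff_groupoid H" and "sigma_compact_space (unit_space H)"
  shows "(similar G H \<longleftrightarrow> Morita_equivalent TYPE(('a, 'b, 'w) universe) G H) \<and>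
         (similar G H \<longleftrightarrow> has_linking_groupoid TYPE(('a, 'b, 'w) universe) G H) \<and>
         (similar G H \<longleftrightarrow> Renault_equivalent TYPE(('a, 'b, 'w) universe) G H) \<and>
         (similar G H \<longleftrightarrow> isomorphic_ampliations TYPE(('a, 'b, 'w) universe) G H) \<and>
         (similar G H \<longleftrightarrow> G \<times>\<^sub>G \<R> \<cong>\<^sub>G H \<times>\<^sub>G \<R>) \<and>
         (similar G H \<longleftrightarrow> Kakutani_equivalent G H) \<and>
         (similar G H \<longleftrightarrow> weakly_Kakutani_equivalent G H)"
proof -
  note G = assms(1,2) and H = assms(3,4)
  note aG = ample_unit_space[OF G(1)] and aH = ample_unit_space[OF H(1)]
  let ?S = "G \<times>\<^sub>G \<R> \<cong>\<^sub>G H \<times>\<^sub>G \<R>"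
  let ?U = "TYPE(('a, 'b, 'w) universe)"
  have S6: ?S if "bridge G H X p q f f'" for X :: "'x topology" and p q f f'
    by (rule bridge.bridge_imp_stably_isomorphic[OF that G H])
  have 1: ?S if sim: "similar G H"
  proof -
    obtain \<rho> f' where "bridge G H (unit_space G) (\<lambda>x. x) \<rho> (\<lambda>x g y. \<rho> g) f'"
      by (rule similar_imp_bridge[OF G(1) H(1) sim])
    then show ?thesis by (rule S6)
  qed
  have 2: ?S if m: "Morita_equivalent ?U G H"
    by (rule Morita_imp_bridge[OF G(1) H(1) m]) (rule S6)
  have 3: ?S if m: "has_linking_groupoid ?U G H"
    by (rule linking_imp_stably_isomorphic[OF G H m])
  have 4: ?S if m: "Renault_equivalent ?U G H"
    by (rule Renault_imp_bridge[OF G(1) H(1) m]) (rule S6)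
  have 5: ?S if m: "isomorphic_ampliations ?U G H"
    by (rule isomorphic_ampliations_imp_bridge[OF G(1) H(1) m]) (rule S6)
  have 8: ?S if m: "weakly_Kakutani_equivalent G H"
    by (rule weakly_Kakutani_imp_bridge[OF G(1) H(1) m]) (rule S6)
  have 78: "weakly_Kakutani_equivalent G H" if "Kakutani_equivalent G H"
    using that unfolding Kakutani_equivalent_def weakly_Kakutani_equivalent_def clopenin_def by blast
  have all: "similar G H \<and> Morita_equivalent ?U G H \<and> has_linking_groupoid ?U G H
    \<and> Renault_equivalent ?U G H \<and>
      isomorphic_ampliations ?U G H \<and> Kakutani_equivalent G H" if S: ?S
  proof -
    have sim: "similar G H" by (rule stably_isomorphic_imp_similar[OF aG(6) aH(6) S])
    \<comment> \<open>A bridge over the units of \<open>G\<close> whose arrow map is a homomorphism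
      is wanted here: the bibundle is built from such a \<rho>.\<close>
    obtain \<rho> f' where br: "bridge G H (unit_space G) (\<lambda>x. x) \<rho> (\<lambda>x g y. \<rho> g) f'"
      by (rule similar_imp_bridge[OF G(1) H(1) sim])
    let ?a = "\<lambda>x. (Inl x :: 'a + 'b + nat + 'w)" and ?b = "\<lambda>y. (Inr (Inl y) :: 'a + 'b + nat + 'w)"
    have "inj (\<lambda>x. [?a x])" by (auto simp: inj_def)
    then have M: "Morita_equivalent ?U G H" by (rule stably_isomorphic_imp_Morita[OF G(1) H(1) S])
    let ?n = "\<lambda>n. (Inr (Inr (Inl n)) :: 'a + 'b + nat + 'w)"
    \<comment> \<open>An arrow of \<open>G\<close> with two pairs of indices becomes a list of five
      tagged entries.\<close>
    have "inj (\<lambda>((g, i, j), k, l). [?a g, ?n i, ?n j, ?n k, ?n l])" by (auto simp: inj_def)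
    then have L: "has_linking_groupoid ?U G H"
      by (rule linking_transport[OF _ stably_isomorphic_imp_linking[OF G(1) H(1) S]])
    have "inj (\<lambda>(x, y). [?a x, ?b y])" by (auto simp: inj_def)
    from similar_bridge_imp_Renault[OF G(1) H(1) br quotient_topology_homeomorphic[OF this]]
    have R: "Renault_equivalent ?U G H" .
    \<comment> \<open>A Renault space lies in the universe already, is locally compact Hausdorff,
      and both of its maps are onto. It therefore gives the ampliations, and its bridge also gives
      Kakutani equivalence.\<close>
    obtain X :: "('a, 'b, 'w) universe topology" and p q f f' where X: "bridge G H X p q f f'"
      "locally_compact_space X" "Hausdorff_space X" "p ` topspace X = units G" "q ` topspace X
        = units H"
      by (rule Renault_imp_bridge[OF G(1) H(1) R])
    have "isomorphic_ampliations ?U G H"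
      using bridge_surjective_imp_isomorphic_ampliations[OF X]
        unfolding isomorphic_ampliations_def by blast
    then show ?thesis
      using sim M L R bridge.bridge_surjective_imp_Kakutani[OF X(1) G H X(4,5)] by blast
  qed
  show ?thesis using 1 2 3 4 5 8 78 all by blast
qed

end
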